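(* Let $\{(\mathcal{A}_i,\varphi_i):i\in I\}$ be a family of noncommutative probability spaces. For any $n\in\mathbb{N}$ and any $a_1\in\mathcal{A}_{i_1},\dots,a_n\in\mathcal{A}_{i_n}$, where $i_1\neq\cdots\neq i_n$, $$(\star_{i\in I}\varphi_i)(a_1\cdots a_n)=\sum_{w=j_1\cdots j_n\in\mathcal{M}_n}\Phi(a_1(j_1)\cdots a_n(j_n)),$$ where $a_k(j_k)$ is the orthogonal replica of $a_k$ of color $j_k$ for $k=1,\dots,n$.
   Context: **Probability spaces and notation.** $\mathbb{N}=\{1,2,\dots\}$. A noncommutative probability space $(\mathcal{A},\varphi)$ is a unital complex algebra with a linear functional $\varphi$ such that $\varphi(1)=1$. The unit of $\mathcal{A}_i$ is $1_i$. The notation $i_1\neq\cdots\neq i_n$ means that $i_k\neq i_{k+1}$ for all $k$. $\star_{i\in I}\varphi_i$ is Voiculescu's free product of the functionals $\varphi_i$, defined on the free product $\star_{i\in I}\mathcal{A}_i$ of unital algebras with identified units; on the left-hand side $a_1\cdots a_n$ is a product in $\star_{i\in I}\mathcal{A}_i$. **Orthogonal replicas.** For each $i\in I$ let $p_i$ be an abstract idempotent ($p_i^2=p_i$) and let $\widetilde{\mathcal{A}}_i=\mathcal{A}_i\star\mathbb{C}[p_i]$ (free product with identified units, where $\mathbb{C}[p_i]$ is the unital algebra generated by $p_i$), with the linear functional $\widetilde\varphi_i$ determined by $\widetilde\varphi_i(p_i)=1$ and $\widetilde\varphi_i(p_i^{\gamma}a_1p_ia_2p_i\cdots p_ia_mp_i^{\delta})=\varphi_i(a_1)\cdots\varphi_i(a_m)$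 for $\gamma,\delta\in\{0,1\}$, $a_1,\dots,a_m\in\mathcal{A}_i$. Let $\mathcal{A}_\otimes=\bigotimes_{i\in I}\widetilde{\mathcal{A}}_i^{\otimes\infty}$ be the infinite tensor product spanned by simple tensors $\bigotimes_{i\in I}\bigotimes_{k=1}^\infty x_{i,k}$ with $x_{i,k}\in\widetilde{\mathcal{A}}_i$ and $x_{i,k}\notin\{1_i,p_i\}$ for only finitely many sites $(i,k)$ (multilinear in the entries, multiplied sitewise), and let $\Phi_\otimes$ be the linear functional with $\Phi_\otimes(\bigotimes x_{i,k})=\prod_{i,k}\widetilde\varphi_i(x_{i,k})$. For $i\in I$ and $j\in\mathbb{N}$ let $P_i(j)$ be the simple tensor with $1_i$ at all sites $(i,m)$ and, for each $k\neq i$, with $1_k$ at sites $(k,m)$, $m\le j-1$, and $p_k$ at sites $(k,m)$, $m\geq j$; put $P_i(0)=0$ and $p_i(j)=P_i(j)-P_i(j-1)$. For $a\in\mathcal{A}_i$ let $\iota_j(a)$ be the simple tensor with $a$ at site $(i,j)$ and units elsewhere. The orthogonal replica of $a\in\mathcal{A}_i$ of label $i$ and color $j$ is $a(j)=\iota_j(a)\,p_i(j)$. Let $\mathcal{A}_{\rm rep}$ be the unital subalgebra of $\mathcal{A}_\otimes$ generated by all replicas, and let $\Phi$ be the restriction of $\Phi_\otimes$ to $\mathcal{A}_{\rm rep}$. **Motzkin words.** $\mathcal{M}_n$ is the set of reduced Motzkin words of length $n$, i.e. words $w=j_1\cdots j_n$ in letters from $\mathbb{N}$ with $j_1=j_n=1$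 and $|j_k-j_{k-1}|\in\{0,1\}$ for $1<k\le n$. *)

theory Defs
  imports Complex_Main "HOL-Algebra.QuotRing" "HOL-Algebra.Module" "HOL-Library.Poly_Mapping" "HOL-Library.FuncSet"
begin

section \<open>Unital complex algebras and noncommutative probability spaces\<close>

definition complex_ring :: "complex ring" where
  "complex_ring = \<lparr>carrier = UNIV, mult = (*), one = 1, zero = 0, add = (+)\<rparr>"

text \<open>The locale \<^locale>\<open>algebra\<close> of HOL-Algebra requires commutativity, hence this variant.\<close>

locale complex_algebra = module complex_ring A + ring A for A (structure) +
  assumes smult_assoc_left:
      "x \<in> carrier A \<Longrightarrow> y \<in> carrier A \<Longrightarrow> (c \<odot> x) \<otimes> y = c \<odot> (x \<otimes> y)"
    and smult_assoc_right:
      "x \<in> carrier A \<Longrightarrow> y \<in> carrier A \<Longrightarrow> x \<otimes> (c \<odot> y) = c \<odot> (x \<otimes> y)"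

definition linear_functional :: "(complex, 'a) module \<Rightarrow> ('a \<Rightarrow> complex) \<Rightarrow> bool" where
  "linear_functional A f \<longleftrightarrow>
     (\<forall>x\<in>carrier A. \<forall>y\<in>carrier A. f (x \<oplus>\<^bsub>A\<^esub> y) = f x + f y) \<and>
     (\<forall>c. \<forall>x\<in>carrier A. f (c \<odot>\<^bsub>A\<^esub> x) = c * f x)"

locale nc_probability_space = complex_algebra A for A (structure) +
  fixes \<phi> :: "'a \<Rightarrow> complex"
  assumes functional_linear: "linear_functional A \<phi>"
    and functional_one: "\<phi> \<one> = 1"

definition list_prod :: "('a, 'b) monoid_scheme \<Rightarrow> 'a list \<Rightarrow> 'a" where
  "list_prod A xs = foldr (mult A) xs \<one>\<^bsub>A\<^esub>"

inductive_set generated_subalgebra :: "(complex, 'a) module \<Rightarrow> 'a set \<Rightarrow> 'a set"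
  for A :: "(complex, 'a) module" and S :: "'a set" where
  one: "\<one>\<^bsub>A\<^esub> \<in> generated_subalgebra A S"
| incl: "x \<in> S \<Longrightarrow> x \<in> generated_subalgebra A S"
| add: "x \<in> generated_subalgebra A S \<Longrightarrow> y \<in> generated_subalgebra A S \<Longrightarrow>
    x \<oplus>\<^bsub>A\<^esub> y \<in> generated_subalgebra A S"
| smult: "x \<in> generated_subalgebra A S \<Longrightarrow> c \<odot>\<^bsub>A\<^esub> x \<in> generated_subalgebra A S"
| mult: "x \<in> generated_subalgebra A S \<Longrightarrow> y \<in> generated_subalgebra A S \<Longrightarrow>
    x \<otimes>\<^bsub>A\<^esub> y \<in> generated_subalgebra A S"


section \<open>Monoid algebras and quotients\<close>

definition monoid_algebra :: "('m, 'b) monoid_scheme \<Rightarrow> (complex, 'm \<Rightarrow>\<^sub>0 complex) module" where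
  "monoid_algebra M =
    \<lparr>carrier = {f. Poly_Mapping.keys f \<subseteq> carrier M},
     mult = (\<lambda>f g. \<Sum>x\<in>Poly_Mapping.keys f. \<Sum>y\<in>Poly_Mapping.keys g.
       Poly_Mapping.single (x \<otimes>\<^bsub>M\<^esub> y) (Poly_Mapping.lookup f x * Poly_Mapping.lookup g y)),
     one = Poly_Mapping.single \<one>\<^bsub>M\<^esub> 1,
     zero = 0,
     add = (+),
     smult = (\<lambda>c. Poly_Mapping.map ((*) c))\<rparr>"

definition word_monoid :: "'x set \<Rightarrow> 'x list monoid" where
  "word_monoid X = \<lparr>carrier = lists X, mult = (@), one = []\<rparr>"

abbreviation free_algebra :: "'x set \<Rightarrow> (complex, 'x list \<Rightarrow>\<^sub>0 complex) module" where
  "free_algebra X \<equiv> monoid_algebra (word_monoid X)"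

abbreviation quot_map :: "(complex, 'a) module \<Rightarrow> 'a set \<Rightarrow> 'a \<Rightarrow> 'a set" where
  "quot_map A S x \<equiv> genideal A S +>\<^bsub>A\<^esub> x"

text \<open>The quotient of a unital algebra \<open>A\<close> by the two-sided ideal generated by \<open>S\<close>. Ring ideals of
  a unital algebra are closed under scalars, so the ring quotient inherits the scalar
  multiplication.\<close>

definition quot_algebra :: "(complex, 'a) module \<Rightarrow> 'a set \<Rightarrow> (complex, 'a set) module" where
  "quot_algebra A S =
    \<lparr>carrier = carrier (A Quot genideal A S),
     mult = mult (A Quot genideal A S),
     one = one (A Quot genideal A S),
     zero = zero (A Quot genideal A S),
     add = add (A Quot genideal A S),
     smult = (\<lambda>c X. \<Union>x\<in>X. quot_map A S (c \<odot>\<^bsub>A\<^esub> x))\<rparr>"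


section \<open>Free products with identified units\<close>

text \<open>The relations which turn \<open>a \<mapsto> [e a]\<close> into a unital algebra homomorphism from \<open>A\<close> into
  the quotient of a free algebra. The free product is the quotient of the free algebra on the
  disjoint union of the factors by these relations.\<close>

definition hom_relations :: "(complex, 'a) module \<Rightarrow> ('a \<Rightarrow> 'x) \<Rightarrow> ('x list \<Rightarrow>\<^sub>0 complex) set" where
  "hom_relations A e =
    {Poly_Mapping.single [e (a \<oplus>\<^bsub>A\<^esub> b)] 1 - Poly_Mapping.single [e a] 1 - Poly_Mapping.single [e b] 1
       | a b. a \<in> carrier A \<and> b \<in> carrier A} \<union>
    {Poly_Mapping.single [e (c \<odot>\<^bsub>A\<^esub> a)] 1 - Poly_Mapping.single [e a] c
       | c a. a \<in> carrier A} \<union>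
    {Poly_Mapping.single [e (a \<otimes>\<^bsub>A\<^esub> b)] 1 - Poly_Mapping.single [e a, e b] 1
       | a b. a \<in> carrier A \<and> b \<in> carrier A} \<union>
    {Poly_Mapping.single [e \<one>\<^bsub>A\<^esub>] 1 - Poly_Mapping.single [] 1}"

type_synonym ('i, 'a) free_elt = "(('i \<times> 'a) list \<Rightarrow>\<^sub>0 complex) set"

definition free_product ::
    "'i set \<Rightarrow> ('i \<Rightarrow> (complex, 'a) module) \<Rightarrow> (complex, ('i, 'a) free_elt) module" where
  "free_product I A =
    quot_algebra (free_algebra (SIGMA i:I. carrier (A i))) (\<Union>i\<in>I. hom_relations (A i) (Pair i))"

definition free_emb ::
    "'i set \<Rightarrow> ('i \<Rightarrow> (complex, 'a) module) \<Rightarrow> 'i \<Rightarrow> 'a \<Rightarrow> ('i, 'a) free_elt" where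
  "free_emb I A i a =
    quot_map (free_algebra (SIGMA i:I. carrier (A i))) (\<Union>i\<in>I. hom_relations (A i) (Pair i))
      (Poly_Mapping.single [(i, a)] 1)"

text \<open>Voiculescu's free product of functionals: the unique unital linear functional on the free
  product which extends all \<open>\<phi> i\<close> and makes the factors free.\<close>

definition free_product_functional ::
    "'i set \<Rightarrow> ('i \<Rightarrow> (complex, 'a) module) \<Rightarrow> ('i \<Rightarrow> 'a \<Rightarrow> complex) \<Rightarrow>
     ('i, 'a) free_elt \<Rightarrow> complex" where
  "free_product_functional I A \<phi> =
    (THE \<psi>. \<psi> \<in> extensional (carrier (free_product I A)) \<and>
       linear_functional (free_product I A) \<psi> \<and>
       \<psi> \<one>\<^bsub>free_product I A\<^esub> = 1 \<and>
       (\<forall>i\<in>I. \<forall>a\<in>carrier (A i). \<psi> (free_emb I A i a) = \<phi> i a) \<and>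
       (\<forall>(n::nat) i a. 1 \<le> n \<longrightarrow>
          (\<forall>k<n. i k \<in> I \<and> a k \<in> carrier (A (i k)) \<and> \<phi> (i k) (a k) = 0) \<longrightarrow>
          (\<forall>k. Suc k < n \<longrightarrow> i k \<noteq> i (Suc k)) \<longrightarrow>
          \<psi> (list_prod (free_product I A) (map (\<lambda>k. free_emb I A (i k) (a k)) [0..<n])) = 0))"


section \<open>Extension by an idempotent\<close>

text \<open>\<open>\<complex>[p]\<close> with \<open>p\<^sup>2 = p\<close>; here \<open>(x, y)\<close> stands for \<open>x 1 + y p\<close>.\<close>

definition idem_algebra :: "(complex, complex \<times> complex) module" where
  "idem_algebra =
    \<lparr>carrier = UNIV,
     mult = (\<lambda>(x, y) (x', y'). (x * x', x * y' + y * x' + y * y')),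
     one = (1, 0),
     zero = (0, 0),
     add = (\<lambda>(x, y) (x', y'). (x + x', y + y')),
     smult = (\<lambda>c (x, y). (c * x, c * y))\<rparr>"

type_synonym 'a ext_elt = "(('a + complex \<times> complex) list \<Rightarrow>\<^sub>0 complex) set"

definition ext_algebra :: "(complex, 'a) module \<Rightarrow> (complex, 'a ext_elt) module" where
  "ext_algebra A =
    quot_algebra (free_algebra (carrier A <+> carrier idem_algebra))
      (hom_relations A Inl \<union> hom_relations idem_algebra Inr)"

definition ext_emb :: "(complex, 'a) module \<Rightarrow> 'a \<Rightarrow> 'a ext_elt" where
  "ext_emb A a =
    quot_map (free_algebra (carrier A <+> carrier idem_algebra))
      (hom_relations A Inl \<union> hom_relations idem_algebra Inr) (Poly_Mapping.single [Inl a] 1)"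

definition ext_idem :: "(complex, 'a) module \<Rightarrow> 'a ext_elt" where
  "ext_idem A =
    quot_map (free_algebra (carrier A <+> carrier idem_algebra))
      (hom_relations A Inl \<union> hom_relations idem_algebra Inr) (Poly_Mapping.single [Inr (0, 1)] 1)"

text \<open>For \<open>as = [a\<^sub>1, \<dots>, a\<^sub>m]\<close>, the product \<open>a\<^sub>1 p a\<^sub>2 p \<dots> p a\<^sub>m\<close>.\<close>

definition idem_word :: "(complex, 'a) module \<Rightarrow> 'a list \<Rightarrow> 'a ext_elt" where
  "idem_word A as =
    list_prod (ext_algebra A)
      (splice (map (ext_emb A) as) (replicate (length as - 1) (ext_idem A)))"

definition ext_functional ::
    "(complex, 'a) module \<Rightarrow> ('a \<Rightarrow> complex) \<Rightarrow> 'a ext_elt \<Rightarrow> complex" where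
  "ext_functional A \<phi> =
    (THE \<psi>. \<psi> \<in> extensional (carrier (ext_algebra A)) \<and>
       linear_functional (ext_algebra A) \<psi> \<and>
       \<psi> (ext_idem A) = 1 \<and>
       (\<forall>\<gamma>\<in>{0, 1::nat}. \<forall>\<delta>\<in>{0, 1::nat}. \<forall>as. as \<noteq> [] \<longrightarrow> set as \<subseteq> carrier A \<longrightarrow>
          \<psi> (ext_idem A [^]\<^bsub>ext_algebra A\<^esub> \<gamma> \<otimes>\<^bsub>ext_algebra A\<^esub> idem_word A as
               \<otimes>\<^bsub>ext_algebra A\<^esub> ext_idem A [^]\<^bsub>ext_algebra A\<^esub> \<delta>) = prod_list (map \<phi> as)))"


section \<open>The infinite tensor product\<close>

text \<open>Sites are pairs \<open>(i, k)\<close> of a label and a positive integer.\<close>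

abbreviation sites :: "'i set \<Rightarrow> ('i \<times> nat) set" where
  "sites I \<equiv> I \<times> {1..}"

definition tensor_support ::
    "'i set \<Rightarrow> ('i \<Rightarrow> (complex, 'a) module) \<Rightarrow> ('i \<times> nat \<Rightarrow> 'a ext_elt) \<Rightarrow> ('i \<times> nat) set" where
  "tensor_support I A x =
    {s \<in> sites I. x s \<notin> {\<one>\<^bsub>ext_algebra (A (fst s))\<^esub>, ext_idem (A (fst s))}}"

text \<open>The families \<open>(x\<^sub>i\<^sub>,\<^sub>k)\<close> which index the simple tensors, with sitewise multiplication.\<close>

definition tensor_monoid ::
    "'i set \<Rightarrow> ('i \<Rightarrow> (complex, 'a) module) \<Rightarrow> ('i \<times> nat \<Rightarrow> 'a ext_elt) monoid" where
  "tensor_monoid I A =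
    \<lparr>carrier = {x \<in> (\<Pi>\<^sub>E s\<in>sites I. carrier (ext_algebra (A (fst s)))).
        finite (tensor_support I A x)},
     mult = (\<lambda>x y. \<lambda>s\<in>sites I. x s \<otimes>\<^bsub>ext_algebra (A (fst s))\<^esub> y s),
     one = (\<lambda>s\<in>sites I. \<one>\<^bsub>ext_algebra (A (fst s))\<^esub>)\<rparr>"

text \<open>Linearity in each entry. The span of these relations is already an ideal of the monoid
  algebra, so dividing by the ideal they generate imposes multilinearity and nothing else.\<close>

definition tensor_relations ::
    "'i set \<Rightarrow> ('i \<Rightarrow> (complex, 'a) module) \<Rightarrow> (('i \<times> nat \<Rightarrow> 'a ext_elt) \<Rightarrow>\<^sub>0 complex) set" where
  "tensor_relations I A =
    {Poly_Mapping.single (x(s := u \<oplus>\<^bsub>ext_algebra (A (fst s))\<^esub> v)) 1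
       - Poly_Mapping.single (x(s := u)) 1 - Poly_Mapping.single (x(s := v)) 1
       | x s u v. x \<in> carrier (tensor_monoid I A) \<and> s \<in> sites I \<and>
           u \<in> carrier (ext_algebra (A (fst s))) \<and> v \<in> carrier (ext_algebra (A (fst s)))} \<union>
    {Poly_Mapping.single (x(s := c \<odot>\<^bsub>ext_algebra (A (fst s))\<^esub> u)) 1
       - Poly_Mapping.single (x(s := u)) c
       | x s c u. x \<in> carrier (tensor_monoid I A) \<and> s \<in> sites I \<and>
           u \<in> carrier (ext_algebra (A (fst s)))}"

type_synonym ('i, 'a) tensor_elt = "(('i \<times> nat \<Rightarrow> 'a ext_elt) \<Rightarrow>\<^sub>0 complex) set"

definition tensor_algebra ::
    "'i set \<Rightarrow> ('i \<Rightarrow> (complex, 'a) module) \<Rightarrow> (complex, ('i, 'a) tensor_elt) module" where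
  "tensor_algebra I A = quot_algebra (monoid_algebra (tensor_monoid I A)) (tensor_relations I A)"

definition simple_tensor ::
    "'i set \<Rightarrow> ('i \<Rightarrow> (complex, 'a) module) \<Rightarrow> ('i \<times> nat \<Rightarrow> 'a ext_elt) \<Rightarrow> ('i, 'a) tensor_elt" where
  "simple_tensor I A x =
    quot_map (monoid_algebra (tensor_monoid I A)) (tensor_relations I A) (Poly_Mapping.single x 1)"

text \<open>Outside of the support of \<open>x\<close> all factors of the product over the sites equal 1, because
  the extended functional takes the value 1 on the unit and on the idempotent.\<close>

definition tensor_functional ::
    "'i set \<Rightarrow> ('i \<Rightarrow> (complex, 'a) module) \<Rightarrow> ('i \<Rightarrow> 'a \<Rightarrow> complex) \<Rightarrow>
     ('i, 'a) tensor_elt \<Rightarrow> complex" where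
  "tensor_functional I A \<phi> =
    (THE \<Psi>. \<Psi> \<in> extensional (carrier (tensor_algebra I A)) \<and>
       linear_functional (tensor_algebra I A) \<Psi> \<and>
       (\<forall>x\<in>carrier (tensor_monoid I A).
          \<Psi> (simple_tensor I A x) =
            (\<Prod>s\<in>tensor_support I A x. ext_functional (A (fst s)) (\<phi> (fst s)) (x s))))"


section \<open>Orthogonal replicas\<close>

text \<open>The elements \<open>P\<^sub>i(j)\<close> and their increments \<open>p\<^sub>i(j)\<close>.\<close>

definition replica_cumul ::
    "'i set \<Rightarrow> ('i \<Rightarrow> (complex, 'a) module) \<Rightarrow> 'i \<Rightarrow> nat \<Rightarrow> ('i, 'a) tensor_elt" where
  "replica_cumul I A i j =
    (if j = 0 then \<zero>\<^bsub>tensor_algebra I A\<^esub>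
     else simple_tensor I A (\<lambda>(k, m)\<in>sites I.
       if k \<noteq> i \<and> j \<le> m then ext_idem (A k) else \<one>\<^bsub>ext_algebra (A k)\<^esub>))"

definition replica_proj ::
    "'i set \<Rightarrow> ('i \<Rightarrow> (complex, 'a) module) \<Rightarrow> 'i \<Rightarrow> nat \<Rightarrow> ('i, 'a) tensor_elt" where
  "replica_proj I A i j =
    replica_cumul I A i j \<ominus>\<^bsub>tensor_algebra I A\<^esub> replica_cumul I A i (j - 1)"

definition site_emb ::
    "'i set \<Rightarrow> ('i \<Rightarrow> (complex, 'a) module) \<Rightarrow> 'i \<Rightarrow> nat \<Rightarrow> 'a \<Rightarrow> ('i, 'a) tensor_elt" where
  "site_emb I A i j a =
    simple_tensor I A (\<lambda>s\<in>sites I.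
      if s = (i, j) then ext_emb (A i) a else \<one>\<^bsub>ext_algebra (A (fst s))\<^esub>)"

text \<open>The orthogonal replica \<open>a(j)\<close> of label \<open>i\<close> and color \<open>j \<ge> 1\<close>.\<close>

definition replica ::
    "'i set \<Rightarrow> ('i \<Rightarrow> (complex, 'a) module) \<Rightarrow> 'i \<Rightarrow> nat \<Rightarrow> 'a \<Rightarrow> ('i, 'a) tensor_elt" where
  "replica I A i j a = site_emb I A i j a \<otimes>\<^bsub>tensor_algebra I A\<^esub> replica_proj I A i j"

definition replica_algebra ::
    "'i set \<Rightarrow> ('i \<Rightarrow> (complex, 'a) module) \<Rightarrow> ('i, 'a) tensor_elt set" where
  "replica_algebra I A =
    generated_subalgebra (tensor_algebra I A)
      {replica I A i j a | i j a. i \<in> I \<and> 1 \<le> j \<and> a \<in> carrier (A i)}"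

definition replica_functional ::
    "'i set \<Rightarrow> ('i \<Rightarrow> (complex, 'a) module) \<Rightarrow> ('i \<Rightarrow> 'a \<Rightarrow> complex) \<Rightarrow>
     ('i, 'a) tensor_elt \<Rightarrow> complex" where
  "replica_functional I A \<phi> = restrict (tensor_functional I A \<phi>) (replica_algebra I A)"


section \<open>Reduced Motzkin words\<close>

definition motzkin_words :: "nat \<Rightarrow> nat list set" where
  "motzkin_words n =
    {w. length w = n \<and> w \<noteq> [] \<and> (\<forall>j\<in>set w. 1 \<le> j) \<and> hd w = 1 \<and> last w = 1 \<and>
       (\<forall>k. Suc k < n \<longrightarrow> \<bar>int (w ! Suc k) - int (w ! k)\<bar> \<in> {0, 1})}"

end

theory Submission
  imports Defs
begin

text \<open>The free product functional is computed by absorbing the letters of a word, from right to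
  left, into a reduced word \<open>\<xi>\<close> of centered letters with alternating labels: absorbing \<open>a\<close> produces
  the word with a new centered head plus a multiple of the remaining word. Put the letters of \<open>\<xi>\<close> on
  the sites of the tensor product, the letter in position \<open>m\<close> from the right at color \<open>m\<close>. The
  idempotents evaluate centered letters to zero, so a replica \<open>a(j)\<close> annihilates this tensor except for one
  color \<open>j\<close>, for which it acts exactly as the absorption of \<open>a\<close>. Since consecutive labels of the
  word differ, the surviving colors change by at most 1 from one letter to the next, and since only
  the empty word has nonzero expectation they start and end at 1.\<close>

section \<open>Linear extension and monoid algebras\<close>

text \<open>The overview takes the three functionals for granted, but each is specified by
  \<open>THE\<close> on a quotient of a monoid algebra, so existence and uniqueness come first. One
  recipe serves all: a function on the monoid whose linear extension kills the relations in every
  two-sided context descends to the quotient (\<open>compatible\<close>, \<open>induced\<close>);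
  uniqueness follows by rewriting monoid elements in terms of those whose values are prescribed. The
  function is found by a representation on the algebra itself for the extension by \<open>p\<close>,
  by a finite product for the tensors, and by the absorption recursion for the free product.

  The obstacle in the comparison is that "annihilates" and "acts as" are not identities of the
  tensor algebra: \<open>p a\<close> need not vanish for a centered \<open>a\<close>, and
  \<open>p\<close> is not the unit. They hold only under the functional and with an arbitrary factor
  \<open>Y\<close> on the left, because the functional sees the right end of a product through a
  vector state, in which \<open>p a\<close> becomes the scalar \<phi>(a). Statements about replicas
  therefore carry such a \<open>Y\<close>, which also holds the letters not yet processed.\<close>

definition lin_ext :: "('m \<Rightarrow> complex) \<Rightarrow> ('m \<Rightarrow>\<^sub>0 complex) \<Rightarrow> complex" where
  "lin_ext h f = (\<Sum>x\<in>Poly_Mapping.keys f. Poly_Mapping.lookup f x * h x)"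

lemma keys_diff_closed:
  fixes f g :: "'m \<Rightarrow>\<^sub>0 complex"
  assumes "Poly_Mapping.keys f \<subseteq> X" "Poly_Mapping.keys g \<subseteq> X"
  shows "Poly_Mapping.keys (f - g) \<subseteq> X"
proof -
  have "Poly_Mapping.keys (- g) = Poly_Mapping.keys g"
    by (simp add: keys_def)
  then show ?thesis
    using Poly_Mapping.keys_add[of f "- g"] assms by auto
qed

lemma lin_ext_superset:
  assumes "finite F" "Poly_Mapping.keys f \<subseteq> F"
  shows "lin_ext h f = (\<Sum>x\<in>F. Poly_Mapping.lookup f x * h x)"
  unfolding lin_ext_def by (rule sum.mono_neutral_left) (use assms in \<open>auto simp: in_keys_iff\<close>)

lemma lin_ext_add [simp]: "lin_ext h (f + g) = lin_ext h f + lin_ext h g"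
proof -
  let ?F = "Poly_Mapping.keys f \<union> Poly_Mapping.keys g"
  have "Poly_Mapping.keys (f + g) \<subseteq> ?F"
    by (rule Poly_Mapping.keys_add)
  then show ?thesis
    by (simp add: lin_ext_superset[of ?F] lookup_add distrib_right sum.distrib)
qed

lemma lin_ext_uminus [simp]: "lin_ext h (- f) = - lin_ext h f"
  by (simp add: lin_ext_def sum_negf keys_def)

lemma lin_ext_diff [simp]: "lin_ext h (f - g) = lin_ext h f - lin_ext h g"
  using lin_ext_add[of h f "- g"] by simp

lemma lin_ext_single [simp]: "lin_ext h (Poly_Mapping.single m c) = c * h m"
  by (simp add: lin_ext_def)

lemma lookup_scale [simp]:
  "Poly_Mapping.lookup (Poly_Mapping.map ((*) (c :: complex)) f) x = c * Poly_Mapping.lookup f x"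
  by transfer (auto simp: when_def)

lemma keys_scale_subset: "Poly_Mapping.keys (Poly_Mapping.map ((*) (c :: complex)) f) \<subseteq> Poly_Mapping.keys f"
  by (auto simp: in_keys_iff)

lemma lin_ext_scale [simp]: "lin_ext h (Poly_Mapping.map ((*) c) f) = c * lin_ext h f"
  by (subst lin_ext_superset[OF finite_keys keys_scale_subset]) (simp add: lin_ext_def sum_distrib_left mult.assoc)

lemma lin_ext_add_scale: "lin_ext (\<lambda>x. g x + c * h x) f = lin_ext g f + c * lin_ext h f"
  by (simp add: lin_ext_def sum.distrib sum_distrib_left algebra_simps)

lemma poly_mapping_eq_sum_single:
  "f = (\<Sum>x\<in>Poly_Mapping.keys f. Poly_Mapping.single x (Poly_Mapping.lookup f x))"
  by (rule poly_mapping_eqI) (auto simp: lookup_sum lookup_single when_def in_keys_iff)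

text \<open>Reduces identities that are additive in an argument to single terms. The coefficient
  stays inside the single term, and zero is covered as the single term at the unit with coefficient
  0.\<close>

lemma (in monoid) monoid_algebra_induct [consumes 1, case_names single add]:
  fixes f :: "'a \<Rightarrow>\<^sub>0 complex"
  defines "X \<equiv> carrier G"
  assumes "Poly_Mapping.keys f \<subseteq> X"
    and "\<And>m c. m \<in> X \<Longrightarrow> P (Poly_Mapping.single m c)"
    and "\<And>f g. Poly_Mapping.keys f \<subseteq> X \<Longrightarrow> Poly_Mapping.keys g \<subseteq> X \<Longrightarrow> P f \<Longrightarrow> P g \<Longrightarrow> P (f + g)"
  shows "P f"
proof -
  have 0: "P 0"
    using assms(3)[of \<one> 0] by (simp add: X_def)
  have "finite F \<Longrightarrow> F \<subseteq> X \<Longrightarrow> Poly_Mapping.keys (\<Sum>x\<in>F. Poly_Mapping.single x (c x)) \<subseteq> X \<and>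
      P (\<Sum>x\<in>F. Poly_Mapping.single x (c x))" for F c
  proof (induction F rule: finite_induct)
    case (insert x F)
    have *: "Poly_Mapping.keys (Poly_Mapping.single x (c x)) \<subseteq> X"
      using insert by simp
    then show ?case
      using insert Poly_Mapping.keys_add[of "Poly_Mapping.single x (c x)" "\<Sum>x\<in>F. Poly_Mapping.single x (c x)"]
      by (auto intro!: assms(3) assms(4))
  qed (simp add: 0)
  then show ?thesis
    using assms(2) poly_mapping_eq_sum_single[of f] finite_keys by metis
qed

lemma monoid_algebra_simps [simp]:
  "carrier (monoid_algebra M) = {f. Poly_Mapping.keys f \<subseteq> carrier M}"
  "\<one>\<^bsub>monoid_algebra M\<^esub> = Poly_Mapping.single \<one>\<^bsub>M\<^esub> 1"
  "\<zero>\<^bsub>monoid_algebra M\<^esub> = 0"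
  "f \<oplus>\<^bsub>monoid_algebra M\<^esub> g = f + g"
  "c \<odot>\<^bsub>monoid_algebra M\<^esub> f = Poly_Mapping.map ((*) c) f"
  by (simp_all add: monoid_algebra_def)

text \<open>Because of cancellation \<open>f + g\<close> may have fewer keys than \<open>f\<close>
  and \<open>g\<close> together. Summing over a common finite set of indices makes the additivity of
  the product visible.\<close>

lemma mult_monoid_algebra_superset:
  assumes "finite F" "Poly_Mapping.keys f \<subseteq> F" "finite G" "Poly_Mapping.keys g \<subseteq> G"
  shows "f \<otimes>\<^bsub>monoid_algebra M\<^esub> g = (\<Sum>x\<in>F. \<Sum>y\<in>G.
    Poly_Mapping.single (x \<otimes>\<^bsub>M\<^esub> y) (Poly_Mapping.lookup f x * Poly_Mapping.lookup g y))"
proof -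
  have "f \<otimes>\<^bsub>monoid_algebra M\<^esub> g = (\<Sum>x\<in>Poly_Mapping.keys f. \<Sum>y\<in>G.
      Poly_Mapping.single (x \<otimes>\<^bsub>M\<^esub> y) (Poly_Mapping.lookup f x * Poly_Mapping.lookup g y))"
    unfolding monoid_algebra_def
    by (simp, intro sum.cong refl sum.mono_neutral_left assms) (auto simp: in_keys_iff)
  also have "\<dots> = (\<Sum>x\<in>F. \<Sum>y\<in>G.
      Poly_Mapping.single (x \<otimes>\<^bsub>M\<^esub> y) (Poly_Mapping.lookup f x * Poly_Mapping.lookup g y))"
    by (rule sum.mono_neutral_left) (use assms in \<open>auto simp: in_keys_iff\<close>)
  finally show ?thesis .
qed

lemma mult_monoid_algebra_add_left [simp]:
  "(f + g) \<otimes>\<^bsub>monoid_algebra M\<^esub> h = f \<otimes>\<^bsub>monoid_algebra M\<^esub> h + g \<otimes>\<^bsub>monoid_algebra M\<^esub> h"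
  using Poly_Mapping.keys_add[of f g]
  by (simp add: mult_monoid_algebra_superset[of "Poly_Mapping.keys f \<union> Poly_Mapping.keys g" _ "Poly_Mapping.keys h"]
      lookup_add distrib_right single_add sum.distrib)

lemma mult_monoid_algebra_add_right [simp]:
  "h \<otimes>\<^bsub>monoid_algebra M\<^esub> (f + g) = h \<otimes>\<^bsub>monoid_algebra M\<^esub> f + h \<otimes>\<^bsub>monoid_algebra M\<^esub> g"
  using Poly_Mapping.keys_add[of f g]
  by (simp add: mult_monoid_algebra_superset[of "Poly_Mapping.keys h" _ "Poly_Mapping.keys f \<union> Poly_Mapping.keys g"]
      lookup_add distrib_left single_add sum.distrib)

lemma mult_monoid_algebra_single [simp]:
  "Poly_Mapping.single x c \<otimes>\<^bsub>monoid_algebra M\<^esub> Poly_Mapping.single y d =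
     Poly_Mapping.single (x \<otimes>\<^bsub>M\<^esub> y) (c * d)"
  by (subst mult_monoid_algebra_superset[of "{x}" _ "{y}"]) auto

lemma scale_add [simp]:
  "Poly_Mapping.map ((*) (c :: complex)) (f + g) = Poly_Mapping.map ((*) c) f + Poly_Mapping.map ((*) c) g"
  by (rule poly_mapping_eqI) (simp add: lookup_add distrib_left)

lemma scale_add_left:
  "Poly_Mapping.map ((*) (c + d :: complex)) f = Poly_Mapping.map ((*) c) f + Poly_Mapping.map ((*) d) f"
  by (rule poly_mapping_eqI) (simp add: lookup_add distrib_right)

lemma scale_scale:
  "Poly_Mapping.map ((*) (c * d :: complex)) f = Poly_Mapping.map ((*) c) (Poly_Mapping.map ((*) d) f)"
  by (rule poly_mapping_eqI) simp

lemma scale_one [simp]: "Poly_Mapping.map ((*) (1 :: complex)) f = f"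
  by (rule poly_mapping_eqI) simp

lemma map_scale_single [simp]:
  "Poly_Mapping.map ((*) (c :: complex)) (Poly_Mapping.single x d) = Poly_Mapping.single x (c * d)"
  by (rule poly_mapping_eqI) (simp add: lookup_single when_def)

lemma complex_ring_simps [simp]:
  "carrier complex_ring = UNIV" "x \<otimes>\<^bsub>complex_ring\<^esub> y = x * y" "x \<oplus>\<^bsub>complex_ring\<^esub> y = x + y"
  "\<one>\<^bsub>complex_ring\<^esub> = 1" "\<zero>\<^bsub>complex_ring\<^esub> = 0"
  by (simp_all add: complex_ring_def)

lemma cring_complex_ring: "cring complex_ring"
proof (rule cringI)
  show "abelian_group complex_ring"
    by (rule abelian_groupI) (auto intro: exI[of _ "- _"])
qed (unfold_locales, auto simp: algebra_simps)

text \<open>All multiplicative laws are additive in each argument, so nested inductions reduce them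
  to single terms, where they become the laws of \<open>M\<close> and of the complex
  numbers.\<close>

lemma complex_algebra_monoid_algebra:
  assumes "monoid M"
  shows "complex_algebra (monoid_algebra M)"
proof -
  interpret M: monoid M by fact
  let ?A = "monoid_algebra M"
  note ind = M.monoid_algebra_induct
  have closed: "Poly_Mapping.keys (f \<otimes>\<^bsub>?A\<^esub> g) \<subseteq> carrier M"
    if f: "Poly_Mapping.keys f \<subseteq> carrier M" and g: "Poly_Mapping.keys g \<subseteq> carrier M" for f g
    using f
  proof (induction f rule: ind)
    case (single m c)
    show ?case using g
    proof (induction g rule: ind)
      case (add g h)
      then show ?case
        using Poly_Mapping.keys_add[of "Poly_Mapping.single m c \<otimes>\<^bsub>?A\<^esub> g" "Poly_Mapping.single m c \<otimes>\<^bsub>?A\<^esub> h"]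
        by (auto simp del: mult_monoid_algebra_single)
    qed (use single in auto)
  next
    case (add f h)
    then show ?case
      using Poly_Mapping.keys_add[of "f \<otimes>\<^bsub>?A\<^esub> g" "h \<otimes>\<^bsub>?A\<^esub> g"] by auto
  qed
  have assoc: "(f \<otimes>\<^bsub>?A\<^esub> g) \<otimes>\<^bsub>?A\<^esub> h = f \<otimes>\<^bsub>?A\<^esub> (g \<otimes>\<^bsub>?A\<^esub> h)"
    if f: "Poly_Mapping.keys f \<subseteq> carrier M" and g: "Poly_Mapping.keys g \<subseteq> carrier M"
      and h: "Poly_Mapping.keys h \<subseteq> carrier M" for f g h
    using f
  proof (induction f rule: ind)
    case fs: (single m c)
    show ?case using g
    proof (induction g rule: ind)
      case gs: (single m' c')
      show ?case using h
        by (induction h rule: ind) (use fs gs in \<open>simp_all add: M.m_assoc mult.assoc\<close>)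
    qed simp
  qed simp
  have l_one: "Poly_Mapping.single \<one>\<^bsub>M\<^esub> 1 \<otimes>\<^bsub>?A\<^esub> f = f" if "Poly_Mapping.keys f \<subseteq> carrier M" for f
    using that by (induction f rule: ind) auto
  have r_one: "f \<otimes>\<^bsub>?A\<^esub> Poly_Mapping.single \<one>\<^bsub>M\<^esub> 1 = f" if "Poly_Mapping.keys f \<subseteq> carrier M" for f
    using that by (induction f rule: ind) auto
  have keys_plus: "Poly_Mapping.keys (f + g) \<subseteq> carrier M"
    if "Poly_Mapping.keys f \<subseteq> carrier M" "Poly_Mapping.keys g \<subseteq> carrier M"
    for f g :: "'a \<Rightarrow>\<^sub>0 complex"
    using that Poly_Mapping.keys_add[of f g] by blast
  have keys_uminus: "Poly_Mapping.keys (- f) = Poly_Mapping.keys f" for f :: "'a \<Rightarrow>\<^sub>0 complex"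
    by (simp add: keys_def)
  have keys_scale_closed: "Poly_Mapping.keys (Poly_Mapping.map ((*) c) f) \<subseteq> carrier M"
    if "Poly_Mapping.keys f \<subseteq> carrier M" for f :: "'a \<Rightarrow>\<^sub>0 complex" and c
    by (rule subset_trans[OF keys_scale_subset that])
  have grp: "abelian_group ?A"
  proof (rule abelian_groupI)
    fix f assume "f \<in> carrier ?A"
    then show "\<exists>g\<in>carrier ?A. g \<oplus>\<^bsub>?A\<^esub> f = \<zero>\<^bsub>?A\<^esub>"
      by (intro bexI[of _ "- f"]) (simp_all add: keys_uminus)
  next
    fix f g h
    show "f \<oplus>\<^bsub>?A\<^esub> g \<oplus>\<^bsub>?A\<^esub> h = f \<oplus>\<^bsub>?A\<^esub> (g \<oplus>\<^bsub>?A\<^esub> h)"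
      by (simp add: add.assoc)
    show "f \<oplus>\<^bsub>?A\<^esub> g = g \<oplus>\<^bsub>?A\<^esub> f"
      by (simp add: add.commute)
  qed (simp_all add: keys_plus)
  have ring: "ring ?A"
  proof (rule ringI)
    show "Group.monoid ?A"
      by (rule monoidI) (simp_all add: closed assoc l_one r_one)
  qed (simp_all add: grp)
  have mod: "module complex_ring ?A"
    by (rule moduleI)
      (simp_all add: cring_complex_ring grp keys_scale_closed scale_add_left scale_scale)
  have left: "Poly_Mapping.map ((*) c) f \<otimes>\<^bsub>?A\<^esub> g = Poly_Mapping.map ((*) c) (f \<otimes>\<^bsub>?A\<^esub> g)"
    if f: "Poly_Mapping.keys f \<subseteq> carrier M" and g: "Poly_Mapping.keys g \<subseteq> carrier M" for f g c
    using f
  proof (induction f rule: ind)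
    case (single m d)
    show ?case using g by (induction g rule: ind) (auto simp: mult.assoc)
  qed simp
  have right: "f \<otimes>\<^bsub>?A\<^esub> Poly_Mapping.map ((*) c) g = Poly_Mapping.map ((*) c) (f \<otimes>\<^bsub>?A\<^esub> g)"
    if f: "Poly_Mapping.keys f \<subseteq> carrier M" and g: "Poly_Mapping.keys g \<subseteq> carrier M" for f g c
    using f
  proof (induction f rule: ind)
    case (single m d)
    show ?case using g by (induction g rule: ind) (auto simp: mult.left_commute)
  qed simp
  show ?thesis
    by (intro complex_algebra.intro mod ring complex_algebra_axioms.intro) (simp_all add: left right)
qed

section \<open>Quotients\<close>

lemma quot_algebra_simps:
  "carrier (quot_algebra A S) = carrier (A Quot genideal A S)"
  "x \<otimes>\<^bsub>quot_algebra A S\<^esub> y = x \<otimes>\<^bsub>A Quot genideal A S\<^esub> y"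
  "x \<oplus>\<^bsub>quot_algebra A S\<^esub> y = x \<oplus>\<^bsub>A Quot genideal A S\<^esub> y"
  "\<one>\<^bsub>quot_algebra A S\<^esub> = \<one>\<^bsub>A Quot genideal A S\<^esub>"
  "\<zero>\<^bsub>quot_algebra A S\<^esub> = \<zero>\<^bsub>A Quot genideal A S\<^esub>"
  by (simp_all add: quot_algebra_def)

locale algebra_quotient = complex_algebra A for A :: "(complex, 'a) module" (structure) +
  fixes S
  assumes relations_closed: "S \<subseteq> carrier A"
begin

lemma ideal_genideal: "ideal (genideal A S) A"
  by (rule genideal_ideal[OF relations_closed])

lemma carrier_quot: "carrier (quot_algebra A S) = quot_map A S ` carrier A"
  by (auto simp: quot_algebra_simps FactRing_def A_RCOSETS_def' a_r_coset_def')

lemma quot_map_closed: "x \<in> carrier A \<Longrightarrow> quot_map A S x \<in> carrier (quot_algebra A S)"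
  unfolding carrier_quot by blast

lemma quot_map_mult:
  "x \<in> carrier A \<Longrightarrow> y \<in> carrier A \<Longrightarrow>
    quot_map A S x \<otimes>\<^bsub>quot_algebra A S\<^esub> quot_map A S y = quot_map A S (x \<otimes> y)"
  using ring_hom_mult[OF ideal.rcos_ring_hom[OF ideal_genideal]] by (simp add: quot_algebra_simps)

lemma quot_map_add:
  "x \<in> carrier A \<Longrightarrow> y \<in> carrier A \<Longrightarrow>
    quot_map A S x \<oplus>\<^bsub>quot_algebra A S\<^esub> quot_map A S y = quot_map A S (x \<oplus> y)"
  using ring_hom_add[OF ideal.rcos_ring_hom[OF ideal_genideal]] by (simp add: quot_algebra_simps)

lemma quot_map_one: "\<one>\<^bsub>quot_algebra A S\<^esub> = quot_map A S \<one>"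
  using ring_hom_one[OF ideal.rcos_ring_hom[OF ideal_genideal]] by (simp add: quot_algebra_simps)

lemma quot_map_eq_iff:
  "x \<in> carrier A \<Longrightarrow> y \<in> carrier A \<Longrightarrow> quot_map A S x = quot_map A S y \<longleftrightarrow> x \<ominus> y \<in> genideal A S"
  using quotient_eq_iff_same_a_r_cos[OF ideal_genideal] by auto

lemma quot_map_eqI:
  "x \<in> carrier A \<Longrightarrow> y \<in> carrier A \<Longrightarrow> x \<ominus> y \<in> S \<Longrightarrow> quot_map A S x = quot_map A S y"
  using quot_map_eq_iff genideal_self[OF relations_closed] by blast

lemma genideal_smult: "x \<in> genideal A S \<Longrightarrow> c \<odot> x \<in> genideal A S"
proof -
  interpret J: ideal "genideal A S" A by (rule ideal_genideal)
  assume x: "x \<in> genideal A S"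
  then have "x \<in> carrier A" by (rule J.Icarr)
  \<comment> \<open>A scalar acts as left multiplication by a multiple of the unit, and a ring ideal
    absorbs such a factor.\<close>
  then have "c \<odot> x = (c \<odot> \<one>) \<otimes> x"
    by (simp add: smult_assoc_left)
  then show ?thesis
    using x by (auto intro: J.I_l_closed)
qed

text \<open>Scalar multiplication on cosets is a union over all representatives. Two representatives
  differ by an element of the ideal, which is closed under scalars, so every member of the union is
  the same coset.\<close>

lemma quot_map_smult:
  assumes x: "x \<in> carrier A"
  shows "c \<odot>\<^bsub>quot_algebra A S\<^esub> quot_map A S x = quot_map A S (c \<odot> x)"
proof -
  interpret J: ideal "genideal A S" A by (rule ideal_genideal)
  have eq: "quot_map A S (c \<odot> y) = quot_map A S (c \<odot> x)" if y: "y \<in> quot_map A S x" for y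
  proof -
    obtain j where j: "j \<in> genideal A S" "y = j \<oplus> x"
      using y by (auto simp: a_r_coset_def')
    have jc: "j \<in> carrier A" using j(1) by (rule J.Icarr)
    have "c \<odot> y \<ominus> c \<odot> x = c \<odot> j"
      using jc x by (simp add: j smult_r_distr a_minus_def a_assoc r_neg)
    then show ?thesis
      using quot_map_eq_iff[of "c \<odot> y" "c \<odot> x"] jc x j genideal_smult[OF j(1), of c] by auto
  qed
  have "quot_map A S x \<noteq> {}"
    using J.a_rcos_self[OF x] by (metis empty_iff)
  then have "(\<Union>y\<in>quot_map A S x. quot_map A S (c \<odot> y)) = quot_map A S (c \<odot> x)"
    by (rule SUP_eq_const) (rule eq)
  then show ?thesis
    by (simp add: quot_algebra_def)
qed

lemma complex_algebra_quot: "complex_algebra (quot_algebra A S)"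
proof -
  interpret Q0: ring "A Quot genideal A S"
    by (rule ideal.quotient_is_ring[OF ideal_genideal])
  let ?Q = "quot_algebra A S"
  have grp: "abelian_group ?Q"
  proof (rule abelian_groupI)
    fix x assume "x \<in> carrier ?Q"
    then show "\<exists>y\<in>carrier ?Q. y \<oplus>\<^bsub>?Q\<^esub> x = \<zero>\<^bsub>?Q\<^esub>"
      unfolding quot_algebra_simps using Q0.l_neg Q0.a_inv_closed by blast
  qed (simp_all add: quot_algebra_simps Q0.a_ac)
  have "Group.monoid ?Q"
    by (rule monoidI) (simp_all add: quot_algebra_simps Q0.m_assoc)
  then have ring: "ring ?Q"
    by (rule ringI[OF grp]) (simp_all add: quot_algebra_simps Q0.l_distr Q0.r_distr)
  have *: "P x" if "x \<in> carrier ?Q" "\<And>y. y \<in> carrier A \<Longrightarrow> P (quot_map A S y)" for P x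
    using that unfolding carrier_quot by blast
  note hom = quot_map_closed quot_map_smult quot_map_add quot_map_mult smult_l_distr smult_r_distr
    smult_assoc1 smult_assoc_left smult_assoc_right
  have mod: "module complex_ring ?Q"
  proof (rule moduleI[OF cring_complex_ring grp])
    fix c x assume "x \<in> carrier ?Q"
    then show "c \<odot>\<^bsub>?Q\<^esub> x \<in> carrier ?Q" "\<one>\<^bsub>complex_ring\<^esub> \<odot>\<^bsub>?Q\<^esub> x = x"
      by (rule *; use smult_one in \<open>simp add: hom\<close>)+
  next
    fix c d x assume "x \<in> carrier ?Q"
    then show "(c \<oplus>\<^bsub>complex_ring\<^esub> d) \<odot>\<^bsub>?Q\<^esub> x = c \<odot>\<^bsub>?Q\<^esub> x \<oplus>\<^bsub>?Q\<^esub> d \<odot>\<^bsub>?Q\<^esub> x"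
      "(c \<otimes>\<^bsub>complex_ring\<^esub> d) \<odot>\<^bsub>?Q\<^esub> x = c \<odot>\<^bsub>?Q\<^esub> (d \<odot>\<^bsub>?Q\<^esub> x)"
      by (rule *; use smult_l_distr[of c d] smult_assoc1[of c d] in \<open>simp add: hom\<close>)+
  next
    fix c x y assume x: "x \<in> carrier ?Q" and y: "y \<in> carrier ?Q"
    from y show "c \<odot>\<^bsub>?Q\<^esub> (x \<oplus>\<^bsub>?Q\<^esub> y) = c \<odot>\<^bsub>?Q\<^esub> x \<oplus>\<^bsub>?Q\<^esub> c \<odot>\<^bsub>?Q\<^esub> y"
      by (rule *, use x in \<open>rule *\<close>) (simp add: hom)
  qed
  show ?thesis
  proof (intro complex_algebra.intro mod ring complex_algebra_axioms.intro)
    fix c x y assume x: "x \<in> carrier ?Q" and y: "y \<in> carrier ?Q"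
    from y show "c \<odot>\<^bsub>?Q\<^esub> x \<otimes>\<^bsub>?Q\<^esub> y = c \<odot>\<^bsub>?Q\<^esub> (x \<otimes>\<^bsub>?Q\<^esub> y)"
      by (rule *, use x in \<open>rule *\<close>) (simp add: hom)
    from y show "x \<otimes>\<^bsub>?Q\<^esub> (c \<odot>\<^bsub>?Q\<^esub> y) = c \<odot>\<^bsub>?Q\<^esub> (x \<otimes>\<^bsub>?Q\<^esub> y)"
      by (rule *, use x in \<open>rule *\<close>) (simp add: hom)
  qed
qed

end

section \<open>Quotients of monoid algebras\<close>

lemma lin_ext_cong:
  "(\<And>x. x \<in> Poly_Mapping.keys f \<Longrightarrow> g x = h x) \<Longrightarrow> lin_ext g f = lin_ext h f"
  by (simp add: lin_ext_def)

text \<open>Common frame for the extension by an idempotent, the tensor product and the free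
  product: word monoids for the first and the last, the monoid of families of entries for the
  second.\<close>

locale monoid_quotient = monoid M for M (structure) +
  fixes S :: "('a \<Rightarrow>\<^sub>0 complex) set"
  assumes relations_closed: "S \<subseteq> carrier (monoid_algebra M)"
begin

abbreviation "Q \<equiv> quot_algebra (monoid_algebra M) S"

definition cls :: "'a \<Rightarrow> ('a \<Rightarrow>\<^sub>0 complex) set" where
  "cls m = quot_map (monoid_algebra M) S (Poly_Mapping.single m 1)"

sublocale MA: algebra_quotient "monoid_algebra M" S
  by (intro algebra_quotient.intro algebra_quotient_axioms.intro relations_closed
      complex_algebra_monoid_algebra monoid_axioms)

sublocale Q: complex_algebra Q
  by (rule MA.complex_algebra_quot)

lemma cls_closed [simp]: "m \<in> carrier M \<Longrightarrow> cls m \<in> carrier Q"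
  unfolding cls_def by (rule MA.quot_map_closed) simp

lemma cls_mult: "m \<in> carrier M \<Longrightarrow> m' \<in> carrier M \<Longrightarrow> cls m \<otimes>\<^bsub>Q\<^esub> cls m' = cls (m \<otimes> m')"
  unfolding cls_def by (subst MA.quot_map_mult) simp_all

lemma cls_one: "cls \<one> = \<one>\<^bsub>Q\<^esub>"
  unfolding cls_def MA.quot_map_one by simp

lemma smult_cls: "m \<in> carrier M \<Longrightarrow>
    c \<odot>\<^bsub>Q\<^esub> cls m = quot_map (monoid_algebra M) S (Poly_Mapping.single m c)"
  unfolding cls_def by (subst MA.quot_map_smult) simp_all

lemma quot_induct [consumes 1, case_names smult_cls add]:
  assumes "x \<in> carrier Q"
    and cls: "\<And>m c. m \<in> carrier M \<Longrightarrow> P (c \<odot>\<^bsub>Q\<^esub> cls m)"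
    and add: "\<And>x y. x \<in> carrier Q \<Longrightarrow> y \<in> carrier Q \<Longrightarrow> P x \<Longrightarrow> P y \<Longrightarrow> P (x \<oplus>\<^bsub>Q\<^esub> y)"
  shows "P x"
proof -
  have "P (quot_map (monoid_algebra M) S f)" if "Poly_Mapping.keys f \<subseteq> carrier M" for f
    using that
  proof (induction f rule: monoid_algebra_induct)
    case (single m c)
    then show ?case using cls[of m c] by (simp add: smult_cls)
  next
    case (add f g)
    then show ?case
      using assms(3)[of "quot_map (monoid_algebra M) S f" "quot_map (monoid_algebra M) S g"]
      by (simp add: MA.quot_map_closed MA.quot_map_add)
  qed
  then show ?thesis
    using assms(1) unfolding MA.carrier_quot by auto
qed

lemma uminus_monoid_algebra:
  assumes "Poly_Mapping.keys f \<subseteq> carrier M"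
  shows "\<ominus>\<^bsub>monoid_algebra M\<^esub> f = - f"
proof (rule MA.minus_equality)
  show "- f \<oplus>\<^bsub>monoid_algebra M\<^esub> f = \<zero>\<^bsub>monoid_algebra M\<^esub>" by simp
qed (use assms in \<open>simp_all add: keys_def\<close>)

lemma minus_monoid_algebra:
  "Poly_Mapping.keys g \<subseteq> carrier M \<Longrightarrow> f \<ominus>\<^bsub>monoid_algebra M\<^esub> g = f - g"
  by (simp add: a_minus_def uminus_monoid_algebra)

lemma quot_map_rel:
  assumes "f - g \<in> S" "Poly_Mapping.keys f \<subseteq> carrier M" "Poly_Mapping.keys g \<subseteq> carrier M"
  shows "quot_map (monoid_algebra M) S f = quot_map (monoid_algebra M) S g"
  by (rule MA.quot_map_eqI) (use assms in \<open>simp_all add: minus_monoid_algebra\<close>)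

lemma cls_add_rel:
  assumes "Poly_Mapping.single m 1 - Poly_Mapping.single m1 1 - Poly_Mapping.single m2 1 \<in> S"
    and [simp]: "m \<in> carrier M" "m1 \<in> carrier M" "m2 \<in> carrier M"
  shows "cls m = cls m1 \<oplus>\<^bsub>Q\<^esub> cls m2"
proof -
  let ?f = "Poly_Mapping.single m1 1 + Poly_Mapping.single m2 (1 :: complex)"
  have "Poly_Mapping.keys ?f \<subseteq> carrier M"
    by (rule subset_trans[OF Poly_Mapping.keys_add]) simp
  then have "cls m = quot_map (monoid_algebra M) S ?f"
    unfolding cls_def using assms(1) by (intro quot_map_rel) (simp_all add: diff_diff_eq)
  also have "\<dots> = cls m1 \<oplus>\<^bsub>Q\<^esub> cls m2"
    unfolding cls_def by (subst MA.quot_map_add) simp_all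
  finally show ?thesis .
qed

lemma cls_smult_rel:
  assumes "Poly_Mapping.single m 1 - Poly_Mapping.single m' c \<in> S"
    and "m \<in> carrier M" "m' \<in> carrier M"
  shows "cls m = c \<odot>\<^bsub>Q\<^esub> cls m'"
  using quot_map_rel[OF assms(1)] assms(2,3) by (simp add: smult_cls) (simp add: cls_def)

lemma cls_rel:
  assumes "Poly_Mapping.single m 1 - Poly_Mapping.single m' 1 \<in> S"
    and "m \<in> carrier M" "m' \<in> carrier M"
  shows "cls m = cls m'"
  using cls_smult_rel[OF assms] assms(2,3) Q.smult_one by simp

text \<open>The classes of monoid elements span the quotient. This settles the uniqueness half of
  each \<open>THE\<close>.\<close>

lemma linear_functional_eqI:
  assumes "linear_functional Q f" "linear_functional Q g"
    and "\<And>m. m \<in> carrier M \<Longrightarrow> f (cls m) = g (cls m)" and "x \<in> carrier Q"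
  shows "f x = g x"
  using assms(4) by (induction rule: quot_induct) (use assms in \<open>auto simp: linear_functional_def\<close>)

section \<open>Functionals induced by functions on the monoid\<close>

lemma lin_ext_mult_single_left:
  "Poly_Mapping.keys a \<subseteq> carrier M \<Longrightarrow>
    lin_ext g (Poly_Mapping.single m c \<otimes>\<^bsub>monoid_algebra M\<^esub> a) = c * lin_ext (\<lambda>y. g (m \<otimes> y)) a"
  by (induction a rule: monoid_algebra_induct) (simp_all add: distrib_left)

lemma lin_ext_mult_single_right:
  "Poly_Mapping.keys a \<subseteq> carrier M \<Longrightarrow>
    lin_ext g (a \<otimes>\<^bsub>monoid_algebra M\<^esub> Poly_Mapping.single m c) = c * lin_ext (\<lambda>y. g (y \<otimes> m)) a"
  by (induction a rule: monoid_algebra_induct) (simp_all add: distrib_left)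

text \<open>The context \<open>u\<close>, \<open>v\<close> is essential: the ideal is spanned by the
  translates of the relations by monoid elements on both sides, not by the relations alone.\<close>

definition compatible :: "('a \<Rightarrow> complex) \<Rightarrow> bool" where
  "compatible h \<longleftrightarrow>
    (\<forall>r\<in>S. \<forall>u\<in>carrier M. \<forall>v\<in>carrier M. lin_ext (\<lambda>x. h (u \<otimes> x \<otimes> v)) r = 0)"

text \<open>The elements killed in every context form a two-sided ideal \<open>K\<close>, since a
  factor on either side can be moved into the context. It contains \<open>S\<close>, hence the
  generated ideal, and the trivial context gives back \<open>h\<close>.\<close>

lemma lin_ext_genideal:
  assumes h: "compatible h" and x: "x \<in> genideal (monoid_algebra M) S"
  shows "lin_ext h x = 0"
proof -
  let ?A = "monoid_algebra M"
  define K where "K = {x \<in> carrier ?A. \<forall>u\<in>carrier M. \<forall>v\<in>carrier M. lin_ext (\<lambda>y. h (u \<otimes> y \<otimes> v)) x = 0}"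
  have "ideal K ?A"
  proof (rule idealI)
    show "ring ?A" by (rule MA.ring_axioms)
    show "subgroup K (add_monoid ?A)"
    proof (rule MA.add.subgroupI)
      show "K \<noteq> {}"
        by (auto simp: K_def lin_ext_def intro!: exI[of _ 0])
    next
      fix x assume x: "x \<in> K"
      have "\<ominus>\<^bsub>?A\<^esub> x \<in> carrier ?A"
        using x by (intro MA.a_inv_closed) (simp add: K_def)
      then show "\<ominus>\<^bsub>?A\<^esub> x \<in> K"
        using x by (simp add: K_def uminus_monoid_algebra)
    next
      fix x y assume xy: "x \<in> K" "y \<in> K"
      have "x \<oplus>\<^bsub>?A\<^esub> y \<in> carrier ?A"
        using xy by (intro MA.a_closed) (simp_all add: K_def)
      then show "x \<oplus>\<^bsub>?A\<^esub> y \<in> K"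
        using xy by (simp add: K_def)
    qed (auto simp: K_def)
  next
    fix a x assume a: "a \<in> K" and x: "x \<in> carrier ?A"
    have ac: "Poly_Mapping.keys a \<subseteq> carrier M"
      using a by (simp add: K_def)
    have "lin_ext (\<lambda>y. h (u \<otimes> y \<otimes> v)) (x \<otimes>\<^bsub>?A\<^esub> a) = 0"
      if uv: "u \<in> carrier M" "v \<in> carrier M" for u v
      using x[simplified]
    proof (induction x rule: monoid_algebra_induct)
      case (single m c)
      have "lin_ext (\<lambda>y. h (u \<otimes> (m \<otimes> y) \<otimes> v)) a = lin_ext (\<lambda>y. h ((u \<otimes> m) \<otimes> y \<otimes> v)) a"
        by (rule lin_ext_cong) (use uv single ac in \<open>auto simp: m_assoc\<close>)
      also have "\<dots> = 0"
        using a uv single by (simp add: K_def)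
      finally show ?case
        using ac by (simp add: lin_ext_mult_single_left)
    qed simp
    moreover have "x \<otimes>\<^bsub>?A\<^esub> a \<in> carrier ?A"
      using x ac by (intro MA.m_closed) simp_all
    ultimately show "x \<otimes>\<^bsub>?A\<^esub> a \<in> K"
      by (simp add: K_def)
    have "lin_ext (\<lambda>y. h (u \<otimes> y \<otimes> v)) (a \<otimes>\<^bsub>?A\<^esub> x) = 0"
      if uv: "u \<in> carrier M" "v \<in> carrier M" for u v
      using x[simplified]
    proof (induction x rule: monoid_algebra_induct)
      case (single m c)
      have "lin_ext (\<lambda>y. h (u \<otimes> (y \<otimes> m) \<otimes> v)) a = lin_ext (\<lambda>y. h (u \<otimes> y \<otimes> (m \<otimes> v))) a"
        by (rule lin_ext_cong) (use uv single ac in \<open>auto simp: m_assoc\<close>)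
      also have "\<dots> = 0"
        using a uv single by (simp add: K_def)
      finally show ?case
        using ac by (simp add: lin_ext_mult_single_right)
    qed simp
    moreover have "a \<otimes>\<^bsub>?A\<^esub> x \<in> carrier ?A"
      using x ac by (intro MA.m_closed) simp_all
    ultimately show "a \<otimes>\<^bsub>?A\<^esub> x \<in> K"
      by (simp add: K_def)
  qed
  moreover have "S \<subseteq> K"
    using h relations_closed by (auto simp: K_def compatible_def)
  ultimately have "x \<in> K"
    using MA.genideal_minimal x by blast
  then have "lin_ext (\<lambda>y. h (\<one> \<otimes> y \<otimes> \<one>)) x = 0" and "Poly_Mapping.keys x \<subseteq> carrier M"
    by (simp_all add: K_def)
  then show ?thesis
    using lin_ext_cong[of x h "\<lambda>y. h (\<one> \<otimes> y \<otimes> \<one>)"] by fastforce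
qed

text \<open>The value is read off a representative picked by \<open>SOME\<close>; for compatible
  \<open>h\<close> the choice is immaterial. The restriction to the carrier matches the
  \<open>extensional\<close> condition in the specifications of the functionals.\<close>

definition induced :: "('a \<Rightarrow> complex) \<Rightarrow> ('a \<Rightarrow>\<^sub>0 complex) set \<Rightarrow> complex" where
  "induced h = restrict (\<lambda>X. lin_ext h
     (SOME f. f \<in> carrier (monoid_algebra M) \<and> quot_map (monoid_algebra M) S f = X)) (carrier Q)"

lemma induced_quot_map:
  assumes h: "compatible h" and f: "f \<in> carrier (monoid_algebra M)"
  shows "induced h (quot_map (monoid_algebra M) S f) = lin_ext h f"
proof -
  let ?P = "\<lambda>g. g \<in> carrier (monoid_algebra M) \<and>
    quot_map (monoid_algebra M) S g = quot_map (monoid_algebra M) S f"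
  define g where "g = (SOME g. ?P g)"
  have g: "?P g"
    unfolding g_def by (rule someI[of ?P f]) (simp add: f[simplified])
  then have "g \<ominus>\<^bsub>monoid_algebra M\<^esub> f \<in> genideal (monoid_algebra M) S"
    using MA.quot_map_eq_iff f by blast
  from lin_ext_genideal[OF h this] have "lin_ext h (g - f) = 0"
    using f by (simp only: minus_monoid_algebra monoid_algebra_simps mem_Collect_eq)
  moreover have "induced h (quot_map (monoid_algebra M) S f) = lin_ext h g"
    using MA.quot_map_closed[OF f] by (simp add: induced_def g_def)
  ultimately show ?thesis by simp
qed

lemma induced_cls: "compatible h \<Longrightarrow> m \<in> carrier M \<Longrightarrow> induced h (cls m) = h m"
  by (simp add: cls_def induced_quot_map)

lemma induced_extensional: "induced h \<in> extensional (carrier Q)"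
  by (simp add: induced_def)

lemma linear_induced:
  assumes h: "compatible h"
  shows "linear_functional Q (induced h)"
  unfolding linear_functional_def MA.carrier_quot
proof (intro conjI ballI allI; elim imageE; hypsubst)
  fix f g assume fg: "f \<in> carrier (monoid_algebra M)" "g \<in> carrier (monoid_algebra M)"
  show "induced h (quot_map (monoid_algebra M) S f \<oplus>\<^bsub>Q\<^esub> quot_map (monoid_algebra M) S g) =
      induced h (quot_map (monoid_algebra M) S f) + induced h (quot_map (monoid_algebra M) S g)"
    using fg MA.a_closed[OF fg] by (simp add: MA.quot_map_add induced_quot_map[OF h])
next
  fix c f assume f: "f \<in> carrier (monoid_algebra M)"
  show "induced h (c \<odot>\<^bsub>Q\<^esub> quot_map (monoid_algebra M) S f) = c * induced h (quot_map (monoid_algebra M) S f)"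
    using f MA.smult_closed[of c f] by (simp add: MA.quot_map_smult induced_quot_map[OF h])
qed

end

section \<open>Quotients of free algebras\<close>

lemma word_monoid_simps [simp]:
  "carrier (word_monoid X) = lists X" "x \<otimes>\<^bsub>word_monoid X\<^esub> y = x @ y" "\<one>\<^bsub>word_monoid X\<^esub> = []"
  by (simp_all add: word_monoid_def)

lemma monoid_word_monoid: "Group.monoid (word_monoid X)"
  by (rule monoidI) auto

lemma hom_relations_closed:
  assumes "complex_algebra A" "e ` carrier A \<subseteq> X"
  shows "hom_relations A e \<subseteq> carrier (free_algebra X)"
proof -
  interpret A: complex_algebra A by fact
  have e: "e a \<in> X" if "a \<in> carrier A" for a
    using assms(2) that by blast
  show ?thesis
    unfolding hom_relations_def monoid_algebra_simps word_monoid_simps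
    by (intro Un_least subsetI; elim CollectE exE conjE insertE emptyE; hypsubst; unfold mem_Collect_eq; intro keys_diff_closed)
      (simp_all add: e)
qed

locale word_quotient = fixes X :: "'x set" and S
  assumes rel_closed: "S \<subseteq> carrier (free_algebra X)"
begin

sublocale monoid_quotient "word_monoid X" S
  by (intro monoid_quotient.intro monoid_quotient_axioms.intro monoid_word_monoid rel_closed)

lemma cls_append: "u \<in> lists X \<Longrightarrow> v \<in> lists X \<Longrightarrow> cls (u @ v) = cls u \<otimes>\<^bsub>Q\<^esub> cls v"
  by (simp add: cls_mult)

lemma list_prod_cls: "set xs \<subseteq> X \<Longrightarrow> list_prod Q (map (\<lambda>x. cls [x]) xs) = cls xs"
proof (induction xs)
  case Nil
  then show ?case using cls_one by (simp add: list_prod_def)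
next
  case (Cons x xs)
  then have "cls [x] \<otimes>\<^bsub>Q\<^esub> cls xs = cls (x # xs)"
    using cls_append[of "[x]" xs] by (simp add: in_lists_conv_set subset_iff)
  then show ?case
    using Cons by (simp add: list_prod_def)
qed

lemma cls_context_add:
  assumes "cls x = cls y \<oplus>\<^bsub>Q\<^esub> cls z" "u \<in> lists X" "v \<in> lists X" "x \<in> lists X" "y \<in> lists X" "z \<in> lists X"
  shows "cls (u @ x @ v) = cls (u @ y @ v) \<oplus>\<^bsub>Q\<^esub> cls (u @ z @ v)"
  using assms by (simp add: cls_append Q.l_distr Q.r_distr)

lemma cls_context_smult:
  assumes "cls x = c \<odot>\<^bsub>Q\<^esub> cls y" "u \<in> lists X" "v \<in> lists X" "x \<in> lists X" "y \<in> lists X"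
  shows "cls (u @ x @ v) = c \<odot>\<^bsub>Q\<^esub> cls (u @ y @ v)"
  using assms by (simp add: cls_append Q.smult_assoc_left Q.smult_assoc_right)

lemma cls_context:
  assumes "cls x = cls y" "u \<in> lists X" "v \<in> lists X" "x \<in> lists X" "y \<in> lists X"
  shows "cls (u @ x @ v) = cls (u @ y @ v)"
  using assms by (simp add: cls_append)

context
  fixes A :: "(complex, 'b) module" and e
  assumes A: "complex_algebra A" and rel: "hom_relations A e \<subseteq> S" and emb: "e ` carrier A \<subseteq> X"
begin

interpretation A: complex_algebra A by (rule A)

lemma letter_closed: "a \<in> carrier A \<Longrightarrow> e a \<in> X"
  using emb by blast

lemma cls_letter_add:
  assumes "a \<in> carrier A" "b \<in> carrier A"
  shows "cls [e (a \<oplus>\<^bsub>A\<^esub> b)] = cls [e a] \<oplus>\<^bsub>Q\<^esub> cls [e b]"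
proof (rule cls_add_rel)
  show "Poly_Mapping.single [e (a \<oplus>\<^bsub>A\<^esub> b)] 1 - Poly_Mapping.single [e a] 1 - Poly_Mapping.single [e b] 1 \<in> S"
    using assms by (intro subsetD[OF rel]) (unfold hom_relations_def, blast)
qed (use assms in \<open>simp_all add: letter_closed\<close>)

lemma cls_letter_smult:
  assumes "a \<in> carrier A"
  shows "cls [e (c \<odot>\<^bsub>A\<^esub> a)] = c \<odot>\<^bsub>Q\<^esub> cls [e a]"
proof (rule cls_smult_rel)
  show "Poly_Mapping.single [e (c \<odot>\<^bsub>A\<^esub> a)] 1 - Poly_Mapping.single [e a] c \<in> S"
    using assms by (intro subsetD[OF rel]) (unfold hom_relations_def, blast)
qed (use assms in \<open>simp_all add: letter_closed\<close>)

lemma cls_letter_mult: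
  assumes "a \<in> carrier A" "b \<in> carrier A"
  shows "cls [e (a \<otimes>\<^bsub>A\<^esub> b)] = cls [e a, e b]"
proof (rule cls_rel)
  show "Poly_Mapping.single [e (a \<otimes>\<^bsub>A\<^esub> b)] 1 - Poly_Mapping.single [e a, e b] 1 \<in> S"
    using assms by (intro subsetD[OF rel]) (unfold hom_relations_def, blast)
qed (use assms in \<open>simp_all add: letter_closed\<close>)

lemma cls_letter_one: "cls [e \<one>\<^bsub>A\<^esub>] = cls []"
proof (rule cls_rel)
  show "Poly_Mapping.single [e \<one>\<^bsub>A\<^esub>] 1 - Poly_Mapping.single [] 1 \<in> S"
    by (intro subsetD[OF rel]) (unfold hom_relations_def, blast)
qed (simp_all add: letter_closed)

end

end

section \<open>Noncommutative probability spaces\<close>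

lemma (in complex_algebra) complex_smult_simps [simp]:
  "x \<in> carrier A \<Longrightarrow> c \<odot> x \<in> carrier A"
  "x \<in> carrier A \<Longrightarrow> 1 \<odot> x = x"
  "x \<in> carrier A \<Longrightarrow> 0 \<odot> x = \<zero>"
  "x \<in> carrier A \<Longrightarrow> c \<odot> (d \<odot> x) = (c * d) \<odot> x"
  using smult_one[of x] smult_l_null[of x] smult_assoc1[of c d x] by simp_all

lemma linear_functional_simps:
  assumes "linear_functional A f"
  shows "x \<in> carrier A \<Longrightarrow> y \<in> carrier A \<Longrightarrow> f (x \<oplus>\<^bsub>A\<^esub> y) = f x + f y"
    and "x \<in> carrier A \<Longrightarrow> f (c \<odot>\<^bsub>A\<^esub> x) = c * f x"
  using assms by (simp_all add: linear_functional_def)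

lemma linear_functional_zero: "complex_algebra B \<Longrightarrow> linear_functional B f \<Longrightarrow> f \<zero>\<^bsub>B\<^esub> = 0"
proof -
  assume B: "complex_algebra B" and f: "linear_functional B f"
  interpret complex_algebra B by (rule B)
  show ?thesis
    using linear_functional_simps(2)[OF f, of "\<zero>\<^bsub>B\<^esub>" 0] by simp
qed

lemma linear_functional_minus:
  assumes B: "complex_algebra B" and f: "linear_functional B f" and x: "x \<in> carrier B" "y \<in> carrier B"
  shows "f (x \<ominus>\<^bsub>B\<^esub> y) = f x - f y"
proof -
  interpret complex_algebra B by (rule B)
  have "f (x \<ominus>\<^bsub>B\<^esub> y \<oplus>\<^bsub>B\<^esub> y) = f (x \<ominus>\<^bsub>B\<^esub> y) + f y"
    using x by (intro linear_functional_simps(1)[OF f]) simp_all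
  moreover have "x \<ominus>\<^bsub>B\<^esub> y \<oplus>\<^bsub>B\<^esub> y = x"
    using x by (simp add: a_minus_def a_assoc l_neg)
  ultimately show ?thesis by simp
qed

context nc_probability_space
begin

lemmas functional_simps [simp] = linear_functional_simps[OF functional_linear]

declare functional_one [simp]

definition center :: "'a \<Rightarrow> 'a" where
  "center a = a \<oplus> (- \<phi> a) \<odot> \<one>"

lemma center_closed [simp]: "a \<in> carrier A \<Longrightarrow> center a \<in> carrier A"
  by (simp add: center_def)

lemma functional_center [simp]: "a \<in> carrier A \<Longrightarrow> \<phi> (center a) = 0"
  by (simp add: center_def)

lemma center_decomp: 
  assumes "a \<in> carrier A"
  shows "center a \<oplus> \<phi> a \<odot> \<one> = a"
proof -
  have "(- \<phi> a) \<odot> \<one> \<oplus> \<phi> a \<odot> \<one> = \<zero>"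
    using smult_l_distr[of "- \<phi> a" "\<phi> a" \<one>] by simp
  then show ?thesis
    using assms by (simp add: center_def a_assoc)
qed

lemma center_eq: "a \<in> carrier A \<Longrightarrow> \<phi> a = 0 \<Longrightarrow> center a = a"
  by (simp add: center_def)

end

section \<open>The extension by an idempotent\<close>

lemma idem_algebra_simps [simp]:
  "x \<in> carrier idem_algebra"
  "x \<otimes>\<^bsub>idem_algebra\<^esub> y = (fst x * fst y, fst x * snd y + snd x * fst y + snd x * snd y)"
  "\<one>\<^bsub>idem_algebra\<^esub> = (1, 0)" "\<zero>\<^bsub>idem_algebra\<^esub> = (0, 0)"
  "x \<oplus>\<^bsub>idem_algebra\<^esub> y = (fst x + fst y, snd x + snd y)"
  "c \<odot>\<^bsub>idem_algebra\<^esub> x = (c * fst x, c * snd x)"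
  by (simp_all add: idem_algebra_def case_prod_beta)

lemma complex_algebra_idem_algebra: "complex_algebra idem_algebra"
proof -
  have grp: "abelian_group idem_algebra"
  proof (rule abelian_groupI)
    fix x
    show "\<exists>y\<in>carrier idem_algebra. y \<oplus>\<^bsub>idem_algebra\<^esub> x = \<zero>\<^bsub>idem_algebra\<^esub>"
      by (rule bexI[of _ "(- fst x, - snd x)"]) auto
  qed (auto simp: algebra_simps)
  have "Group.monoid idem_algebra"
    by (rule monoidI) (auto simp: algebra_simps)
  then have "ring idem_algebra"
    by (rule ringI[OF grp]) (auto simp: algebra_simps)
  moreover have "module complex_ring idem_algebra"
    by (rule moduleI[OF cring_complex_ring grp]) (auto simp: algebra_simps)
  ultimately show ?thesis
    by (intro complex_algebra.intro complex_algebra_axioms.intro) (auto simp: algebra_simps)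
qed

lemma map_splice: "map f (splice xs ys) = splice (map f xs) (map f ys)"
  by (induction xs ys rule: splice.induct) auto

context nc_probability_space
begin

abbreviation "ext_letters \<equiv> carrier A <+> carrier idem_algebra"

abbreviation "ext_relations \<equiv> hom_relations A Inl \<union> hom_relations idem_algebra Inr"

abbreviation idem_letter :: "'a + complex \<times> complex" where
  "idem_letter \<equiv> Inr (0, 1)"

lemma ext_letters_simps [simp]: "Inl a \<in> ext_letters \<longleftrightarrow> a \<in> carrier A" "Inr p \<in> ext_letters"
  by auto

lemma complex_algebra_A: "complex_algebra A"
  by unfold_locales

sublocale E: word_quotient ext_letters ext_relations
  using hom_relations_closed[OF complex_algebra_A, of Inl ext_letters]
    hom_relations_closed[OF complex_algebra_idem_algebra, of Inr ext_letters]
  by unfold_locales auto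

lemma Q_ext: "E.Q = ext_algebra A"
  by (simp add: ext_algebra_def)

lemma cls_ext_emb: "E.cls [Inl a] = ext_emb A a"
  unfolding E.cls_def ext_emb_def ..

lemma cls_ext_idem: "E.cls [idem_letter] = ext_idem A"
  unfolding E.cls_def ext_idem_def ..

lemma emb_add: "a \<in> carrier A \<Longrightarrow> b \<in> carrier A \<Longrightarrow>
    E.cls [Inl (a \<oplus> b)] = E.cls [Inl a] \<oplus>\<^bsub>E.Q\<^esub> E.cls [Inl b]"
  by (rule E.cls_letter_add[OF complex_algebra_A]) auto

lemma emb_smult: "a \<in> carrier A \<Longrightarrow> E.cls [Inl (c \<odot> a)] = c \<odot>\<^bsub>E.Q\<^esub> E.cls [Inl a]"
  by (rule E.cls_letter_smult[OF complex_algebra_A]) auto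

lemma emb_mult: "a \<in> carrier A \<Longrightarrow> b \<in> carrier A \<Longrightarrow> E.cls [Inl (a \<otimes> b)] = E.cls [Inl a, Inl b]"
  by (rule E.cls_letter_mult[OF complex_algebra_A]) auto

lemma emb_one: "E.cls [Inl \<one>] = E.cls []"
  by (rule E.cls_letter_one[OF complex_algebra_A]) auto

lemma idem_decomp:
  "E.cls [Inr (s, t)] = s \<odot>\<^bsub>E.Q\<^esub> E.cls [] \<oplus>\<^bsub>E.Q\<^esub> t \<odot>\<^bsub>E.Q\<^esub> E.cls [idem_letter]"
proof -
  have "E.cls [Inr (s, t)] = E.cls [Inr ((s, 0) \<oplus>\<^bsub>idem_algebra\<^esub> (0, t))]"
    by simp
  also have "\<dots> = E.cls [Inr (s, 0)] \<oplus>\<^bsub>E.Q\<^esub> E.cls [Inr (0, t)]"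
    by (rule E.cls_letter_add[OF complex_algebra_idem_algebra]) auto
  also have "E.cls [Inr (0, t)] = E.cls [Inr (t \<odot>\<^bsub>idem_algebra\<^esub> (0, 1))]"
    by simp
  also have "\<dots> = t \<odot>\<^bsub>E.Q\<^esub> E.cls [idem_letter]"
    by (rule E.cls_letter_smult[OF complex_algebra_idem_algebra]) auto
  also have "E.cls [Inr (s, 0)] = E.cls [Inr (s \<odot>\<^bsub>idem_algebra\<^esub> \<one>\<^bsub>idem_algebra\<^esub>)]"
    by simp
  also have "\<dots> = s \<odot>\<^bsub>E.Q\<^esub> E.cls [Inr \<one>\<^bsub>idem_algebra\<^esub>]"
    by (rule E.cls_letter_smult[OF complex_algebra_idem_algebra]) auto
  also have "E.cls [Inr \<one>\<^bsub>idem_algebra\<^esub>] = E.cls []"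
    by (rule E.cls_letter_one[OF complex_algebra_idem_algebra]) auto
  finally show ?thesis .
qed

lemma idem_idem: "E.cls [idem_letter, idem_letter] = E.cls [idem_letter]"
  using E.cls_letter_mult[OF complex_algebra_idem_algebra, of Inr "(0, 1)" "(0, 1)"] by auto

text \<open>The algebra \<open>\<A> \<star> \<complex>[p]\<close> acts on \<open>\<A>\<close>: elements of \<open>\<A>\<close> by left multiplication and \<open>p\<close> as
  the projection \<open>x \<mapsto> \<phi>(x) 1\<close>. The extended functional is the vector state of \<open>1\<close>.\<close>

fun act_letter :: "'a + complex \<times> complex \<Rightarrow> 'a \<Rightarrow> 'a" where
  "act_letter (Inl a) x = a \<otimes> x"
| "act_letter (Inr (s, t)) x = s \<odot> x \<oplus> (t * \<phi> x) \<odot> \<one>"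

definition act :: "('a + complex \<times> complex) list \<Rightarrow> 'a \<Rightarrow> 'a" where
  "act w x = foldr act_letter w x"

lemma act_simps [simp]: "act [] x = x" "act (l # w) x = act_letter l (act w x)"
  "act (v @ w) x = act v (act w x)"
  by (simp_all add: act_def)

lemma act_letter_Inr: "act_letter (Inr p) x = fst p \<odot> x \<oplus> (snd p * \<phi> x) \<odot> \<one>"
  by (cases p) simp

lemma act_letter_closed: "l \<in> ext_letters \<Longrightarrow> x \<in> carrier A \<Longrightarrow> act_letter l x \<in> carrier A"
  by (cases l) (auto simp: act_letter_Inr)

lemma act_letter_add: "l \<in> ext_letters \<Longrightarrow> x \<in> carrier A \<Longrightarrow> y \<in> carrier A \<Longrightarrow>
    act_letter l (x \<oplus> y) = act_letter l x \<oplus> act_letter l y"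
  by (cases l) (auto simp: act_letter_Inr r_distr smult_r_distr smult_l_distr[simplified] distrib_left a_ac)

lemma act_letter_smult: "l \<in> ext_letters \<Longrightarrow> x \<in> carrier A \<Longrightarrow>
    act_letter l (c \<odot> x) = c \<odot> act_letter l x"
  by (cases l) (auto simp: act_letter_Inr smult_assoc_right smult_r_distr mult_ac)

lemma act_closed [simp]: "w \<in> lists ext_letters \<Longrightarrow> x \<in> carrier A \<Longrightarrow> act w x \<in> carrier A"
  by (induction w) (simp_all add: act_letter_closed)

text \<open>The vector \<open>x\<close> is left free, not fixed to the unit, because the uniqueness
  proof absorbs letters into it one at a time.\<close>

definition matrix_coeff :: "('a + complex \<times> complex) list \<Rightarrow> 'a \<Rightarrow> complex" where
  "matrix_coeff w x = \<phi> (act w x)"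

lemma act_add:
  "w \<in> lists ext_letters \<Longrightarrow> x \<in> carrier A \<Longrightarrow> y \<in> carrier A \<Longrightarrow> act w (x \<oplus> y) = act w x \<oplus> act w y"
  by (induction w) (simp_all add: act_letter_add)

lemma act_smult:
  "w \<in> lists ext_letters \<Longrightarrow> x \<in> carrier A \<Longrightarrow> act w (c \<odot> x) = c \<odot> act w x"
  by (induction w) (simp_all add: act_letter_smult)

lemma linear_matrix_coeff: "w \<in> lists ext_letters \<Longrightarrow> linear_functional A (matrix_coeff w)"
  by (simp add: linear_functional_def matrix_coeff_def act_add act_smult)

definition ext_val :: "('a + complex \<times> complex) list \<Rightarrow> complex" where
  "ext_val w = matrix_coeff w \<one>"

lemma ext_val_append: "ext_val (u @ x @ v) = matrix_coeff u (act x (act v \<one>))"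
  by (simp add: ext_val_def matrix_coeff_def)

text \<open>The right context only changes the vector, to \<open>act v \<one>\<close>, and the left
  context only changes the linear functional, to \<open>matrix_coeff u\<close>. What remains is that
  \<open>act\<close> respects the relations, in particular that \<open>p\<close> acts as an
  idempotent, which rests on \<phi>(1) = 1.\<close>

lemma compatible_ext_val: "E.compatible ext_val"
  unfolding E.compatible_def
proof (intro ballI)
  fix r u v assume r: "r \<in> ext_relations" and u: "u \<in> carrier (word_monoid ext_letters)"
    and v: "v \<in> carrier (word_monoid ext_letters)"
  define z where "z = act v \<one>"
  have z [simp]: "z \<in> carrier A"
    using v by (simp add: z_def)
  have u': "u \<in> lists ext_letters"
    using u by simp
  note lin [simp] = linear_functional_simps[OF linear_matrix_coeff[OF u']]
  have "lin_ext (\<lambda>x. matrix_coeff u (act x z)) r = 0"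
    using r unfolding hom_relations_def
    by (elim UnE CollectE exE conjE insertE emptyE; hypsubst)
      (simp_all add: l_distr smult_assoc_left m_assoc algebra_simps split_beta act_letter_Inr)
  then show "lin_ext (\<lambda>x. ext_val (u \<otimes>\<^bsub>word_monoid ext_letters\<^esub> x \<otimes>\<^bsub>word_monoid ext_letters\<^esub> v)) r = 0"
    by (simp add: ext_val_append z_def)
qed

section \<open>Alternating words and the characterization of the extended functional\<close>

definition alt_word :: "'a list \<Rightarrow> ('a + complex \<times> complex) list" where
  "alt_word as = splice (map Inl as) (replicate (length as - 1) idem_letter)"

lemma alt_word_simps [simp]:
  "alt_word [a] = [Inl a]"
  "alt_word (a # b # as) = Inl a # idem_letter # alt_word (b # as)"
  by (simp_all add: alt_word_def)

text \<open>The order of quantifiers matters: the tail \<open>r\<close> does not depend on the first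
  letter, so that letter can be replaced by a product while the rest of the word stays put.\<close>

lemma alt_word_Cons: "\<exists>r\<in>lists ext_letters. \<forall>a. alt_word (a # as) = Inl a # r"
  if "set as \<subseteq> carrier A"
  using that
proof (induction as)
  case (Cons b as)
  then obtain r where "r \<in> lists ext_letters" "\<forall>a. alt_word (a # as) = Inl a # r"
    by auto
  then show ?case
    using Cons.prems by (intro bexI[of _ "idem_letter # Inl b # r"]) auto
qed auto

lemma alt_word_closed: "set as \<subseteq> carrier A \<Longrightarrow> as \<noteq> [] \<Longrightarrow> alt_word as \<in> lists ext_letters"
  using alt_word_Cons[of "tl as"] by (cases as) fastforce+

lemma idem_word_eq_cls:
  assumes "set as \<subseteq> carrier A" "as \<noteq> []"
  shows "idem_word A as = E.cls (alt_word as)"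
proof -
  have "idem_word A as = list_prod E.Q (map (\<lambda>l. E.cls [l]) (alt_word as))"
    by (simp add: idem_word_def alt_word_def map_splice comp_def cls_ext_emb cls_ext_idem Q_ext)
  also have "\<dots> = E.cls (alt_word as)"
    using alt_word_closed[OF assms] by (intro E.list_prod_cls) (auto simp: in_lists_conv_set)
  finally show ?thesis .
qed

lemma matrix_coeff_alt_word:
  "set as \<subseteq> carrier A \<Longrightarrow> as \<noteq> [] \<Longrightarrow> matrix_coeff (alt_word as) \<one> = prod_list (map \<phi> as)"
proof (induction as rule: induct_list012)
  case (3 a b as)
  then have "alt_word (b # as) \<in> lists ext_letters"
    by (intro alt_word_closed) auto
  with 3 show ?case
    by (simp add: matrix_coeff_def smult_assoc_right)
qed (simp_all add: matrix_coeff_def)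


text \<open>The letters of \<open>w\<close> are absorbed from the right into the alternating word
  behind them: an element of the algebra is multiplied into its first letter, while \<open>p\<close>
  opens a new block. Each step mirrors \<open>act_letter\<close>, so the prescribed values on
  alternating words determine the functional on all words.\<close>

lemma linear_on_alt_words:
  assumes lin: "linear_functional E.Q \<psi>"
    and alt: "\<And>as. as \<noteq> [] \<Longrightarrow> set as \<subseteq> carrier A \<Longrightarrow> \<psi> (E.cls (alt_word as)) = prod_list (map \<phi> as)"
    and "w \<in> lists ext_letters" "a \<in> carrier A" "set as \<subseteq> carrier A"
  shows "\<psi> (E.cls (w @ alt_word (a # as))) = matrix_coeff w a * prod_list (map \<phi> as)"
  using assms(3-5)
proof (induction w arbitrary: a as rule: rev_induct)
  case Nil
  then show ?case
    using alt[of "a # as"] by (simp add: matrix_coeff_def)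
next
  case (snoc l w)
  note lin_simps = linear_functional_simps[OF lin]
  have w: "w \<in> lists ext_letters" and l: "l \<in> ext_letters"
    using snoc.prems by auto
  obtain r where r: "r \<in> lists ext_letters" "\<And>a. alt_word (a # as) = Inl a # r"
    using alt_word_Cons[OF snoc.prems(3)] by blast
  show ?case
  proof (cases l)
    case (Inl b)
    with l have b: "b \<in> carrier A" by auto
    have "E.cls (w @ [Inl (b \<otimes> a)] @ r) = E.cls (w @ [Inl b, Inl a] @ r)"
      using b snoc.prems w r by (intro E.cls_context emb_mult) auto
    then show ?thesis
      using snoc.IH[of "b \<otimes> a" as] snoc.prems b w by (simp add: Inl r matrix_coeff_def)
  next
    case (Inr p)
    obtain s t where p: "p = (s, t)" by force
    define v where "v = alt_word (a # as)"
    have v: "v \<in> lists ext_letters"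
      using snoc.prems unfolding v_def by (intro alt_word_closed) auto
    \<comment> \<open>A unit inserted before \<open>p\<close> restores the alternating shape; the
      new block starts with the letter \<open>\<one>\<close>, as \<open>p\<close> maps every vector
      to a multiple of it.\<close>
    have "E.cls (w @ [Inl \<one>] @ idem_letter # v) = E.cls (w @ [] @ idem_letter # v)"
      using v w by (intro E.cls_context emb_one) auto
    then have "E.cls (w @ idem_letter # v) = E.cls (w @ alt_word (\<one> # a # as))"
      by (simp add: v_def)
    then have 1: "\<psi> (E.cls (w @ [idem_letter] @ v)) = matrix_coeff w \<one> * (\<phi> a * prod_list (map \<phi> as))"
      using snoc.IH[of \<one> "a # as"] snoc.prems w by simp
    have 2: "\<psi> (E.cls (w @ [] @ v)) = matrix_coeff w a * prod_list (map \<phi> as)"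
      using snoc.IH[of a as] snoc.prems w by (simp add: v_def)
    have "E.cls (w @ [Inr (s, t)] @ v) =
        s \<odot>\<^bsub>E.Q\<^esub> E.cls (w @ [] @ v) \<oplus>\<^bsub>E.Q\<^esub> t \<odot>\<^bsub>E.Q\<^esub> E.cls (w @ [idem_letter] @ v)"
    proof -
      have split: "E.cls (w @ x @ v) = E.cls w \<otimes>\<^bsub>E.Q\<^esub> (E.cls x \<otimes>\<^bsub>E.Q\<^esub> E.cls v)"
        if "x \<in> lists ext_letters" for x
        using v w that by (simp only: E.cls_append append_in_lists_conv simp_thms)
      have closed: "E.cls w \<in> carrier E.Q" "E.cls v \<in> carrier E.Q" "E.cls [] \<in> carrier E.Q"
        "E.cls [idem_letter] \<in> carrier E.Q"
        using v w by simp_all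
      have "E.cls (w @ [Inr (s, t)] @ v) = E.cls w \<otimes>\<^bsub>E.Q\<^esub>
          ((s \<odot>\<^bsub>E.Q\<^esub> E.cls [] \<oplus>\<^bsub>E.Q\<^esub> t \<odot>\<^bsub>E.Q\<^esub> E.cls [idem_letter]) \<otimes>\<^bsub>E.Q\<^esub> E.cls v)"
        by (simp only: split Cons_in_lists_iff ext_letters_simps lists.Nil simp_thms idem_decomp[of s t])
      also have "\<dots> = s \<odot>\<^bsub>E.Q\<^esub> (E.cls w \<otimes>\<^bsub>E.Q\<^esub> (E.cls [] \<otimes>\<^bsub>E.Q\<^esub> E.cls v)) \<oplus>\<^bsub>E.Q\<^esub>
          t \<odot>\<^bsub>E.Q\<^esub> (E.cls w \<otimes>\<^bsub>E.Q\<^esub> (E.cls [idem_letter] \<otimes>\<^bsub>E.Q\<^esub> E.cls v))"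
        by (simp only: closed E.Q.l_distr E.Q.r_distr E.Q.smult_assoc_left E.Q.smult_assoc_right
            E.Q.complex_smult_simps E.Q.m_closed)
      finally show ?thesis
        by (simp only: split Cons_in_lists_iff ext_letters_simps lists.Nil simp_thms)
    qed
    then have "\<psi> (E.cls (w @ [Inr (s, t)] @ v)) =
        s * (matrix_coeff w a * prod_list (map \<phi> as)) + t * (matrix_coeff w \<one> * (\<phi> a * prod_list (map \<phi> as)))"
      using v w by (simp add: lin_simps 1 2 del: append_Nil append_Cons)
    also have "\<dots> = matrix_coeff w (act_letter l a) * prod_list (map \<phi> as)"
      using snoc.prems w linear_functional_simps[OF linear_matrix_coeff[OF w]]
      by (simp add: Inr p algebra_simps)
    finally show ?thesis
      by (simp add: Inr p v_def matrix_coeff_def)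
  qed
qed

lemma ext_functional_eq: "ext_functional A \<phi> = E.induced ext_val"
  unfolding ext_functional_def
proof (rule the_equality, goal_cases)
  case 1
  have pow: "ext_idem A [^]\<^bsub>E.Q\<^esub> \<gamma> = E.cls (replicate \<gamma> idem_letter)" if "\<gamma> \<in> {0, 1}" for \<gamma> :: nat
  proof -
    have "E.cls [idem_letter] \<in> carrier E.Q"
      by simp
    then show ?thesis
      using that E.cls_one E.Q.l_one by (auto simp: cls_ext_idem[symmetric] Q_ext[symmetric] nat_pow_def)
  qed
  have "E.induced ext_val (ext_idem A [^]\<^bsub>ext_algebra A\<^esub> \<gamma> \<otimes>\<^bsub>ext_algebra A\<^esub> idem_word A as
               \<otimes>\<^bsub>ext_algebra A\<^esub> ext_idem A [^]\<^bsub>ext_algebra A\<^esub> \<delta>) = prod_list (map \<phi> as)"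
    if "\<gamma> \<in> {0, 1}" "\<delta> \<in> {0, 1}" "as \<noteq> []" "set as \<subseteq> carrier A" for \<gamma> \<delta> :: nat and as
  proof -
    let ?p = "\<lambda>n. replicate n idem_letter"
    have w: "alt_word as \<in> lists ext_letters"
      using that by (intro alt_word_closed)
    have p: "?p n \<in> lists ext_letters" for n
      by (auto simp: in_lists_conv_set)
    \<comment> \<open>The outer idempotents are invisible: \<open>p\<close> fixes the vector
      \<open>\<one>\<close>, and \<phi> after \<open>p\<close> is again \<phi>.\<close>
    have "act (?p \<delta>) \<one> = \<one>"
      using that(2) by auto
    moreover have "\<phi> (act (?p \<gamma>) y) = \<phi> y" if "y \<in> carrier A" for y
      using \<open>\<gamma> \<in> {0, 1}\<close> that by auto
    ultimately have "ext_val ((?p \<gamma> @ alt_word as) @ ?p \<delta>) = prod_list (map \<phi> as)"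
      using matrix_coeff_alt_word[OF that(4,3)] w by (simp add: ext_val_def matrix_coeff_def)
    moreover have "E.cls (?p \<gamma>) \<otimes>\<^bsub>E.Q\<^esub> E.cls (alt_word as) \<otimes>\<^bsub>E.Q\<^esub> E.cls (?p \<delta>) =
        E.cls ((?p \<gamma> @ alt_word as) @ ?p \<delta>)"
      using w p by (simp only: E.cls_append append_in_lists_conv simp_thms)
    moreover have "E.induced ext_val (E.cls ((?p \<gamma> @ alt_word as) @ ?p \<delta>)) = ext_val ((?p \<gamma> @ alt_word as) @ ?p \<delta>)"
      using w p by (intro E.induced_cls compatible_ext_val) (simp only: word_monoid_simps append_in_lists_conv simp_thms)
    ultimately show ?thesis
      by (simp add: pow[OF that(1)] pow[OF that(2)] idem_word_eq_cls[OF that(4,3)] flip: Q_ext)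
  qed
  moreover have "E.induced ext_val (ext_idem A) = 1"
    by (simp add: cls_ext_idem[symmetric] E.induced_cls[OF compatible_ext_val] ext_val_def matrix_coeff_def)
  ultimately show ?case
    using E.induced_extensional[of ext_val] E.linear_induced[OF compatible_ext_val]
    unfolding Q_ext by blast
next
  case (2 \<psi>)
  then have lin: "linear_functional E.Q \<psi>" and ext: "\<psi> \<in> extensional (carrier E.Q)"
    by (simp_all add: Q_ext)
  have alt: "\<psi> (E.cls (alt_word as)) = prod_list (map \<phi> as)" if "as \<noteq> []" "set as \<subseteq> carrier A" for as
  proof -
    have "E.cls (alt_word as) \<in> carrier E.Q"
      using alt_word_closed that by simp
    then show ?thesis
      using 2 that by (auto simp: idem_word_eq_cls Q_ext[symmetric])
  qed
  have vals: "\<psi> (E.cls w) = E.induced ext_val (E.cls w)" if w: "w \<in> lists ext_letters" for w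
  proof -
    \<comment> \<open>A unit at the end presents any word as \<open>w\<close> followed by an
      alternating word of one letter.\<close>
    have "E.cls w = E.cls (w @ [Inl \<one>] @ [])"
      using E.cls_context[OF emb_one w] by simp
    then have "\<psi> (E.cls w) = ext_val w"
      using linear_on_alt_words[OF lin alt w, of \<one> "[]"] by (simp add: ext_val_def)
    then show ?thesis
      using w by (simp add: E.induced_cls[OF compatible_ext_val])
  qed
  have "\<psi> x = E.induced ext_val x" if "x \<in> carrier E.Q" for x
    by (rule E.linear_functional_eqI[OF lin E.linear_induced[OF compatible_ext_val] _ that])
      (rule vals, simp only: word_monoid_simps)
  then show ?case
    by (rule extensionalityI[OF ext E.induced_extensional])
qed

section \<open>Evaluation rules for the extended functional\<close>

lemma complex_algebra_ext: "complex_algebra (ext_algebra A)"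
  unfolding Q_ext[symmetric] by unfold_locales

lemma linear_ext_functional: "linear_functional (ext_algebra A) (ext_functional A \<phi>)"
  using E.linear_induced[OF compatible_ext_val] unfolding ext_functional_eq Q_ext .

lemma ext_idem_closed: "ext_idem A \<in> carrier (ext_algebra A)"
  unfolding Q_ext[symmetric] cls_ext_idem[symmetric] by (rule E.cls_closed) simp

lemma ext_emb_closed: "a \<in> carrier A \<Longrightarrow> ext_emb A a \<in> carrier (ext_algebra A)"
  unfolding Q_ext[symmetric] cls_ext_emb[symmetric] by (rule E.cls_closed) simp

lemma ext_idem_idem: "ext_idem A \<otimes>\<^bsub>ext_algebra A\<^esub> ext_idem A = ext_idem A"
  using E.cls_append[of "[idem_letter]" "[idem_letter]"]
  by (simp add: idem_idem cls_ext_idem Q_ext)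

lemma ext_emb_one: "ext_emb A \<one> = \<one>\<^bsub>ext_algebra A\<^esub>"
  using emb_one E.cls_one unfolding cls_ext_emb word_monoid_simps Q_ext by simp

lemma ext_emb_mult: "a \<in> carrier A \<Longrightarrow> b \<in> carrier A \<Longrightarrow>
    ext_emb A (a \<otimes> b) = ext_emb A a \<otimes>\<^bsub>ext_algebra A\<^esub> ext_emb A b"
  using emb_mult[of a b] E.cls_append[of "[Inl a]" "[Inl b]"] by (simp add: cls_ext_emb Q_ext)

lemma ext_emb_add: "a \<in> carrier A \<Longrightarrow> b \<in> carrier A \<Longrightarrow>
    ext_emb A (a \<oplus> b) = ext_emb A a \<oplus>\<^bsub>ext_algebra A\<^esub> ext_emb A b"
  using emb_add[of a b] by (simp add: cls_ext_emb Q_ext)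

lemma ext_emb_smult: "a \<in> carrier A \<Longrightarrow> ext_emb A (c \<odot> a) = c \<odot>\<^bsub>ext_algebra A\<^esub> ext_emb A a"
  using emb_smult[of a c] by (simp add: cls_ext_emb Q_ext)

lemma ext_functional_cls: "w \<in> lists ext_letters \<Longrightarrow> ext_functional A \<phi> (E.cls w) = ext_val w"
  unfolding ext_functional_eq by (rule E.induced_cls[OF compatible_ext_val]) simp

lemma ext_functional_one: "ext_functional A \<phi> \<one>\<^bsub>ext_algebra A\<^esub> = 1"
  using ext_functional_cls[of "[]"] E.cls_one by (simp add: Q_ext ext_val_def matrix_coeff_def)

lemma ext_functional_idem: "ext_functional A \<phi> (ext_idem A) = 1"
  using ext_functional_cls[of "[idem_letter]"] by (simp add: cls_ext_idem ext_val_def matrix_coeff_def)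

lemma ext_functional_emb: "a \<in> carrier A \<Longrightarrow> ext_functional A \<phi> (ext_emb A a) = \<phi> a"
  using ext_functional_cls[of "[Inl a]"] by (simp add: cls_ext_emb ext_val_def matrix_coeff_def)

text \<open>In the representation \<open>p a\<close> sends the vector \<open>\<one>\<close> to its
  multiple by \<phi>(a), whatever stands to the left. So \<open>p\<close> followed by a centered
  letter gives zero, and for the unit in place of \<open>a\<close> an idempotent at the right end
  disappears.\<close>

lemma ext_functional_idem_emb:
  assumes "y \<in> carrier (ext_algebra A)" and a: "a \<in> carrier A"
  shows "ext_functional A \<phi> (y \<otimes>\<^bsub>ext_algebra A\<^esub> (ext_idem A \<otimes>\<^bsub>ext_algebra A\<^esub> ext_emb A a)) =
    \<phi> a * ext_functional A \<phi> y"
proof -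
  let ?f = "ext_functional A \<phi>"
  note lin = linear_functional_simps[OF linear_ext_functional[folded Q_ext]]
  have pa: "E.cls [idem_letter, Inl a] \<in> carrier E.Q"
    using a by simp
  have "?f (y \<otimes>\<^bsub>E.Q\<^esub> E.cls [idem_letter, Inl a]) = \<phi> a * ?f y" if "y \<in> carrier E.Q"
    using that
  proof (induction y rule: E.quot_induct)
    case (smult_cls m c)
    then have m: "m \<in> lists ext_letters" and m': "m @ [idem_letter, Inl a] \<in> lists ext_letters"
      using a by simp_all
    have "E.cls m \<otimes>\<^bsub>E.Q\<^esub> E.cls [idem_letter, Inl a] = E.cls (m @ [idem_letter, Inl a])"
      using m a by (simp add: E.cls_append)
    moreover have "?f (E.cls (m @ [idem_letter, Inl a])) = \<phi> a * ?f (E.cls m)"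
      using a linear_functional_simps(2)[OF linear_matrix_coeff[OF m], of \<one> "\<phi> a"]
      unfolding ext_functional_cls[OF m] ext_functional_cls[OF m']
      by (simp add: ext_val_def matrix_coeff_def)
    ultimately show ?case
      using smult_cls m m' pa by (simp only: E.Q.smult_assoc_left lin E.cls_closed word_monoid_simps mult.left_commute)
  next
    case (add x y)
    then show ?case
      by (simp only: E.Q.l_distr lin E.Q.m_closed distrib_left pa)
  qed
  moreover have "E.cls [idem_letter, Inl a] = ext_idem A \<otimes>\<^bsub>E.Q\<^esub> ext_emb A a"
    using E.cls_append[of "[idem_letter]" "[Inl a]"] a by (simp add: cls_ext_emb cls_ext_idem)
  ultimately show ?thesis
    using assms(1) by (simp add: Q_ext)
qed

lemma ext_functional_mult_idem:
  assumes "y \<in> carrier (ext_algebra A)"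
  shows "ext_functional A \<phi> (y \<otimes>\<^bsub>ext_algebra A\<^esub> ext_idem A) = ext_functional A \<phi> y"
proof -
  interpret X: complex_algebra "ext_algebra A" by (rule complex_algebra_ext)
  show ?thesis
    using ext_functional_idem_emb[OF assms one_closed] ext_idem_closed by (simp add: ext_emb_one)
qed

end

section \<open>The infinite tensor product\<close>

locale nc_family =
  fixes I :: "'i set" and A :: "'i \<Rightarrow> (complex, 'a) module" and \<phi> :: "'i \<Rightarrow> 'a \<Rightarrow> complex"
  assumes nc: "l \<in> I \<Longrightarrow> nc_probability_space (A l) (\<phi> l)"
begin

abbreviation "Ext l \<equiv> ext_algebra (A l)"

abbreviation "ext_fun l \<equiv> ext_functional (A l) (\<phi> l)"

lemmas ext_facts = nc[THEN nc_probability_space.ext_functional_one]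
  nc[THEN nc_probability_space.ext_functional_idem]
  nc[THEN nc_probability_space.ext_idem_closed]
  nc[THEN nc_probability_space.ext_idem_idem]

lemma ext_algebra_I: "l \<in> I \<Longrightarrow> complex_algebra (Ext l)"
  by (rule nc_probability_space.complex_algebra_ext[OF nc])

lemma ext_monoid: "l \<in> I \<Longrightarrow> Group.monoid (Ext l)"
  using ext_algebra_I[THEN complex_algebra.axioms(2)] ring.is_monoid by blast

lemma ext_simps [simp]:
  assumes "l \<in> I"
  shows "\<one>\<^bsub>Ext l\<^esub> \<in> carrier (Ext l)"
    and "ext_idem (A l) \<in> carrier (Ext l)"
    and "ext_idem (A l) \<otimes>\<^bsub>Ext l\<^esub> ext_idem (A l) = ext_idem (A l)"
    and "ext_fun l \<one>\<^bsub>Ext l\<^esub> = 1"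
    and "ext_fun l (ext_idem (A l)) = 1"
    and "x \<in> carrier (Ext l) \<Longrightarrow> y \<in> carrier (Ext l) \<Longrightarrow> x \<otimes>\<^bsub>Ext l\<^esub> y \<in> carrier (Ext l)"
    and "x \<in> carrier (Ext l) \<Longrightarrow> \<one>\<^bsub>Ext l\<^esub> \<otimes>\<^bsub>Ext l\<^esub> x = x"
    and "x \<in> carrier (Ext l) \<Longrightarrow> x \<otimes>\<^bsub>Ext l\<^esub> \<one>\<^bsub>Ext l\<^esub> = x"
  using ext_monoid[OF assms] ext_facts[OF assms]
  by (simp_all add: monoid.m_closed monoid.l_one monoid.r_one monoid.one_closed)

abbreviation "TM \<equiv> tensor_monoid I A"

lemma tensor_monoid_simps:
  "carrier TM = {x \<in> (\<Pi>\<^sub>E s\<in>sites I. carrier (Ext (fst s))). finite (tensor_support I A x)}"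
  "x \<otimes>\<^bsub>TM\<^esub> y = (\<lambda>s\<in>sites I. x s \<otimes>\<^bsub>Ext (fst s)\<^esub> y s)"
  "\<one>\<^bsub>TM\<^esub> = (\<lambda>s\<in>sites I. \<one>\<^bsub>Ext (fst s)\<^esub>)"
  by (simp_all add: tensor_monoid_def)

lemma TM_site: "x \<in> carrier TM \<Longrightarrow> s \<in> sites I \<Longrightarrow> x s \<in> carrier (Ext (fst s))"
  unfolding tensor_monoid_simps by (blast dest: PiE_mem)

lemma TM_finite: "x \<in> carrier TM \<Longrightarrow> finite (tensor_support I A x)"
  by (simp add: tensor_monoid_simps)

lemma TM_eqI:
  assumes "x \<in> carrier TM" "y \<in> carrier TM" "\<And>s. s \<in> sites I \<Longrightarrow> x s = y s"
  shows "x = y"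
proof (rule PiE_ext)
  show "x \<in> (\<Pi>\<^sub>E s\<in>sites I. carrier (Ext (fst s)))" "y \<in> (\<Pi>\<^sub>E s\<in>sites I. carrier (Ext (fst s)))"
    using assms by (simp_all only: tensor_monoid_simps mem_Collect_eq)
qed (rule assms(3))

lemma site_label: "s \<in> sites I \<Longrightarrow> fst s \<in> I"
  by auto

lemma TM_mult_site: "s \<in> sites I \<Longrightarrow> (x \<otimes>\<^bsub>TM\<^esub> y) s = x s \<otimes>\<^bsub>Ext (fst s)\<^esub> y s"
  by (simp only: tensor_monoid_simps restrict_apply' )

lemma TM_one_site: "s \<in> sites I \<Longrightarrow> \<one>\<^bsub>TM\<^esub> s = \<one>\<^bsub>Ext (fst s)\<^esub>"
  by (simp only: tensor_monoid_simps restrict_apply' )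

lemma TM_mult_closed:
  assumes x: "x \<in> carrier TM" and y: "y \<in> carrier TM"
  shows "x \<otimes>\<^bsub>TM\<^esub> y \<in> carrier TM"
proof -
  have "tensor_support I A (x \<otimes>\<^bsub>TM\<^esub> y) \<subseteq> tensor_support I A x \<union> tensor_support I A y"
    using site_label by (fastforce simp: tensor_support_def TM_mult_site)
  then have "finite (tensor_support I A (x \<otimes>\<^bsub>TM\<^esub> y))"
    by (rule finite_subset) (use x y TM_finite in blast)
  moreover have "x \<otimes>\<^bsub>TM\<^esub> y \<in> (\<Pi>\<^sub>E s\<in>sites I. carrier (Ext (fst s)))"
    unfolding tensor_monoid_simps(2)
    by (intro restrict_PiE_iff[THEN iffD2] ballI ext_simps TM_site x y site_label)
  ultimately show ?thesis
    by (simp only: tensor_monoid_simps(1) mem_Collect_eq)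
qed

text \<open>The support ignores idempotents as well as units, so infinitely many entries
  \<open>p\<close> are allowed. This admits the families behind the elements P_i(j).\<close>

lemma TM_config_closed:
  assumes "\<And>s. s \<in> sites I \<Longrightarrow> x s = \<one>\<^bsub>Ext (fst s)\<^esub> \<or> x s = ext_idem (A (fst s))"
  shows "(\<lambda>s\<in>sites I. x s) \<in> carrier TM"
proof -
  have "tensor_support I A (\<lambda>s\<in>sites I. x s) = {}"
    using assms by (auto simp: tensor_support_def)
  moreover have "x s \<in> carrier (Ext (fst s))" if "s \<in> sites I" for s
    using assms[OF that] site_label[OF that] by auto
  ultimately show ?thesis
    by (simp only: tensor_monoid_simps(1) mem_Collect_eq restrict_PiE_iff finite.emptyI ball_simps simp_thms) blast
qed

lemma TM_upd_closed:
  assumes x: "x \<in> carrier TM" and s: "s \<in> sites I" and u: "u \<in> carrier (Ext (fst s))"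
  shows "x(s := u) \<in> carrier TM"
proof -
  have "tensor_support I A (x(s := u)) \<subseteq> insert s (tensor_support I A x)"
    by (auto simp: tensor_support_def)
  then have "finite (tensor_support I A (x(s := u)))"
    by (rule finite_subset) (use x TM_finite in blast)
  moreover have "x(s := u) \<in> (\<Pi>\<^sub>E s\<in>insert s (sites I). carrier (Ext (fst s)))"
    using x u by (intro PiE_fun_upd) (simp_all only: tensor_monoid_simps mem_Collect_eq)
  ultimately show ?thesis
    using s by (simp only: tensor_monoid_simps(1) mem_Collect_eq insert_absorb)
qed

lemma monoid_TM: "Group.monoid TM"
proof (rule monoidI)
  show one: "\<one>\<^bsub>TM\<^esub> \<in> carrier TM"
    unfolding tensor_monoid_simps(3) by (rule TM_config_closed) simp
  fix x y z assume x: "x \<in> carrier TM" and y: "y \<in> carrier TM" and z: "z \<in> carrier TM"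
  show "x \<otimes>\<^bsub>TM\<^esub> y \<otimes>\<^bsub>TM\<^esub> z = x \<otimes>\<^bsub>TM\<^esub> (y \<otimes>\<^bsub>TM\<^esub> z)"
  proof (rule TM_eqI)
    fix s assume s: "s \<in> sites I"
    note closed = x[THEN TM_site, OF s] y[THEN TM_site, OF s] z[THEN TM_site, OF s]
    show "(x \<otimes>\<^bsub>TM\<^esub> y \<otimes>\<^bsub>TM\<^esub> z) s = (x \<otimes>\<^bsub>TM\<^esub> (y \<otimes>\<^bsub>TM\<^esub> z)) s"
      unfolding TM_mult_site[OF s]
      by (rule monoid.m_assoc[OF ext_monoid[OF site_label[OF s]] closed])
  qed (intro TM_mult_closed x y z)+
next
  fix x assume x: "x \<in> carrier TM"
  have one: "\<one>\<^bsub>TM\<^esub> \<in> carrier TM"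
    unfolding tensor_monoid_simps(3) by (rule TM_config_closed) simp
  show "\<one>\<^bsub>TM\<^esub> \<otimes>\<^bsub>TM\<^esub> x = x"
    by (rule TM_eqI[OF TM_mult_closed[OF one x] x])
      (simp only: TM_mult_site TM_one_site ext_simps site_label TM_site[OF x])
  show "x \<otimes>\<^bsub>TM\<^esub> \<one>\<^bsub>TM\<^esub> = x"
    by (rule TM_eqI[OF TM_mult_closed[OF x one] x])
      (simp only: TM_mult_site TM_one_site ext_simps site_label TM_site[OF x])
qed (rule TM_mult_closed)

lemma tensor_relations_closed: "tensor_relations I A \<subseteq> carrier (monoid_algebra TM)"
proof -
  have single: "Poly_Mapping.keys (Poly_Mapping.single x c) \<subseteq> carrier TM"
    if "x \<in> carrier TM" for x and c :: complex
    using that by simp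
  have add: "u \<oplus>\<^bsub>Ext l\<^esub> v \<in> carrier (Ext l)"
    if "l \<in> I" "u \<in> carrier (Ext l)" "v \<in> carrier (Ext l)" for l u v
  proof -
    interpret X: complex_algebra "Ext l" by (rule ext_algebra_I[OF that(1)])
    show ?thesis using that by simp
  qed
  have smult: "c \<odot>\<^bsub>Ext l\<^esub> u \<in> carrier (Ext l)"
    if "l \<in> I" "u \<in> carrier (Ext l)" for l u c
  proof -
    interpret X: complex_algebra "Ext l" by (rule ext_algebra_I[OF that(1)])
    show ?thesis using that by simp
  qed
  show ?thesis
    unfolding tensor_relations_def monoid_algebra_simps
    by (intro Un_least subsetI; elim CollectE exE conjE; hypsubst; unfold mem_Collect_eq;
        intro keys_diff_closed single TM_upd_closed add smult site_label)
qed

sublocale T: monoid_quotient TM "tensor_relations I A"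
  by (intro monoid_quotient.intro monoid_quotient_axioms.intro monoid_TM tensor_relations_closed)

lemma T_Q: "T.Q = tensor_algebra I A"
  by (simp add: tensor_algebra_def)

lemma T_cls: "T.cls x = simple_tensor I A x"
  by (simp add: T.cls_def simple_tensor_def)

section \<open>The product functional on simple tensors\<close>

definition site_val :: "('i \<times> nat \<Rightarrow> 'a ext_elt) \<Rightarrow> 'i \<times> nat \<Rightarrow> complex" where
  "site_val x s = ext_fun (fst s) (x s)"

definition tensor_val :: "('i \<times> nat \<Rightarrow> 'a ext_elt) \<Rightarrow> complex" where
  "tensor_val x = (\<Prod>s\<in>tensor_support I A x. site_val x s)"

lemma tensor_val_superset:
  assumes "finite F" "tensor_support I A x \<subseteq> F" "F \<subseteq> sites I"
  shows "tensor_val x = (\<Prod>s\<in>F. site_val x s)"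
  unfolding tensor_val_def
proof (rule prod.mono_neutral_left)
  show "\<forall>s\<in>F - tensor_support I A x. site_val x s = 1"
  proof
    fix s assume "s \<in> F - tensor_support I A x"
    with assms(3) have "s \<in> sites I" "x s = \<one>\<^bsub>Ext (fst s)\<^esub> \<or> x s = ext_idem (A (fst s))"
      by (auto simp: tensor_support_def)
    then show "site_val x s = 1"
      using site_label[of s] by (auto simp: site_val_def)
  qed
qed (use assms in auto)

lemma tensor_support_sites: "tensor_support I A x \<subseteq> sites I"
  unfolding tensor_support_def by blast

lemma tensor_val_cong:
  assumes x: "x \<in> carrier TM" and y: "y \<in> carrier TM"
    and eq: "\<And>s. s \<in> sites I \<Longrightarrow> site_val x s = site_val y s"
  shows "tensor_val x = tensor_val y"
proof -
  let ?F = "tensor_support I A x \<union> tensor_support I A y"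
  have F: "finite ?F" "?F \<subseteq> sites I"
    using TM_finite[OF x] TM_finite[OF y] tensor_support_sites by blast+
  then have "tensor_val x = (\<Prod>s\<in>?F. site_val x s)"
    by (intro tensor_val_superset) auto
  also have "\<dots> = (\<Prod>s\<in>?F. site_val y s)"
    using F by (intro prod.cong refl eq) blast
  also have "\<dots> = tensor_val y"
    using F by (intro tensor_val_superset[symmetric]) auto
  finally show ?thesis .
qed

text \<open>The second factor is independent of \<open>u\<close>, so the value is linear in the
  entry at \<open>s\<close>, even if the update moves \<open>s\<close> into or out of the
  support.\<close>

lemma tensor_val_upd:
  assumes x: "x \<in> carrier TM" and s: "s \<in> sites I"
  shows "tensor_val (x(s := u)) =
    ext_fun (fst s) u * (\<Prod>t\<in>tensor_support I A x - {s}. site_val x t)"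
proof -
  let ?F = "insert s (tensor_support I A x)"
  have F: "finite ?F" "?F \<subseteq> sites I" "tensor_support I A (x(s := u)) \<subseteq> ?F"
    using TM_finite[OF x] tensor_support_sites s by (auto simp: tensor_support_def)
  have "tensor_val (x(s := u)) = (\<Prod>t\<in>?F. site_val (x(s := u)) t)"
    by (intro tensor_val_superset F)
  also have "\<dots> = site_val (x(s := u)) s * (\<Prod>t\<in>?F - {s}. site_val (x(s := u)) t)"
    using F by (intro prod.remove) auto
  also have "?F - {s} = tensor_support I A x - {s}"
    by blast
  also have "(\<Prod>t\<in>tensor_support I A x - {s}. site_val (x(s := u)) t) =
      (\<Prod>t\<in>tensor_support I A x - {s}. site_val x t)"
    by (intro prod.cong) (auto simp: site_val_def)
  also have "site_val (x(s := u)) s = ext_fun (fst s) u"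
    by (simp add: site_val_def)
  finally show ?thesis .
qed

lemma tensor_val_zero:
  assumes "x \<in> carrier TM" "s \<in> sites I" "site_val x s = 0"
  shows "tensor_val x = 0"
  using tensor_val_upd[OF assms(1,2), of "x s"] assms(3) by (simp add: site_val_def)

text \<open>A context changes an updated entry only at its own site, so multilinearity in context
  reduces to bilinearity of the product in a single extended algebra.\<close>

lemma TM_mult_upd:
  assumes "u \<in> carrier TM" "x \<in> carrier TM" "v \<in> carrier TM" "s \<in> sites I" "a \<in> carrier (Ext (fst s))"
  shows "u \<otimes>\<^bsub>TM\<^esub> x(s := a) \<otimes>\<^bsub>TM\<^esub> v =
    (u \<otimes>\<^bsub>TM\<^esub> x \<otimes>\<^bsub>TM\<^esub> v)(s := u s \<otimes>\<^bsub>Ext (fst s)\<^esub> a \<otimes>\<^bsub>Ext (fst s)\<^esub> v s)"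
proof (rule TM_eqI)
  show "u \<otimes>\<^bsub>TM\<^esub> x(s := a) \<otimes>\<^bsub>TM\<^esub> v \<in> carrier TM"
    by (intro TM_mult_closed TM_upd_closed assms)
  show "(u \<otimes>\<^bsub>TM\<^esub> x \<otimes>\<^bsub>TM\<^esub> v)(s := u s \<otimes>\<^bsub>Ext (fst s)\<^esub> a \<otimes>\<^bsub>Ext (fst s)\<^esub> v s) \<in> carrier TM"
    by (intro TM_mult_closed TM_upd_closed TM_site ext_simps site_label assms)
  show "(u \<otimes>\<^bsub>TM\<^esub> x(s := a) \<otimes>\<^bsub>TM\<^esub> v) t =
    ((u \<otimes>\<^bsub>TM\<^esub> x \<otimes>\<^bsub>TM\<^esub> v)(s := u s \<otimes>\<^bsub>Ext (fst s)\<^esub> a \<otimes>\<^bsub>Ext (fst s)\<^esub> v s)) t" if "t \<in> sites I" for t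
    using that by (simp add: TM_mult_site)
qed

lemma compatible_tensor_val: "T.compatible tensor_val"
  unfolding T.compatible_def
proof (intro ballI)
  fix r u v assume r: "r \<in> tensor_relations I A" and u: "u \<in> carrier TM" and v: "v \<in> carrier TM"
  have add: "tensor_val (u \<otimes>\<^bsub>TM\<^esub> x(s := a \<oplus>\<^bsub>Ext (fst s)\<^esub> b) \<otimes>\<^bsub>TM\<^esub> v) =
      tensor_val (u \<otimes>\<^bsub>TM\<^esub> x(s := a) \<otimes>\<^bsub>TM\<^esub> v) + tensor_val (u \<otimes>\<^bsub>TM\<^esub> x(s := b) \<otimes>\<^bsub>TM\<^esub> v)"
    and smult: "tensor_val (u \<otimes>\<^bsub>TM\<^esub> x(s := c \<odot>\<^bsub>Ext (fst s)\<^esub> a) \<otimes>\<^bsub>TM\<^esub> v) =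
      c * tensor_val (u \<otimes>\<^bsub>TM\<^esub> x(s := a) \<otimes>\<^bsub>TM\<^esub> v)"
    if x: "x \<in> carrier TM" and s: "s \<in> sites I"
      and a: "a \<in> carrier (Ext (fst s))" and b: "b \<in> carrier (Ext (fst s))" for x s a b c
  proof -
    interpret X: complex_algebra "Ext (fst s)" by (rule ext_algebra_I[OF site_label[OF s]])
    note lin = linear_functional_simps[OF
        nc_probability_space.linear_ext_functional[OF nc[OF site_label[OF s]]]]
    note upd = tensor_val_upd[OF TM_mult_closed[OF TM_mult_closed[OF u x] v] s]
    note us = TM_site[OF u s] and vs = TM_site[OF v s]
    show "tensor_val (u \<otimes>\<^bsub>TM\<^esub> x(s := a \<oplus>\<^bsub>Ext (fst s)\<^esub> b) \<otimes>\<^bsub>TM\<^esub> v) =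
      tensor_val (u \<otimes>\<^bsub>TM\<^esub> x(s := a) \<otimes>\<^bsub>TM\<^esub> v) + tensor_val (u \<otimes>\<^bsub>TM\<^esub> x(s := b) \<otimes>\<^bsub>TM\<^esub> v)"
      using TM_mult_upd[OF u x v s] a b us vs
      by (simp add: upd X.l_distr X.r_distr lin distrib_right)
    show "tensor_val (u \<otimes>\<^bsub>TM\<^esub> x(s := c \<odot>\<^bsub>Ext (fst s)\<^esub> a) \<otimes>\<^bsub>TM\<^esub> v) =
      c * tensor_val (u \<otimes>\<^bsub>TM\<^esub> x(s := a) \<otimes>\<^bsub>TM\<^esub> v)"
      using TM_mult_upd[OF u x v s] a us vs
      by (simp add: upd X.smult_assoc_left X.smult_assoc_right lin)
  qed
  show "lin_ext (\<lambda>x. tensor_val (u \<otimes>\<^bsub>TM\<^esub> x \<otimes>\<^bsub>TM\<^esub> v)) r = 0"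
    using r unfolding tensor_relations_def
    by (elim UnE CollectE exE conjE; hypsubst; unfold lin_ext_diff lin_ext_single)
      (simp_all add: add smult del: fun_upd_apply)
qed

lemma tensor_functional_eq: "tensor_functional I A \<phi> = T.induced tensor_val"
  unfolding tensor_functional_def
proof (rule the_equality, goal_cases)
  case 1
  show ?case
    using T.induced_extensional[of tensor_val] T.linear_induced[OF compatible_tensor_val]
      T.induced_cls[OF compatible_tensor_val]
    unfolding T_Q T_cls tensor_val_def site_val_def by blast
next
  case (2 \<Psi>)
  then have ext: "\<Psi> \<in> extensional (carrier T.Q)" and lin: "linear_functional T.Q \<Psi>"
    and val: "\<And>x. x \<in> carrier TM \<Longrightarrow> \<Psi> (T.cls x) = tensor_val x"
    unfolding T_Q T_cls tensor_val_def site_val_def by blast+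
  have "\<Psi> x = T.induced tensor_val x" if "x \<in> carrier T.Q" for x
    by (rule T.linear_functional_eqI[OF lin T.linear_induced[OF compatible_tensor_val] _ that])
      (simp only: val T.induced_cls[OF compatible_tensor_val])
  then show ?case
    by (rule extensionalityI[OF ext T.induced_extensional])
qed

abbreviation "\<Phi> \<equiv> tensor_functional I A \<phi>"

lemma linear_tensor_functional: "linear_functional T.Q \<Phi>"
  unfolding tensor_functional_eq by (rule T.linear_induced[OF compatible_tensor_val])

lemma tensor_functional_cls: "x \<in> carrier TM \<Longrightarrow> \<Phi> (T.cls x) = tensor_val x"
  unfolding tensor_functional_eq by (rule T.induced_cls[OF compatible_tensor_val])

end

section \<open>Reduced words\<close>

context nc_probability_space
begin

lemma center_add: "x \<in> carrier A \<Longrightarrow> y \<in> carrier A \<Longrightarrow> center (x \<oplus> y) = center x \<oplus> center y"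
  using smult_l_distr[of "- \<phi> x" "- \<phi> y" \<one>] by (simp add: center_def a_ac)

lemma center_smult: "x \<in> carrier A \<Longrightarrow> center (c \<odot> x) = c \<odot> center x"
  by (simp add: center_def smult_r_distr)

text \<open>Zero is written as a multiple of the unit so that homogeneity with scalar 0 applies to
  it later.\<close>

lemma center_one: "center \<one> = 0 \<odot> \<one>"
  using center_decomp[OF one_closed] smult_l_distr[of "1" "-1" \<one>] by (simp add: center_def)

end

context nc_family
begin

abbreviation "letters \<equiv> (SIGMA l:I. carrier (A l))"

abbreviation "ctr l \<equiv> nc_probability_space.center (A l) (\<phi> l)"

lemma complex_algebra_I: "l \<in> I \<Longrightarrow> complex_algebra (A l)"
  using nc nc_probability_space.complex_algebra_A by blast

fun reduced :: "('i \<times> 'a) list \<Rightarrow> bool" where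
  "reduced [] \<longleftrightarrow> True"
| "reduced ((l, x) # \<xi>) \<longleftrightarrow> l \<in> I \<and> x \<in> carrier (A l) \<and> \<phi> l x = 0 \<and>
     (\<xi> = [] \<or> fst (hd \<xi>) \<noteq> l) \<and> reduced \<xi>"

lemma reduced_letters: "reduced \<xi> \<Longrightarrow> \<xi> \<in> lists letters"
  by (induction \<xi> rule: reduced.induct) auto

text \<open>Multiplying the word \<open>\<xi>\<close> by \<open>a \<in> A l\<close> from the left gives \<open>a \<otimes> head_factor l \<xi>\<close>
  followed by \<open>rest l \<xi>\<close>.\<close>

fun head_factor :: "'i \<Rightarrow> ('i \<times> 'a) list \<Rightarrow> 'a" where
  "head_factor l [] = \<one>\<^bsub>A l\<^esub>"
| "head_factor l ((k, x) # \<xi>) = (if k = l then x else \<one>\<^bsub>A l\<^esub>)"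

fun rest :: "'i \<Rightarrow> ('i \<times> 'a) list \<Rightarrow> ('i \<times> 'a) list" where
  "rest l [] = []"
| "rest l ((k, x) # \<xi>) = (if k = l then \<xi> else (k, x) # \<xi>)"

lemma head_factor_closed: "l \<in> I \<Longrightarrow> \<xi> \<in> lists letters \<Longrightarrow> head_factor l \<xi> \<in> carrier (A l)"
proof -
  assume l: "l \<in> I" and \<xi>: "\<xi> \<in> lists letters"
  interpret X: nc_probability_space "A l" "\<phi> l" by (rule nc[OF l])
  show ?thesis using \<xi> by (cases \<xi>) auto
qed

lemma rest_letters: "\<xi> \<in> lists letters \<Longrightarrow> rest l \<xi> \<in> lists letters"
  by (cases "(l, \<xi>)" rule: rest.cases) auto

lemma reduced_rest: "reduced \<xi> \<Longrightarrow> reduced (rest l \<xi>)"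
  by (cases "(l, \<xi>)" rule: rest.cases) auto

lemma hd_rest: "reduced \<xi> \<Longrightarrow> rest l \<xi> = [] \<or> fst (hd (rest l \<xi>)) \<noteq> l"
  by (cases "(l, \<xi>)" rule: rest.cases) auto

lemma head_factor_rest: "reduced \<xi> \<Longrightarrow> head_factor l (rest l \<xi>) = \<one>\<^bsub>A l\<^esub>"
  using hd_rest[of \<xi> l] by (cases "rest l \<xi>") auto

lemma rest_rest: "reduced \<xi> \<Longrightarrow> rest l (rest l \<xi>) = rest l \<xi>"
  using hd_rest[of \<xi> l] by (cases "rest l \<xi>") auto

lemma absorb_closed:
  assumes "l \<in> I" "a \<in> carrier (A l)" "\<xi> \<in> lists letters"
  shows "a \<otimes>\<^bsub>A l\<^esub> head_factor l \<xi> \<in> carrier (A l)"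
proof -
  interpret X: nc_probability_space "A l" "\<phi> l" by (rule nc[OF assms(1)])
  show ?thesis using assms head_factor_closed by simp
qed

lemma ctr_closed: "l \<in> I \<Longrightarrow> y \<in> carrier (A l) \<Longrightarrow> ctr l y \<in> carrier (A l)"
  by (rule nc_probability_space.center_closed[OF nc])

lemma reduced_Cons_ctr:
  assumes "l \<in> I" "y \<in> carrier (A l)" "reduced \<xi>"
  shows "reduced ((l, ctr l y) # rest l \<xi>)"
proof -
  interpret X: nc_probability_space "A l" "\<phi> l" by (rule nc[OF assms(1)])
  show ?thesis using assms reduced_rest hd_rest by simp
qed

section \<open>Simple tensors attached to reduced words\<close>

abbreviation "emb l \<equiv> ext_emb (A l)"

lemma emb_closed: "l \<in> I \<Longrightarrow> a \<in> carrier (A l) \<Longrightarrow> emb l a \<in> carrier (Ext l)"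
  by (rule nc_probability_space.ext_emb_closed[OF nc])

text \<open>The letter with \<open>m - 1\<close> letters to its right is put at color \<open>m\<close>. This embeds the free
  product of the vector spaces into the tensor product.\<close>

fun place :: "('i \<times> 'a) list \<Rightarrow> 'i \<times> nat \<Rightarrow> 'a ext_elt" where
  "place [] = \<one>\<^bsub>TM\<^esub>"
| "place ((l, x) # \<xi>) = (place \<xi>)((l, Suc (length \<xi>)) := emb l x)"

lemma place_closed: "\<xi> \<in> lists letters \<Longrightarrow> place \<xi> \<in> carrier TM"
proof (induction \<xi>)
  case Nil
  then show ?case
    by (simp add: T.one_closed)
next
  case (Cons p \<xi>)
  then show ?case
    by (cases p) (auto simp del: fun_upd_apply intro!: TM_upd_closed emb_closed)
qed

lemma place_vacuum: "(l, m) \<in> sites I \<Longrightarrow> length \<xi> < m \<Longrightarrow> place \<xi> (l, m) = \<one>\<^bsub>Ext l\<^esub>"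
  by (induction \<xi> rule: place.induct) (auto simp: TM_one_site)

lemma place_upd_one:
  assumes "\<xi> \<in> lists letters" "l \<in> I"
  shows "(place \<xi>)((l, Suc (length \<xi>)) := \<one>\<^bsub>Ext l\<^esub>) = place \<xi>"
  using place_vacuum[of l "Suc (length \<xi>)" \<xi>] assms by (intro fun_upd_idem) auto

text \<open>Replacing \<open>x\<close> by a multiple of \<open>x'\<close> is justified only under
  the functional and behind a left factor. By linearity in \<open>Y\<close> the test can be made on
  simple tensors, where it becomes a question about single sites.\<close>

lemma tensor_functional_multI:
  assumes "x \<in> carrier TM" "x' \<in> carrier TM"
    and "\<And>y. y \<in> carrier TM \<Longrightarrow> tensor_val (y \<otimes>\<^bsub>TM\<^esub> x) = c * tensor_val (y \<otimes>\<^bsub>TM\<^esub> x')"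
    and "Y \<in> carrier T.Q"
  shows "\<Phi> (Y \<otimes>\<^bsub>T.Q\<^esub> T.cls x) = c * \<Phi> (Y \<otimes>\<^bsub>T.Q\<^esub> T.cls x')"
  using assms(4)
proof (induction Y rule: T.quot_induct)
  note lin = linear_functional_simps[OF linear_tensor_functional]
  note closed = T.cls_closed[OF assms(1)] T.cls_closed[OF assms(2)]
  {
    case (smult_cls y d)
    have "\<Phi> (T.cls y \<otimes>\<^bsub>T.Q\<^esub> T.cls x) = c * \<Phi> (T.cls y \<otimes>\<^bsub>T.Q\<^esub> T.cls x')"
      using assms(1,2) smult_cls
      by (simp only: T.cls_mult tensor_functional_cls TM_mult_closed assms(3))
    then show ?case
      using smult_cls closed
      by (simp only: T.Q.smult_assoc_left T.cls_closed lin T.Q.m_closed mult.left_commute)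
  next
    case (add Y Y')
    then show ?case
      using closed by (simp only: T.Q.l_distr lin T.Q.m_closed distrib_left)
  }
qed

text \<open>The entries of P_i(j) for positive \<open>j\<close>. Sites start at 1, so the family for
  \<open>j = 0\<close> would equal that for \<open>j = 1\<close>; this is why P_i(0) = 0 is split
  off in \<open>replica_cumul_eq\<close>.\<close>

definition proj :: "'i \<Rightarrow> nat \<Rightarrow> 'i \<times> nat \<Rightarrow> 'a ext_elt" where
  "proj i j = (\<lambda>(k, m)\<in>sites I. if k \<noteq> i \<and> j \<le> m then ext_idem (A k) else \<one>\<^bsub>Ext k\<^esub>)"

lemma proj_closed: "proj i j \<in> carrier TM"
  unfolding proj_def by (rule TM_config_closed) (simp add: case_prod_beta)

lemma proj_site:
  "s \<in> sites I \<Longrightarrow> proj i j s = (if fst s \<noteq> i \<and> j \<le> snd s then ext_idem (A (fst s)) else \<one>\<^bsub>Ext (fst s)\<^esub>)"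
  unfolding proj_def by (cases s) (simp only: restrict_apply' case_prod_conv fst_conv snd_conv)

lemma site_val_proj:
  assumes y: "y \<in> carrier TM" and x: "x \<in> carrier TM" and s: "s \<in> sites I"
  shows "site_val (y \<otimes>\<^bsub>TM\<^esub> (proj i j \<otimes>\<^bsub>TM\<^esub> x)) s =
    (if fst s \<noteq> i \<and> j \<le> snd s
     then ext_fun (fst s) (y s \<otimes>\<^bsub>Ext (fst s)\<^esub> (ext_idem (A (fst s)) \<otimes>\<^bsub>Ext (fst s)\<^esub> x s))
     else site_val (y \<otimes>\<^bsub>TM\<^esub> x) s)"
  unfolding site_val_def TM_mult_site[OF s] proj_site[OF s]
  by (simp only: ext_simps(7)[OF site_label[OF s] TM_site[OF x s]] split: if_split) simp

text \<open>Wherever the projection puts an idempotent, \<open>x\<close> has a unit, so the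
  idempotent stands at the right end of its site and is invisible there.\<close>

lemma proj_vacuum:
  assumes Y: "Y \<in> carrier T.Q" and x: "x \<in> carrier TM"
    and vac: "\<And>k m. (k, m) \<in> sites I \<Longrightarrow> k \<noteq> i \<Longrightarrow> j \<le> m \<Longrightarrow> x (k, m) = \<one>\<^bsub>Ext k\<^esub>"
  shows "\<Phi> (Y \<otimes>\<^bsub>T.Q\<^esub> T.cls (proj i j \<otimes>\<^bsub>TM\<^esub> x)) = \<Phi> (Y \<otimes>\<^bsub>T.Q\<^esub> T.cls x)"
proof -
  have "tensor_val (y \<otimes>\<^bsub>TM\<^esub> (proj i j \<otimes>\<^bsub>TM\<^esub> x)) = tensor_val (y \<otimes>\<^bsub>TM\<^esub> x)"
    if y: "y \<in> carrier TM" for y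
  proof (rule tensor_val_cong)
    fix s assume s: "s \<in> sites I"
    have l: "fst s \<in> I" by (rule site_label[OF s])
    have ys: "y s \<in> carrier (Ext (fst s))" by (rule TM_site[OF y s])
    show "site_val (y \<otimes>\<^bsub>TM\<^esub> (proj i j \<otimes>\<^bsub>TM\<^esub> x)) s = site_val (y \<otimes>\<^bsub>TM\<^esub> x) s"
    proof (cases "fst s \<noteq> i \<and> j \<le> snd s")
      case True
      then have "x s = \<one>\<^bsub>Ext (fst s)\<^esub>"
        using vac[of "fst s" "snd s"] s by simp
      then show ?thesis
        using True ys l nc_probability_space.ext_functional_mult_idem[OF nc[OF l] ys]
        unfolding site_val_proj[OF y x s] unfolding site_val_def TM_mult_site[OF s] by simp
    next
      case False
      then show ?thesis
        unfolding site_val_proj[OF y x s] by (rule if_not_P)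
    qed
  qed (intro TM_mult_closed y x proj_closed)+
  then show ?thesis
    using tensor_functional_multI[OF TM_mult_closed[OF proj_closed x] x _ Y, of i j 1] by simp
qed

text \<open>One site suffices: there the projection puts \<open>p\<close> in front of a centered
  letter, and the product over the sites acquires a factor zero.\<close>

lemma proj_kill:
  assumes Y: "Y \<in> carrier T.Q" and x: "x \<in> carrier TM"
    and s: "(k, m) \<in> sites I" "k \<noteq> i" "j \<le> m"
    and a: "a \<in> carrier (A k)" "\<phi> k a = 0" "x (k, m) = emb k a"
  shows "\<Phi> (Y \<otimes>\<^bsub>T.Q\<^esub> T.cls (proj i j \<otimes>\<^bsub>TM\<^esub> x)) = 0"
proof -
  have k: "k \<in> I" using site_label[OF s(1)] by simp
  have "tensor_val (y \<otimes>\<^bsub>TM\<^esub> (proj i j \<otimes>\<^bsub>TM\<^esub> x)) = 0" if y: "y \<in> carrier TM" for y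
  proof (rule tensor_val_zero[OF _ s(1)])
    show "site_val (y \<otimes>\<^bsub>TM\<^esub> (proj i j \<otimes>\<^bsub>TM\<^esub> x)) (k, m) = 0"
      unfolding site_val_proj[OF y x s(1)]
      using s a nc_probability_space.ext_functional_idem_emb[OF nc[OF k] _ a(1), of "y (k, m)"]
        TM_site[OF y s(1)] by simp
  qed (intro TM_mult_closed y x proj_closed)
  then show ?thesis
    using tensor_functional_multI[OF TM_mult_closed[OF proj_closed x] x _ Y, of i j 0] by simp
qed

lemma replica_cumul_eq:
  "replica_cumul I A i j = (if j = 0 then \<zero>\<^bsub>T.Q\<^esub> else T.cls (proj i j))"
  by (simp add: replica_cumul_def T_Q T_cls proj_def)

lemma replica_cumul_closed: "replica_cumul I A i j \<in> carrier T.Q"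
  unfolding replica_cumul_eq using T.cls_closed[OF proj_closed] T.Q.zero_closed by simp

text \<open>The only color at which a replica of label \<open>i\<close> acts nontrivially on the tensor of \<open>\<xi>\<close>.\<close>

definition color :: "'i \<Rightarrow> ('i \<times> 'a) list \<Rightarrow> nat" where
  "color i \<xi> = Suc (length (rest i \<xi>))"

text \<open>If \<open>rest i \<xi>\<close> is nonempty, its head has a label other than
  \<open>i\<close> and sits at color \<open>color i \<xi> - 1\<close>; above it there is at most a
  letter of label \<open>i\<close>, which P_i(j) leaves alone. So P_i(j) meets a foreign letter
  exactly for positive \<open>j\<close> below \<open>color i \<xi>\<close>. The value 0 at
  \<open>j = 0\<close> fits too, as active colors are positive: as a function of \<open>j\<close>
  this is a step with a single jump.\<close>

lemma tensor_functional_cumul: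
  assumes Y: "Y \<in> carrier T.Q" and \<xi>: "reduced \<xi>"
  shows "\<Phi> (Y \<otimes>\<^bsub>T.Q\<^esub> (replica_cumul I A i j \<otimes>\<^bsub>T.Q\<^esub> T.cls (place \<xi>))) =
    (if color i \<xi> \<le> j then \<Phi> (Y \<otimes>\<^bsub>T.Q\<^esub> T.cls (place \<xi>)) else 0)"
proof -
  have x: "place \<xi> \<in> carrier TM"
    by (rule place_closed[OF reduced_letters[OF \<xi>]])
  consider "j = 0" | "j \<noteq> 0" "color i \<xi> \<le> j" | "j \<noteq> 0" "j < color i \<xi>"
    by linarith
  then show ?thesis
  proof cases
    case 1
    have "replica_cumul I A i j = \<zero>\<^bsub>T.Q\<^esub>"
      unfolding replica_cumul_eq using 1 by simp
    then show ?thesis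
      using 1 T.cls_closed[OF x] Y linear_functional_zero[OF _ linear_tensor_functional]
        T.Q.complex_algebra_axioms
      by (simp add: color_def T.MA.complex_algebra_quot)
  next
    case 2
    have "place \<xi> (k, m) = \<one>\<^bsub>Ext k\<^esub>" if "(k, m) \<in> sites I" "k \<noteq> i" "j \<le> m" for k m
    proof (cases \<xi>)
      case Nil
      then show ?thesis
        using that 2 place_vacuum[OF that(1), of \<xi>] by (auto simp: color_def)
    next
      case (Cons p \<xi>')
      then show ?thesis
        using that 2 place_vacuum[OF that(1), of \<xi>'] by (cases p) (auto simp: color_def split: if_splits)
    qed
    then have "\<Phi> (Y \<otimes>\<^bsub>T.Q\<^esub> T.cls (proj i j \<otimes>\<^bsub>TM\<^esub> place \<xi>)) = \<Phi> (Y \<otimes>\<^bsub>T.Q\<^esub> T.cls (place \<xi>))"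
      by (intro proj_vacuum Y x)
    then show ?thesis
      unfolding replica_cumul_eq using 2 T.cls_mult[OF proj_closed x] by simp
  next
    case 3
    have "rest i \<xi> \<noteq> []" and j: "j \<le> length (rest i \<xi>)"
      using 3 by (auto simp: color_def)
    then obtain k a \<xi>' where r: "rest i \<xi> = (k, a) # \<xi>'"
      by (metis list.exhaust surj_pair)
    have red: "reduced ((k, a) # \<xi>')"
      using reduced_rest[OF \<xi>, of i] r by simp
    have ki: "k \<noteq> i"
      using hd_rest[OF \<xi>, of i] r by simp
    \<comment> \<open>Colors are counted from the right end, so dropping a head of label
      \<open>i\<close> does not move the remaining letters, and that head occupies a site of another
      label.\<close>
    have "place \<xi> (k, Suc (length \<xi>')) = emb k a"
    proof (cases \<xi>)
      case (Cons p \<xi>'')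
      then show ?thesis
        using r ki by (cases p) (auto split: if_splits)
    qed (use r in simp)
    then have "\<Phi> (Y \<otimes>\<^bsub>T.Q\<^esub> T.cls (proj i j \<otimes>\<^bsub>TM\<^esub> place \<xi>)) = 0"
      using red j r ki by (intro proj_kill[OF Y x, of k "Suc (length \<xi>')"]) auto
    then show ?thesis
      unfolding replica_cumul_eq using 3 T.cls_mult[OF proj_closed x] by simp
  qed
qed

section \<open>Action of a letter embedded at one site\<close>

abbreviation "site_config i j a \<equiv>
  (\<lambda>s\<in>sites I. if s = (i, j) then emb i a else \<one>\<^bsub>Ext (fst s)\<^esub>)"

lemma site_config_eq: "i \<in> I \<Longrightarrow> 1 \<le> j \<Longrightarrow> site_config i j a = \<one>\<^bsub>TM\<^esub>((i, j) := emb i a)"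
  by (rule ext) (auto simp: tensor_monoid_simps)

lemma site_config_closed: "i \<in> I \<Longrightarrow> 1 \<le> j \<Longrightarrow> a \<in> carrier (A i) \<Longrightarrow> site_config i j a \<in> carrier TM"
  unfolding site_config_eq by (intro TM_upd_closed T.one_closed) (auto intro: emb_closed)

text \<open>The active color is that of the head if its label is \<open>i\<close>, and the first
  color above the whole word otherwise. In the first case \<open>a\<close> is multiplied onto the
  head, in the second it becomes a new head at its proper place.\<close>

lemma site_config_place:
  assumes i: "i \<in> I" and a: "a \<in> carrier (A i)" and \<xi>: "\<xi> \<in> lists letters"
  shows "site_config i (color i \<xi>) a \<otimes>\<^bsub>TM\<^esub> place \<xi> =
    place ((i, a \<otimes>\<^bsub>A i\<^esub> head_factor i \<xi>) # rest i \<xi>)"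
proof (rule TM_eqI)
  have r: "rest i \<xi> \<in> lists letters"
    by (rule rest_letters[OF \<xi>])
  show "site_config i (color i \<xi>) a \<otimes>\<^bsub>TM\<^esub> place \<xi> \<in> carrier TM"
    by (intro TM_mult_closed site_config_closed i a place_closed \<xi>) (simp add: color_def)
  show "place ((i, a \<otimes>\<^bsub>A i\<^esub> head_factor i \<xi>) # rest i \<xi>) \<in> carrier TM"
    using r i absorb_closed[OF i a \<xi>] by (intro place_closed) simp
  fix s assume s: "s \<in> sites I"
  have c: "color i \<xi> = Suc (length (rest i \<xi>))" by (simp add: color_def)
  interpret X: nc_probability_space "A i" "\<phi> i" by (rule nc[OF i])
  have ps: "place \<xi> s \<in> carrier (Ext (fst s))"
    by (rule TM_site[OF place_closed[OF \<xi>] s])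
  have ea: "emb i a \<in> carrier (Ext i)"
    by (rule emb_closed[OF i a])
  consider "rest i \<xi> = \<xi>" "head_factor i \<xi> = \<one>\<^bsub>A i\<^esub>" | x where "\<xi> = (i, x) # rest i \<xi>" "head_factor i \<xi> = x"
  proof (cases \<xi>)
    case (Cons p \<xi>')
    then show ?thesis
      using that by (cases p; cases "fst p = i") auto
  qed (use that in auto)
  then show "(site_config i (color i \<xi>) a \<otimes>\<^bsub>TM\<^esub> place \<xi>) s =
      place ((i, a \<otimes>\<^bsub>A i\<^esub> head_factor i \<xi>) # rest i \<xi>) s"
  proof cases
    case 1
    have "place \<xi> (i, Suc (length \<xi>)) = \<one>\<^bsub>Ext i\<^esub>"
      using i by (intro place_vacuum) auto
    then show ?thesis
      unfolding TM_mult_site[OF s] restrict_apply'[OF s] c 1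
      using i s a ps ea site_label[OF s] by auto
  next
    case 2
    have x: "x \<in> carrier (A i)"
      using head_factor_closed[OF i \<xi>] 2 by simp
    have "place \<xi> = (place (rest i \<xi>))((i, Suc (length (rest i \<xi>))) := emb i x)"
      by (subst 2(1)) (simp only: place.simps)
    then show ?thesis
      unfolding TM_mult_site[OF s] restrict_apply'[OF s] c 2(2)
      using i ps site_label[OF s] X.ext_emb_mult[OF a x]
      by (cases "s = (i, Suc (length (rest i \<xi>)))") simp_all
  qed
qed

text \<open>Multilinearity at the site of the head: the letter splits into its centered part and a
  multiple of the unit, and a unit at that site is the same as no letter.\<close>

lemma cls_place_center:
  assumes i: "i \<in> I" and y: "y \<in> carrier (A i)" and \<xi>: "\<xi> \<in> lists letters"
  shows "T.cls (place ((i, y) # \<xi>)) =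
    T.cls (place ((i, ctr i y) # \<xi>)) \<oplus>\<^bsub>T.Q\<^esub> \<phi> i y \<odot>\<^bsub>T.Q\<^esub> T.cls (place \<xi>)"
proof -
  interpret X: nc_probability_space "A i" "\<phi> i" by (rule nc[OF i])
  interpret XE: complex_algebra "Ext i" by (rule ext_algebra_I[OF i])
  let ?s = "(i, Suc (length \<xi>))"
  have s: "?s \<in> sites I" using i by simp
  let ?x = "place \<xi>"
  have x: "?x \<in> carrier TM" by (rule place_closed[OF \<xi>])
  have c: "emb i (ctr i y) \<in> carrier (Ext i)"
    by (intro emb_closed i ctr_closed y)
  have "emb i y = emb i (X.center y \<oplus>\<^bsub>A i\<^esub> \<phi> i y \<odot>\<^bsub>A i\<^esub> \<one>\<^bsub>A i\<^esub>)"
    using X.center_decomp[OF y] by simp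
  also have "\<dots> = emb i (X.center y) \<oplus>\<^bsub>Ext i\<^esub> \<phi> i y \<odot>\<^bsub>Ext i\<^esub> \<one>\<^bsub>Ext i\<^esub>"
    using y by (simp only: X.ext_emb_add X.ext_emb_smult X.ext_emb_one X.center_closed
        X.complex_smult_simps X.one_closed)
  finally have e: "emb i y = emb i (ctr i y) \<oplus>\<^bsub>Ext i\<^esub> \<phi> i y \<odot>\<^bsub>Ext i\<^esub> \<one>\<^bsub>Ext i\<^esub>" .
  have "T.cls (?x(?s := emb i (ctr i y) \<oplus>\<^bsub>Ext i\<^esub> \<phi> i y \<odot>\<^bsub>Ext i\<^esub> \<one>\<^bsub>Ext i\<^esub>)) =
      T.cls (?x(?s := emb i (ctr i y))) \<oplus>\<^bsub>T.Q\<^esub> T.cls (?x(?s := \<phi> i y \<odot>\<^bsub>Ext i\<^esub> \<one>\<^bsub>Ext i\<^esub>))"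
  proof (rule T.cls_add_rel)
    show "Poly_Mapping.single (?x(?s := emb i (ctr i y) \<oplus>\<^bsub>Ext i\<^esub> \<phi> i y \<odot>\<^bsub>Ext i\<^esub> \<one>\<^bsub>Ext i\<^esub>)) 1 -
        Poly_Mapping.single (?x(?s := emb i (ctr i y))) 1 -
        Poly_Mapping.single (?x(?s := \<phi> i y \<odot>\<^bsub>Ext i\<^esub> \<one>\<^bsub>Ext i\<^esub>)) 1 \<in> tensor_relations I A"
      unfolding tensor_relations_def
      by (rule UnI1, rule CollectI, intro exI[of _ ?x] exI[of _ ?s] exI[of _ "emb i (ctr i y)"]
          exI[of _ "\<phi> i y \<odot>\<^bsub>Ext i\<^esub> \<one>\<^bsub>Ext i\<^esub>"])
        (use x s c in simp)
  qed (intro TM_upd_closed x s; use c in simp)+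
  also have "T.cls (?x(?s := \<phi> i y \<odot>\<^bsub>Ext i\<^esub> \<one>\<^bsub>Ext i\<^esub>)) = \<phi> i y \<odot>\<^bsub>T.Q\<^esub> T.cls (?x(?s := \<one>\<^bsub>Ext i\<^esub>))"
  proof (rule T.cls_smult_rel)
    show "Poly_Mapping.single (?x(?s := \<phi> i y \<odot>\<^bsub>Ext i\<^esub> \<one>\<^bsub>Ext i\<^esub>)) 1 -
        Poly_Mapping.single (?x(?s := \<one>\<^bsub>Ext i\<^esub>)) (\<phi> i y) \<in> tensor_relations I A"
      unfolding tensor_relations_def
      by (rule UnI2, rule CollectI, intro exI[of _ ?x] exI[of _ ?s] exI[of _ "\<phi> i y"]
          exI[of _ "\<one>\<^bsub>Ext i\<^esub>"])
        (use x s in simp)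
  qed (intro TM_upd_closed x s; simp)+
  also have "?x(?s := \<one>\<^bsub>Ext i\<^esub>) = ?x"
    by (rule place_upd_one[OF \<xi> i])
  finally show ?thesis
    unfolding place.simps e .
qed

lemma site_emb_eq: "site_emb I A i j a = T.cls (site_config i j a)"
  by (simp add: site_emb_def T_cls)

lemma replica_closed:
  assumes "i \<in> I" "1 \<le> j" "a \<in> carrier (A i)"
  shows "replica I A i j a \<in> carrier T.Q"
  unfolding replica_def replica_proj_def site_emb_eq T_Q[symmetric]
  by (intro T.Q.m_closed T.cls_closed site_config_closed assms T.Q.minus_closed replica_cumul_closed)

lemma tensor_functional_replica:
  assumes Y: "Y \<in> carrier T.Q" and \<xi>: "reduced \<xi>" and i: "i \<in> I" and a: "a \<in> carrier (A i)"
    and j: "1 \<le> j"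
  defines "y \<equiv> a \<otimes>\<^bsub>A i\<^esub> head_factor i \<xi>"
  shows "\<Phi> (Y \<otimes>\<^bsub>T.Q\<^esub> (replica I A i j a \<otimes>\<^bsub>T.Q\<^esub> T.cls (place \<xi>))) =
    (if j = color i \<xi>
     then \<Phi> (Y \<otimes>\<^bsub>T.Q\<^esub> T.cls (place ((i, ctr i y) # rest i \<xi>))) +
       \<phi> i y * \<Phi> (Y \<otimes>\<^bsub>T.Q\<^esub> T.cls (place (rest i \<xi>)))
     else 0)"
proof -
  have \<xi>l: "\<xi> \<in> lists letters" by (rule reduced_letters[OF \<xi>])
  have rl: "rest i \<xi> \<in> lists letters" by (rule rest_letters[OF \<xi>l])
  have y: "y \<in> carrier (A i)" unfolding y_def by (rule absorb_closed[OF i a \<xi>l])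
  define E where "E = site_emb I A i j a"
  define V where "V = T.cls (place \<xi>)"
  define P where "P = replica_cumul I A i"
  have V: "V \<in> carrier T.Q" unfolding V_def by (intro T.cls_closed place_closed \<xi>l)
  have E: "E \<in> carrier T.Q"
    unfolding E_def site_emb_eq by (intro T.cls_closed site_config_closed i j a)
  have P: "P k \<in> carrier T.Q" for k unfolding P_def by (rule replica_cumul_closed)
  note YE = T.Q.m_closed[OF Y E]
  have "Y \<otimes>\<^bsub>T.Q\<^esub> (replica I A i j a \<otimes>\<^bsub>T.Q\<^esub> V) =
      Y \<otimes>\<^bsub>T.Q\<^esub> (E \<otimes>\<^bsub>T.Q\<^esub> (P j \<ominus>\<^bsub>T.Q\<^esub> P (j - 1)) \<otimes>\<^bsub>T.Q\<^esub> V)"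
    unfolding replica_def replica_proj_def E_def P_def T_Q[symmetric] ..
  also have "\<dots> = (Y \<otimes>\<^bsub>T.Q\<^esub> E) \<otimes>\<^bsub>T.Q\<^esub> (P j \<otimes>\<^bsub>T.Q\<^esub> V) \<ominus>\<^bsub>T.Q\<^esub> (Y \<otimes>\<^bsub>T.Q\<^esub> E) \<otimes>\<^bsub>T.Q\<^esub> (P (j - 1) \<otimes>\<^bsub>T.Q\<^esub> V)"
    using Y E V P[of j] P[of "j - 1"]
    by (simp add: T.Q.m_assoc a_minus_def T.Q.l_distr T.Q.r_distr T.Q.l_minus T.Q.r_minus)
  finally have "\<Phi> (Y \<otimes>\<^bsub>T.Q\<^esub> (replica I A i j a \<otimes>\<^bsub>T.Q\<^esub> V)) =
      \<Phi> ((Y \<otimes>\<^bsub>T.Q\<^esub> E) \<otimes>\<^bsub>T.Q\<^esub> (P j \<otimes>\<^bsub>T.Q\<^esub> V)) - \<Phi> ((Y \<otimes>\<^bsub>T.Q\<^esub> E) \<otimes>\<^bsub>T.Q\<^esub> (P (j - 1) \<otimes>\<^bsub>T.Q\<^esub> V))"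
    using linear_functional_minus[OF T.MA.complex_algebra_quot linear_tensor_functional]
      T.Q.m_closed[OF YE T.Q.m_closed[OF P V]] by simp
  \<comment> \<open>Both terms are step functions with the same jump, one shifted by 1, so they
    differ only at the jump; \<open>1 \<le> j\<close> makes \<open>j - 1\<close> a proper
    predecessor.\<close>
  also have "\<dots> = (if j = color i \<xi> then \<Phi> ((Y \<otimes>\<^bsub>T.Q\<^esub> E) \<otimes>\<^bsub>T.Q\<^esub> V) else 0)"
    unfolding P_def V_def tensor_functional_cumul[OF YE \<xi>] using j by auto
  also have "\<dots> = (if j = color i \<xi>
     then \<Phi> (Y \<otimes>\<^bsub>T.Q\<^esub> T.cls (place ((i, ctr i y) # rest i \<xi>))) +
       \<phi> i y * \<Phi> (Y \<otimes>\<^bsub>T.Q\<^esub> T.cls (place (rest i \<xi>)))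
     else 0)"
  proof (cases "j = color i \<xi>")
    case True
    have "(Y \<otimes>\<^bsub>T.Q\<^esub> E) \<otimes>\<^bsub>T.Q\<^esub> V = Y \<otimes>\<^bsub>T.Q\<^esub> (E \<otimes>\<^bsub>T.Q\<^esub> V)"
      by (rule T.Q.m_assoc[OF Y E V])
    also have "E \<otimes>\<^bsub>T.Q\<^esub> V = T.cls (site_config i j a \<otimes>\<^bsub>TM\<^esub> place \<xi>)"
      unfolding E_def V_def site_emb_eq
      by (intro T.cls_mult site_config_closed i j a place_closed \<xi>l)
    also have "\<dots> = T.cls (place ((i, y) # rest i \<xi>))"
      unfolding True site_config_place[OF i a \<xi>l] y_def ..
    also have "\<dots> = T.cls (place ((i, ctr i y) # rest i \<xi>)) \<oplus>\<^bsub>T.Q\<^esub> \<phi> i y \<odot>\<^bsub>T.Q\<^esub> T.cls (place (rest i \<xi>))"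
      by (rule cls_place_center[OF i y rl])
    finally have eq: "(Y \<otimes>\<^bsub>T.Q\<^esub> E) \<otimes>\<^bsub>T.Q\<^esub> V = Y \<otimes>\<^bsub>T.Q\<^esub>
      (T.cls (place ((i, ctr i y) # rest i \<xi>)) \<oplus>\<^bsub>T.Q\<^esub> \<phi> i y \<odot>\<^bsub>T.Q\<^esub> T.cls (place (rest i \<xi>)))" .
    have "place ((i, ctr i y) # rest i \<xi>) \<in> carrier TM"
      using rl i ctr_closed[OF i y] by (intro place_closed) simp
    note closed = T.cls_closed[OF this] T.cls_closed[OF place_closed[OF rl]]
    show ?thesis
      unfolding eq using True Y closed
      by (simp only: T.Q.r_distr T.Q.smult_assoc_right T.Q.m_closed T.Q.complex_smult_simps
          linear_functional_simps[OF linear_tensor_functional] if_True)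
  qed simp
  finally show ?thesis
    unfolding V_def .
qed

lemma tensor_val_place:
  assumes "reduced \<xi>"
  shows "tensor_val (place \<xi>) = (if \<xi> = [] then 1 else 0)"
proof (cases \<xi>)
  case Nil
  have "tensor_support I A \<one>\<^bsub>TM\<^esub> = {}"
    using TM_one_site by (auto simp: tensor_support_def)
  then show ?thesis
    by (simp add: Nil tensor_val_def)
next
  case (Cons p \<xi>')
  obtain l x where p: "p = (l, x)" by force
  have "tensor_val (place \<xi>) = 0"
    using assms nc_probability_space.ext_functional_emb[OF nc, of l x]
    by (intro tensor_val_zero[of _ "(l, Suc (length \<xi>'))"] place_closed[OF reduced_letters[OF assms]])
      (auto simp: Cons p site_val_def)
  then show ?thesis
    by (simp add: Cons)
qed

end

section \<open>The free product functional\<close>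

context nc_family
begin

lemma free_relations_closed:
  "(\<Union>l\<in>I. hom_relations (A l) (Pair l)) \<subseteq> carrier (free_algebra letters)"
  by (rule UN_least, rule hom_relations_closed[OF complex_algebra_I]) auto

sublocale F: word_quotient letters "\<Union>l\<in>I. hom_relations (A l) (Pair l)"
  by (unfold_locales, rule free_relations_closed)

lemma F_Q: "F.Q = free_product I A"
  by (simp add: free_product_def)

lemma F_cls: "F.cls [(l, a)] = free_emb I A l a"
  by (simp add: F.cls_def free_emb_def)

lemma free_rel:
  assumes l: "l \<in> I"
  shows free_cls_add: "a \<in> carrier (A l) \<Longrightarrow> b \<in> carrier (A l) \<Longrightarrow>
      F.cls [(l, a \<oplus>\<^bsub>A l\<^esub> b)] = F.cls [(l, a)] \<oplus>\<^bsub>F.Q\<^esub> F.cls [(l, b)]"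
    and free_cls_smult: "a \<in> carrier (A l) \<Longrightarrow>
      F.cls [(l, c \<odot>\<^bsub>A l\<^esub> a)] = c \<odot>\<^bsub>F.Q\<^esub> F.cls [(l, a)]"
    and free_cls_mult: "a \<in> carrier (A l) \<Longrightarrow> b \<in> carrier (A l) \<Longrightarrow>
      F.cls [(l, a \<otimes>\<^bsub>A l\<^esub> b)] = F.cls [(l, a), (l, b)]"
    and free_cls_one: "F.cls [(l, \<one>\<^bsub>A l\<^esub>)] = F.cls []"
proof -
  have rel: "hom_relations (A l) (Pair l) \<subseteq> (\<Union>l\<in>I. hom_relations (A l) (Pair l))"
    using l by blast
  have emb: "Pair l ` carrier (A l) \<subseteq> letters"
    using l by auto
  show "a \<in> carrier (A l) \<Longrightarrow> b \<in> carrier (A l) \<Longrightarrow>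
      F.cls [(l, a \<oplus>\<^bsub>A l\<^esub> b)] = F.cls [(l, a)] \<oplus>\<^bsub>F.Q\<^esub> F.cls [(l, b)]"
    by (rule F.cls_letter_add[OF complex_algebra_I[OF l] rel emb])
  show "a \<in> carrier (A l) \<Longrightarrow> F.cls [(l, c \<odot>\<^bsub>A l\<^esub> a)] = c \<odot>\<^bsub>F.Q\<^esub> F.cls [(l, a)]"
    by (rule F.cls_letter_smult[OF complex_algebra_I[OF l] rel emb])
  show "a \<in> carrier (A l) \<Longrightarrow> b \<in> carrier (A l) \<Longrightarrow>
      F.cls [(l, a \<otimes>\<^bsub>A l\<^esub> b)] = F.cls [(l, a), (l, b)]"
    by (rule F.cls_letter_mult[OF complex_algebra_I[OF l] rel emb])
  show "F.cls [(l, \<one>\<^bsub>A l\<^esub>)] = F.cls []"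
    by (rule F.cls_letter_one[OF complex_algebra_I[OF l] rel emb])
qed

text \<open>\<open>free_val u \<xi>\<close> is the value of the free product functional on the word \<open>rev u @ \<xi>\<close>, where
  \<open>\<xi>\<close> is reduced: the last letter of \<open>rev u\<close> is absorbed into \<open>\<xi>\<close> and then centered.\<close>

fun free_val :: "('i \<times> 'a) list \<Rightarrow> ('i \<times> 'a) list \<Rightarrow> complex" where
  "free_val [] \<xi> = (if \<xi> = [] then 1 else 0)"
| "free_val ((l, a) # u) \<xi> =
     free_val u ((l, ctr l (a \<otimes>\<^bsub>A l\<^esub> head_factor l \<xi>)) # rest l \<xi>) +
     \<phi> l (a \<otimes>\<^bsub>A l\<^esub> head_factor l \<xi>) * free_val u (rest l \<xi>)"

text \<open>Stated for arbitrary words around an arbitrary letter, since a letter ranging over all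
  of \<open>A l\<close> cannot stay centered. Linearity survives because centering is linear and the
  case distinctions of the recursion look only at labels.\<close>

lemma free_val_linear:
  assumes "u \<in> lists letters" "\<xi> \<in> lists letters" "\<eta> \<in> lists letters" "l \<in> I"
  shows "linear_functional (A l) (\<lambda>x. free_val u (\<xi> @ (l, x) # \<eta>))"
  using assms(1-3)
proof (induction u arbitrary: \<xi> \<eta> rule: list.induct)
  case Nil
  then show ?case by (simp add: linear_functional_def)
next
  case (Cons p u)
  obtain k b where p: "p = (k, b)" by force
  have k: "k \<in> I" and b: "b \<in> carrier (A k)" and u: "u \<in> lists letters"
    using Cons.prems(1) by (simp_all add: p)
  interpret X: nc_probability_space "A l" "\<phi> l" by (rule nc[OF assms(4)])
  interpret K: nc_probability_space "A k" "\<phi> k" by (rule nc[OF k])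
  note lin = linear_functional_simps[OF Cons.IH[OF u]]
  show ?case
  proof (cases \<xi>)
    case Nil
    show ?thesis
    proof (cases "l = k")
      case True
      then show ?thesis
        using lin[of "[]" \<eta>] b Cons.prems
        by (simp add: p Nil linear_functional_def K.r_distr K.smult_assoc_right K.center_add K.center_smult
            algebra_simps)
    next
      case False
      then show ?thesis
        using lin[of "[]" \<eta>] lin[of "[(k, K.center b)]" \<eta>] b k Cons.prems
        by (simp add: p Nil linear_functional_def algebra_simps)
    qed
  next
    case (Cons q \<xi>')
    obtain m z where q: "q = (m, z)" by force
    have z: "m \<in> I" "z \<in> carrier (A m)" and \<xi>': "\<xi>' \<in> lists letters"
      using \<open>\<xi> \<in> lists letters\<close> by (auto simp: Cons q)
    show ?thesis
    proof (cases "m = k")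
      case True
      then show ?thesis
        using lin[of "(k, K.center (b \<otimes>\<^bsub>A k\<^esub> z)) # \<xi>'" \<eta>] lin[of \<xi>' \<eta>] b k z \<xi>' Cons.prems
        by (simp add: p Cons q linear_functional_def algebra_simps)
    next
      case False
      then show ?thesis
        using lin[of "(k, K.center b) # (m, z) # \<xi>'" \<eta>] lin[of "(m, z) # \<xi>'" \<eta>] b k z \<xi>' Cons.prems
        by (simp add: p Cons q linear_functional_def algebra_simps)
    qed
  qed
qed

text \<open>Extends \<open>free_val\<close> to words whose head \<open>y\<close> is not yet
  centered, which makes the dependence on the head linear on the whole of
  \<open>A l\<close>.\<close>

definition head_val :: "('i \<times> 'a) list \<Rightarrow> ('i \<times> 'a) list \<Rightarrow> 'i \<Rightarrow> 'a \<Rightarrow> complex" where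
  "head_val u \<xi> l y = free_val u ((l, ctr l y) # \<xi>) + \<phi> l y * free_val u \<xi>"

lemma free_val_Cons:
  "free_val ((l, a) # u) \<xi> = head_val u (rest l \<xi>) l (a \<otimes>\<^bsub>A l\<^esub> head_factor l \<xi>)"
  by (simp add: head_val_def)

lemma head_val_linear:
  assumes "u \<in> lists letters" "\<xi> \<in> lists letters" "l \<in> I"
  shows "linear_functional (A l) (head_val u \<xi> l)"
proof -
  interpret X: nc_probability_space "A l" "\<phi> l" by (rule nc[OF assms(3)])
  show ?thesis
    using linear_functional_simps[OF free_val_linear[OF assms(1) lists.Nil assms(2,3)]]
    by (simp add: linear_functional_def head_val_def X.center_add X.center_smult algebra_simps)
qed

lemma head_val_centered:
  assumes "l \<in> I" "x \<in> carrier (A l)" "\<phi> l x = 0"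
  shows "head_val u \<xi> l x = free_val u ((l, x) # \<xi>)"
proof -
  interpret X: nc_probability_space "A l" "\<phi> l" by (rule nc[OF assms(1)])
  show ?thesis
    using assms by (simp add: head_val_def X.center_eq)
qed

lemma head_val_one:
  assumes "u \<in> lists letters" "\<xi> \<in> lists letters" "l \<in> I"
  shows "head_val u \<xi> l \<one>\<^bsub>A l\<^esub> = free_val u \<xi>"
proof -
  interpret X: nc_probability_space "A l" "\<phi> l" by (rule nc[OF assms(3)])
  show ?thesis
    using linear_functional_simps(2)[OF free_val_linear[OF assms(1) lists.Nil assms(2,3)], of "\<one>\<^bsub>A l\<^esub>" 0]
    by (simp add: head_val_def X.center_one del: X.complex_smult_simps)
qed

text \<open>If the head has label \<open>l\<close>, absorbing the unit takes it off and puts it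
  back; it is unchanged because in a reduced word it is already centered. Otherwise the unit
  contributes a head that centers to zero, and the scalar term remains.\<close>

lemma free_val_unit:
  assumes u: "u \<in> lists letters" and \<xi>: "reduced \<xi>" and l: "l \<in> I"
  shows "free_val ((l, \<one>\<^bsub>A l\<^esub>) # u) \<xi> = free_val u \<xi>"
proof -
  interpret X: nc_probability_space "A l" "\<phi> l" by (rule nc[OF l])
  show ?thesis
  proof (cases "\<exists>x \<eta>. \<xi> = (l, x) # \<eta>")
    case True
    then show ?thesis
      using \<xi> l by (auto simp: free_val_Cons head_val_centered simp del: free_val.simps(2))
  next
    case False
    then have "head_factor l \<xi> = \<one>\<^bsub>A l\<^esub>" "rest l \<xi> = \<xi>"
      by (cases "(l, \<xi>)" rule: rest.cases; auto)+
    then show ?thesis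
      using head_val_one[OF u reduced_letters[OF \<xi>] l]
      by (simp add: free_val_Cons del: free_val.simps(2))
  qed
qed

text \<open>The list is read from the right end of the word, so \<open>b\<close> is absorbed before
  \<open>a\<close>. Then \<open>a\<close> meets the centered head in one term and no letter of its
  label in the other; linearity recombines the two into the absorption of the product.\<close>

lemma free_val_mult:
  assumes u: "u \<in> lists letters" and \<xi>: "reduced \<xi>" and l: "l \<in> I"
    and a: "a \<in> carrier (A l)" and b: "b \<in> carrier (A l)"
  shows "free_val ((l, a \<otimes>\<^bsub>A l\<^esub> b) # u) \<xi> = free_val ((l, b) # (l, a) # u) \<xi>"
proof -
  interpret X: nc_probability_space "A l" "\<phi> l" by (rule nc[OF l])
  have \<xi>l: "\<xi> \<in> lists letters" by (rule reduced_letters[OF \<xi>])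
  note lin = linear_functional_simps[OF head_val_linear[OF u rest_letters[OF \<xi>l] l]]
  define y where "y = b \<otimes>\<^bsub>A l\<^esub> head_factor l \<xi>"
  have y: "y \<in> carrier (A l)" unfolding y_def by (rule absorb_closed[OF l b \<xi>l])
  have "free_val ((l, b) # (l, a) # u) \<xi> =
      head_val u (rest l \<xi>) l (a \<otimes>\<^bsub>A l\<^esub> X.center y) + \<phi> l y * head_val u (rest l \<xi>) l a"
    using \<xi> a by (simp add: free_val_Cons[of _ _ "_ # _"] y_def[symmetric] head_val_def[of "_ # _"]
        free_val_Cons head_factor_rest rest_rest del: free_val.simps(2))
  also have "\<dots> = head_val u (rest l \<xi>) l (a \<otimes>\<^bsub>A l\<^esub> X.center y \<oplus>\<^bsub>A l\<^esub> \<phi> l y \<odot>\<^bsub>A l\<^esub> a)"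
    using a y by (simp add: lin)
  also have "a \<otimes>\<^bsub>A l\<^esub> X.center y \<oplus>\<^bsub>A l\<^esub> \<phi> l y \<odot>\<^bsub>A l\<^esub> a =
      a \<otimes>\<^bsub>A l\<^esub> (X.center y \<oplus>\<^bsub>A l\<^esub> \<phi> l y \<odot>\<^bsub>A l\<^esub> \<one>\<^bsub>A l\<^esub>)"
    using a y by (simp add: X.r_distr X.smult_assoc_right)
  also have "\<dots> = a \<otimes>\<^bsub>A l\<^esub> b \<otimes>\<^bsub>A l\<^esub> head_factor l \<xi>"
    using a b head_factor_closed[OF l \<xi>l] unfolding X.center_decomp[OF y] unfolding y_def by (simp add: X.m_assoc)
  finally show ?thesis
    by (simp add: free_val_Cons del: free_val.simps(2))
qed

lemma free_val_relation:
  assumes u: "u \<in> lists letters" and \<xi>: "reduced \<xi>" and l: "l \<in> I"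
    and r: "r \<in> hom_relations (A l) (Pair l)"
  shows "lin_ext (\<lambda>x. free_val (rev x @ u) \<xi>) r = 0"
proof -
  interpret X: nc_probability_space "A l" "\<phi> l" by (rule nc[OF l])
  have \<xi>l: "\<xi> \<in> lists letters" by (rule reduced_letters[OF \<xi>])
  note lin = linear_functional_simps[OF head_val_linear[OF u rest_letters[OF \<xi>l] l]]
  have add: "free_val ((l, a \<oplus>\<^bsub>A l\<^esub> b) # u) \<xi> = free_val ((l, a) # u) \<xi> + free_val ((l, b) # u) \<xi>"
    if "a \<in> carrier (A l)" "b \<in> carrier (A l)" for a b
    using that head_factor_closed[OF l \<xi>l]
    by (simp add: free_val_Cons X.l_distr lin del: free_val.simps(2))
  have smult: "free_val ((l, c \<odot>\<^bsub>A l\<^esub> a) # u) \<xi> = c * free_val ((l, a) # u) \<xi>"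
    if "a \<in> carrier (A l)" for c a
    using that head_factor_closed[OF l \<xi>l]
    by (simp add: free_val_Cons X.smult_assoc_left lin del: free_val.simps(2))
  show ?thesis
    using r unfolding hom_relations_def
    by (elim UnE CollectE exE conjE insertE emptyE; hypsubst; unfold lin_ext_diff lin_ext_single)
      (simp_all add: add smult free_val_mult[OF u \<xi> l] free_val_unit[OF u \<xi> l] del: free_val.simps(2))
qed

text \<open>Here \<open>v\<close> is the reversed right context. It is absorbed first and leaves a
  linear combination of reduced words, so the relation can be applied in front of each of
  them.\<close>

lemma free_val_relation_context:
  assumes "v \<in> lists letters" and u: "u \<in> lists letters" and "reduced \<xi>" and l: "l \<in> I"
    and r: "r \<in> hom_relations (A l) (Pair l)"
  shows "lin_ext (\<lambda>x. free_val (v @ rev x @ u) \<xi>) r = 0"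
  using assms(1,3)
proof (induction v arbitrary: \<xi> rule: list.induct)
  case Nil
  then show ?case
    using free_val_relation[OF u _ l r] by simp
next
  case (Cons p v)
  obtain k b where p: "p = (k, b)" by force
  define y where "y = b \<otimes>\<^bsub>A k\<^esub> head_factor k \<xi>"
  have k: "k \<in> I" and b: "b \<in> carrier (A k)" and v: "v \<in> lists letters"
    using Cons.prems(1) by (simp_all add: p)
  have "y \<in> carrier (A k)"
    unfolding y_def by (rule absorb_closed[OF k b reduced_letters[OF Cons.prems(2)]])
  then have red: "reduced ((k, ctr k y) # rest k \<xi>)" "reduced (rest k \<xi>)"
    using reduced_Cons_ctr[OF k _ Cons.prems(2)] reduced_rest[OF Cons.prems(2)] by blast+
  show ?case
    using Cons.IH[OF v red(1)] Cons.IH[OF v red(2)]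
    by (simp add: p y_def[symmetric] lin_ext_add_scale)
qed

section \<open>Existence and uniqueness of the free product functional\<close>

lemma compatible_free_val: "F.compatible (\<lambda>w. free_val (rev w) [])"
  unfolding F.compatible_def
proof (intro ballI, elim UN_E)
  fix r u v l
  assume l: "l \<in> I" "r \<in> hom_relations (A l) (Pair l)"
    and "u \<in> carrier (word_monoid letters)" "v \<in> carrier (word_monoid letters)"
  then have "rev v \<in> lists letters" "rev u \<in> lists letters"
    by (simp_all only: word_monoid_simps in_lists_conv_set set_rev)
  then show "lin_ext (\<lambda>x. free_val (rev (u \<otimes>\<^bsub>word_monoid letters\<^esub> x \<otimes>\<^bsub>word_monoid letters\<^esub> v)) []) r = 0"
    using free_val_relation_context[of "rev v" "rev u" "[]", OF _ _ _ l] by simp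
qed

text \<open>Centered letters with alternating labels are stacked without merging and without scalar
  terms. This gives freeness of the induced functional.\<close>

lemma free_val_reduced:
  assumes "reduced (rev u @ \<xi>)"
  shows "free_val u \<xi> = free_val [] (rev u @ \<xi>)"
  using assms
proof (induction u arbitrary: \<xi>)
  case (Cons p u)
  obtain l a where p: "p = (l, a)" by force
  have suffix: "reduced (v @ \<eta>) \<Longrightarrow> reduced \<eta>" for v \<eta>
    by (induction v) (auto simp: split_paired_all)
  have red: "reduced ((l, a) # \<xi>)"
    using Cons.prems suffix[of "rev u" "(l, a) # \<xi>"] by (simp add: p)
  then have l: "l \<in> I" and a: "a \<in> carrier (A l)" and c: "\<phi> l a = 0"
    by auto
  interpret X: nc_probability_space "A l" "\<phi> l" by (rule nc[OF l])
  have "head_factor l \<xi> = \<one>\<^bsub>A l\<^esub>" "rest l \<xi> = \<xi>"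
    using red by (cases "(l, \<xi>)" rule: rest.cases; auto)+
  then have "free_val (p # u) \<xi> = free_val u ((l, a) # \<xi>)"
    using head_val_centered[OF l a c] a by (simp add: p free_val_Cons del: free_val.simps(2))
  then show ?case
    using Cons.IH[of "(l, a) # \<xi>"] Cons.prems by (simp add: p)
qed simp

text \<open>The recursion of \<open>free_val\<close> as an identity in the free product itself. Any
  linear functional obeys it, so its values on reduced words determine it on all words.\<close>

lemma cls_absorb:
  assumes u: "u \<in> lists letters" and \<xi>: "\<xi> \<in> lists letters" and l: "l \<in> I" and a: "a \<in> carrier (A l)"
  defines "y \<equiv> a \<otimes>\<^bsub>A l\<^esub> head_factor l \<xi>"
  shows "F.cls (u @ (l, a) # \<xi>) = F.cls (u @ (l, ctr l y) # rest l \<xi>) \<oplus>\<^bsub>F.Q\<^esub>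
    \<phi> l y \<odot>\<^bsub>F.Q\<^esub> F.cls (u @ rest l \<xi>)"
proof -
  interpret X: nc_probability_space "A l" "\<phi> l" by (rule nc[OF l])
  have r: "rest l \<xi> \<in> lists letters" by (rule rest_letters[OF \<xi>])
  have y: "y \<in> carrier (A l)" unfolding y_def by (rule absorb_closed[OF l a \<xi>])
  have lt: "[(l, x)] \<in> lists letters" if "x \<in> carrier (A l)" for x
    using that l by simp
  have "F.cls (u @ (l, a) # \<xi>) = F.cls (u @ [(l, y)] @ rest l \<xi>)"
  proof (cases "\<exists>x \<eta>. \<xi> = (l, x) # \<eta>")
    case True
    then obtain x \<eta> where x: "\<xi> = (l, x) # \<eta>" by blast
    then have xc: "x \<in> carrier (A l)" "\<eta> \<in> lists letters" using \<xi> by auto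
    have "F.cls (u @ [(l, a \<otimes>\<^bsub>A l\<^esub> x)] @ \<eta>) = F.cls (u @ [(l, a), (l, x)] @ \<eta>)"
      using u a l xc by (intro F.cls_context free_cls_mult) auto
    then show ?thesis
      by (simp add: x y_def)
  next
    case False
    then have "head_factor l \<xi> = \<one>\<^bsub>A l\<^esub>" "rest l \<xi> = \<xi>"
      by (cases "(l, \<xi>)" rule: rest.cases; auto)+
    then show ?thesis
      using a by (simp add: y_def)
  qed
  also have "F.cls (u @ [(l, y)] @ rest l \<xi>) =
      F.cls (u @ [(l, X.center y \<oplus>\<^bsub>A l\<^esub> \<phi> l y \<odot>\<^bsub>A l\<^esub> \<one>\<^bsub>A l\<^esub>)] @ rest l \<xi>)"
    using X.center_decomp[OF y] by simp
  also have "\<dots> = F.cls (u @ [(l, X.center y)] @ rest l \<xi>) \<oplus>\<^bsub>F.Q\<^esub>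
      F.cls (u @ [(l, \<phi> l y \<odot>\<^bsub>A l\<^esub> \<one>\<^bsub>A l\<^esub>)] @ rest l \<xi>)"
    using y by (intro F.cls_context_add free_cls_add u r l lt) simp_all
  also have "F.cls (u @ [(l, \<phi> l y \<odot>\<^bsub>A l\<^esub> \<one>\<^bsub>A l\<^esub>)] @ rest l \<xi>) =
      \<phi> l y \<odot>\<^bsub>F.Q\<^esub> F.cls (u @ [(l, \<one>\<^bsub>A l\<^esub>)] @ rest l \<xi>)"
    by (intro F.cls_context_smult free_cls_smult u r l lt) simp_all
  also have "F.cls (u @ [(l, \<one>\<^bsub>A l\<^esub>)] @ rest l \<xi>) = F.cls (u @ [] @ rest l \<xi>)"
    by (intro F.cls_context free_cls_one u r l lt) simp_all
  finally show ?thesis by simp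
qed

lemma functional_free_val:
  assumes lin: "linear_functional F.Q \<psi>"
    and red: "\<And>\<xi>. reduced \<xi> \<Longrightarrow> \<psi> (F.cls \<xi>) = (if \<xi> = [] then 1 else 0)"
    and "u \<in> lists letters" "reduced \<xi>"
  shows "\<psi> (F.cls (rev u @ \<xi>)) = free_val u \<xi>"
  using assms(3,4)
proof (induction u arbitrary: \<xi> rule: list.induct)
  case (Cons p u)
  obtain l a where p: "p = (l, a)" by force
  have l: "l \<in> I" and a: "a \<in> carrier (A l)" and u: "u \<in> lists letters"
    using Cons.prems(1) by (simp_all add: p)
  define y where "y = a \<otimes>\<^bsub>A l\<^esub> head_factor l \<xi>"
  have \<xi>: "\<xi> \<in> lists letters" by (rule reduced_letters[OF Cons.prems(2)])
  have "y \<in> carrier (A l)"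
    unfolding y_def by (rule absorb_closed[OF l a \<xi>])
  then have red: "reduced ((l, ctr l y) # rest l \<xi>)" "reduced (rest l \<xi>)"
    using reduced_Cons_ctr[OF l _ Cons.prems(2)] reduced_rest[OF Cons.prems(2)] by blast+
  have ru: "rev u \<in> lists letters"
    using u by (simp add: in_lists_conv_set)
  have closed: "F.cls (rev u @ \<eta>) \<in> carrier F.Q" if "reduced \<eta>" for \<eta>
    by (rule F.cls_closed) (use ru reduced_letters[OF that] in simp)
  have "F.cls (rev (p # u) @ \<xi>) = F.cls (rev u @ (l, ctr l y) # rest l \<xi>) \<oplus>\<^bsub>F.Q\<^esub>
    \<phi> l y \<odot>\<^bsub>F.Q\<^esub> F.cls (rev u @ rest l \<xi>)"
    using cls_absorb[OF ru \<xi> l a] by (simp add: p y_def)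
  then have "\<psi> (F.cls (rev (p # u) @ \<xi>)) = \<psi> (F.cls (rev u @ (l, ctr l y) # rest l \<xi>)) +
    \<phi> l y * \<psi> (F.cls (rev u @ rest l \<xi>))"
    using closed[OF red(1)] closed[OF red(2)]
    by (simp only: linear_functional_simps[OF lin] F.Q.complex_smult_simps)
  also have "\<dots> = free_val (p # u) \<xi>"
    using Cons.IH[OF u red(1)] Cons.IH[OF u red(2)] by (simp add: p y_def)
  finally show ?case .
qed (simp add: red)

lemma reduced_map:
  assumes "\<forall>k<n. i k \<in> I \<and> a k \<in> carrier (A (i k)) \<and> \<phi> (i k) (a k) = 0"
    and "\<forall>k. Suc k < n \<longrightarrow> i k \<noteq> i (Suc k)" and "m \<le> n"
  shows "reduced (map (\<lambda>k. (i k, a k)) [m..<n])"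
  using assms(3)
proof (induction rule: inc_induct)
  case (step m)
  have "[m..<n] = m # [Suc m..<n]"
    using step by (simp add: upt_conv_Cons)
  moreover have "[Suc m..<n] = [] \<or> hd [Suc m..<n] = Suc m \<and> Suc m < n"
    by (cases "Suc m < n") simp_all
  ultimately show ?case
    using step assms(1,2) by (auto simp: hd_map)
qed simp

lemma list_prod_free_emb:
  assumes "\<And>k. k < n \<Longrightarrow> i k \<in> I \<and> a k \<in> carrier (A (i k))"
  shows "list_prod (free_product I A) (map (\<lambda>k. free_emb I A (i k) (a k)) [0..<n]) =
    F.cls (map (\<lambda>k. (i k, a k)) [0..<n])"
proof -
  have "set (map (\<lambda>k. (i k, a k)) [0..<n]) \<subseteq> letters"
    using assms by auto
  from F.list_prod_cls[OF this] show ?thesis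
    by (simp add: F_Q F_cls comp_def)
qed

lemma free_product_functional_eq:
  "free_product_functional I A \<phi> = F.induced (\<lambda>w. free_val (rev w) [])"
  unfolding free_product_functional_def
proof (rule the_equality, goal_cases)
  case 1
  let ?\<psi> = "F.induced (\<lambda>w. free_val (rev w) [])"
  note val = F.induced_cls[OF compatible_free_val, unfolded word_monoid_simps]
  have "?\<psi> \<one>\<^bsub>F.Q\<^esub> = 1"
    using val[of "[]"] F.cls_one by simp
  moreover have "?\<psi> (free_emb I A l a) = \<phi> l a" if "l \<in> I" "a \<in> carrier (A l)" for l a
  proof -
    interpret X: nc_probability_space "A l" "\<phi> l" by (rule nc[OF that(1)])
    show ?thesis
      using val[of "[(l, a)]"] that by (simp add: F_cls)
  qed
  moreover have "?\<psi> (list_prod (free_product I A) (map (\<lambda>k. free_emb I A (i k) (a k)) [0..<n])) = 0"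
    if "1 \<le> n" and 1: "\<forall>k<n. i k \<in> I \<and> a k \<in> carrier (A (i k)) \<and> \<phi> (i k) (a k) = 0"
      and 2: "\<forall>k. Suc k < n \<longrightarrow> i k \<noteq> i (Suc k)" for n i a
  proof -
    have red: "reduced (map (\<lambda>k. (i k, a k)) [0..<n])"
      by (rule reduced_map[OF 1 2]) simp
    have "?\<psi> (F.cls (map (\<lambda>k. (i k, a k)) [0..<n])) = 0"
      using val[OF reduced_letters[OF red]] free_val_reduced[of "rev (map (\<lambda>k. (i k, a k)) [0..<n])" "[]"] red that(1)
      by simp
    then show ?thesis
      using list_prod_free_emb[of n i a] 1 by simp
  qed
  ultimately show ?case
    using F.induced_extensional[of "\<lambda>w. free_val (rev w) []"] F.linear_induced[OF compatible_free_val]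
    unfolding F_Q by blast
next
  case (2 \<psi>)
  then have ext: "\<psi> \<in> extensional (carrier F.Q)" and lin: "linear_functional F.Q \<psi>"
    and one: "\<psi> \<one>\<^bsub>F.Q\<^esub> = 1"
    and free: "\<And>n i a. 1 \<le> n \<Longrightarrow> \<forall>k<n. i k \<in> I \<and> a k \<in> carrier (A (i k)) \<and> \<phi> (i k) (a k) = 0 \<Longrightarrow>
      \<forall>k. Suc k < n \<longrightarrow> i k \<noteq> i (Suc k) \<Longrightarrow>
      \<psi> (list_prod (free_product I A) (map (\<lambda>k. free_emb I A (i k) (a k)) [0..<n])) = 0"
    unfolding F_Q by blast+
  have red: "\<psi> (F.cls \<xi>) = (if \<xi> = [] then 1 else 0)" if \<xi>: "reduced \<xi>" for \<xi>
  proof (cases "\<xi> = []")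
    case True
    then show ?thesis
      using one F.cls_one by simp
  next
    case False
    let ?i = "\<lambda>k. fst (\<xi> ! k)" and ?a = "\<lambda>k. snd (\<xi> ! k)"
    have 1: "\<forall>k<length \<xi>. ?i k \<in> I \<and> ?a k \<in> carrier (A (?i k)) \<and> \<phi> (?i k) (?a k) = 0"
      using \<xi> by (induction \<xi> rule: reduced.induct) (auto simp: less_Suc_eq_0_disj)
    have 2: "\<forall>k. Suc k < length \<xi> \<longrightarrow> ?i k \<noteq> ?i (Suc k)"
      using \<xi> by (induction \<xi> rule: reduced.induct) (auto simp: nth_Cons hd_conv_nth split: nat.splits)
    have "map (\<lambda>k. (?i k, ?a k)) [0..<length \<xi>] = \<xi>"
      by (simp add: map_nth)
    moreover have "\<psi> (F.cls (map (\<lambda>k. (?i k, ?a k)) [0..<length \<xi>])) = 0"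
      using free[OF _ 1 2] list_prod_free_emb[of "length \<xi>" ?i ?a] 1 False
      by (simp add: Suc_le_eq)
    ultimately show ?thesis
      using False by simp
  qed
  have vals: "\<psi> (F.cls w) = F.induced (\<lambda>w. free_val (rev w) []) (F.cls w)" if "w \<in> lists letters" for w
  proof -
    have "rev w \<in> lists letters"
      using that by (simp add: in_lists_conv_set)
    then show ?thesis
      using functional_free_val[OF lin red, of "rev w" "[]"] that
      by (simp add: F.induced_cls[OF compatible_free_val])
  qed
  have "\<psi> x = F.induced (\<lambda>w. free_val (rev w) []) x" if "x \<in> carrier F.Q" for x
    by (rule F.linear_functional_eqI[OF lin F.linear_induced[OF compatible_free_val] _ that])
      (rule vals, simp only: word_monoid_simps)
  then show ?case
    by (rule extensionalityI[OF ext F.induced_extensional])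
qed

lemma free_product_functional_cls:
  "w \<in> lists letters \<Longrightarrow> free_product_functional I A \<phi> (F.cls w) = free_val (rev w) []"
  unfolding free_product_functional_eq
  by (rule F.induced_cls[OF compatible_free_val]) simp

end

section \<open>Motzkin words\<close>

text \<open>Motzkin words with the final letter left open: removing letters from the right leaves
  prefixes that need not end in 1. For \<open>j = 1\<close> the window reaches 0, where the set is
  empty.\<close>

fun motzkin_ending :: "nat \<Rightarrow> nat \<Rightarrow> nat list set" where
  "motzkin_ending 0 j = {}"
| "motzkin_ending (Suc 0) j = (if j = 1 then {[1]} else {})"
| "motzkin_ending (Suc (Suc n)) j =
     (if j = 0 then {} else (\<lambda>w. w @ [j]) ` (\<Union>j'\<in>{j - 1..j + 1}. motzkin_ending (Suc n) j'))"

lemma motzkin_ending_0 [simp]: "motzkin_ending n 0 = {}"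
  by (cases "(n, 0 :: nat)" rule: motzkin_ending.cases) auto

lemma finite_motzkin_ending: "finite (motzkin_ending n j)"
  by (induction n j rule: motzkin_ending.induct) auto

lemma motzkin_ending_iff:
  "w \<in> motzkin_ending n j \<longleftrightarrow> length w = n \<and> w \<noteq> [] \<and> (\<forall>j\<in>set w. 1 \<le> j) \<and> hd w = 1 \<and> last w = j \<and>
    (\<forall>k. Suc k < n \<longrightarrow> \<bar>int (w ! Suc k) - int (w ! k)\<bar> \<in> {0, 1})"
proof (induction n j arbitrary: w rule: motzkin_ending.induct)
  case (2 j)
  then show ?case by (auto simp: length_Suc_conv)
next
  case (3 n j)
  show ?case
  proof (cases w rule: rev_cases)
    case (snoc v m)
    have last_v: "last v = v ! n" if "length v = Suc n"
      using that by (cases v rule: rev_cases) auto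
    have steps: "(\<forall>k. Suc k < Suc (Suc n) \<longrightarrow> \<bar>int ((v @ [m]) ! Suc k) - int ((v @ [m]) ! k)\<bar> \<in> {0, 1}) \<longleftrightarrow>
        (\<forall>k. Suc k < Suc n \<longrightarrow> \<bar>int (v ! Suc k) - int (v ! k)\<bar> \<in> {0, 1}) \<and> \<bar>int m - int (last v)\<bar> \<in> {0, 1}"
      if "length v = Suc n"
      using that by (auto simp: nth_append last_v less_Suc_eq)
    have "w \<in> motzkin_ending (Suc (Suc n)) j \<longleftrightarrow>
        j \<noteq> 0 \<and> m = j \<and> (\<exists>j'\<in>{j - 1..j + 1}. v \<in> motzkin_ending (Suc n) j')"
      by (auto simp: snoc)
    also have "\<dots> \<longleftrightarrow> j \<noteq> 0 \<and> m = j \<and> last v \<in> {j - 1..j + 1} \<and> v \<in> motzkin_ending (Suc n) (last v)"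
    proof -
      have last: "last v = j'" if "v \<in> motzkin_ending (Suc n) j'" "j \<noteq> 0" "j' \<in> {j - 1..j + 1}" for j'
        using "3.IH"[OF that(2,3)] that(1) by blast
      show ?thesis (is "?L \<longleftrightarrow> ?R")
      proof
        assume ?L
        then obtain j' where "j \<noteq> 0" "m = j" "v \<in> motzkin_ending (Suc n) j'" "j' \<in> {j - 1..j + 1}"
          by blast
        then show ?R
          using last[of j'] by (simp only: simp_thms)
      qed blast
    qed
    also have "\<dots> \<longleftrightarrow> j \<noteq> 0 \<and> m = j \<and> last v \<in> {j - 1..j + 1} \<and> length v = Suc n \<and> v \<noteq> [] \<and>
        (\<forall>j\<in>set v. 1 \<le> j) \<and> hd v = 1 \<and>
        (\<forall>k. Suc k < Suc n \<longrightarrow> \<bar>int (v ! Suc k) - int (v ! k)\<bar> \<in> {0, 1})"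
      using "3.IH"[of "last v" v] by blast
    also have "\<dots> \<longleftrightarrow> length w = Suc (Suc n) \<and> w \<noteq> [] \<and> (\<forall>j\<in>set w. 1 \<le> j) \<and> hd w = 1 \<and> last w = j \<and>
        (\<forall>k. Suc k < Suc (Suc n) \<longrightarrow> \<bar>int (w ! Suc k) - int (w ! k)\<bar> \<in> {0, 1})"
    proof (cases "length v = Suc n")
      case True
      have "last v \<in> {j - 1..j + 1} \<longleftrightarrow> \<bar>int j - int (last v)\<bar> \<in> {0, 1}" if "j \<noteq> 0"
        using that by auto
      moreover have "v \<noteq> []"
        using True by auto
      ultimately show ?thesis
        using True unfolding snoc steps[OF True] by auto
    qed (simp add: snoc)
    finally show ?thesis .
  qed auto
qed simp

lemma motzkin_words_eq: "motzkin_words n = motzkin_ending n 1"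
  by (auto simp: motzkin_words_def motzkin_ending_iff)

lemma sum_motzkin_ending_Suc:
  assumes "1 \<le> n" "1 \<le> j"
  shows "(\<Sum>w\<in>motzkin_ending (Suc n) j. f w) =
    (\<Sum>j'\<in>{j - 1..j + 1}. \<Sum>w\<in>motzkin_ending n j'. f (w @ [j]))"
proof -
  obtain m where n: "n = Suc m"
    using assms(1) by (cases n) auto
  have "(\<Sum>w\<in>motzkin_ending (Suc n) j. f w) =
      (\<Sum>w\<in>(\<Union>j'\<in>{j - 1..j + 1}. motzkin_ending n j'). f (w @ [j]))"
    using assms(2) by (simp add: n sum.reindex inj_on_def)
  also have "\<dots> = (\<Sum>j'\<in>{j - 1..j + 1}. \<Sum>w\<in>motzkin_ending n j'. f (w @ [j]))"
    \<comment> \<open>The sets are disjoint because their words differ in the last letter.\<close>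
    by (rule sum.UNION_disjoint) (auto simp: finite_motzkin_ending motzkin_ending_iff)
  finally show ?thesis .
qed

lemma list_prod_snoc:
  assumes "Group.monoid R" "set xs \<subseteq> carrier R" "x \<in> carrier R"
  shows "list_prod R (xs @ [x]) = list_prod R xs \<otimes>\<^bsub>R\<^esub> x \<and> list_prod R xs \<in> carrier R"
proof -
  interpret R: Group.monoid R by fact
  show ?thesis
    using assms(2,3) by (induction xs) (auto simp: list_prod_def R.m_assoc)
qed

context nc_family
begin

context
  fixes i :: "nat \<Rightarrow> 'i" and a :: "nat \<Rightarrow> 'a" and n :: nat
  assumes label: "\<And>k. k < n \<Longrightarrow> i k \<in> I" and elt: "\<And>k. k < n \<Longrightarrow> a k \<in> carrier (A (i k))"
    and alternating: "\<And>k. Suc k < n \<Longrightarrow> i k \<noteq> i (Suc k)"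
begin

section \<open>Comparison of the free product expansion with the sum over color words\<close>

definition replicas :: "nat \<Rightarrow> nat list \<Rightarrow> ('i, 'a) tensor_elt" where
  "replicas m w = list_prod T.Q (map (\<lambda>k. replica I A (i k) (w ! k) (a k)) [0..<m])"

definition colored_val :: "nat \<Rightarrow> nat list \<Rightarrow> ('i \<times> 'a) list \<Rightarrow> complex" where
  "colored_val m w \<xi> = \<Phi> (replicas m w \<otimes>\<^bsub>T.Q\<^esub> T.cls (place \<xi>))"

definition prefix_val :: "nat \<Rightarrow> ('i \<times> 'a) list \<Rightarrow> complex" where
  "prefix_val m \<xi> = free_val (rev (map (\<lambda>k. (i k, a k)) [0..<m])) \<xi>"

lemma monoid_TQ: "Group.monoid T.Q"
  using T.Q.ring_axioms ring.is_monoid by blast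

lemma replicas_closed:
  assumes "m \<le> n" "length w = m" "\<forall>j\<in>set w. 1 \<le> j" "k < m"
  shows "replica I A (i k) (w ! k) (a k) \<in> carrier T.Q"
  using assms label elt by (intro replica_closed) auto

lemma replicas_snoc:
  assumes m: "Suc m \<le> n" "length w = m" "\<forall>j\<in>set w. 1 \<le> j" "1 \<le> j"
  shows "replicas (Suc m) (w @ [j]) = replicas m w \<otimes>\<^bsub>T.Q\<^esub> replica I A (i m) j (a m)"
    and "replicas m w \<in> carrier T.Q"
proof -
  let ?r = "\<lambda>k. replica I A (i k) (w ! k) (a k)"
  have "set (map ?r [0..<m]) \<subseteq> carrier T.Q"
    using replicas_closed[of m w] m by auto
  moreover have "replica I A (i m) j (a m) \<in> carrier T.Q"
    using m label elt by (intro replica_closed) auto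
  ultimately have "list_prod T.Q (map ?r [0..<m] @ [replica I A (i m) j (a m)]) =
      list_prod T.Q (map ?r [0..<m]) \<otimes>\<^bsub>T.Q\<^esub> replica I A (i m) j (a m) \<and>
      list_prod T.Q (map ?r [0..<m]) \<in> carrier T.Q"
    by (rule list_prod_snoc[OF monoid_TQ])
  moreover have "map (\<lambda>k. replica I A (i k) ((w @ [j]) ! k) (a k)) [0..<Suc m] =
      map ?r [0..<m] @ [replica I A (i m) j (a m)]"
    using m(2) by (simp add: nth_append)
  ultimately show "replicas (Suc m) (w @ [j]) = replicas m w \<otimes>\<^bsub>T.Q\<^esub> replica I A (i m) j (a m)"
    and "replicas m w \<in> carrier T.Q"
    unfolding replicas_def by (simp_all only:)
qed

lemma colored_val_snoc:
  assumes m: "Suc m \<le> n" "length w = m" "\<forall>j\<in>set w. 1 \<le> j" "1 \<le> j" and \<xi>: "reduced \<xi>"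
  defines "y \<equiv> a m \<otimes>\<^bsub>A (i m)\<^esub> head_factor (i m) \<xi>"
  shows "colored_val (Suc m) (w @ [j]) \<xi> =
    (if j = color (i m) \<xi>
     then colored_val m w ((i m, ctr (i m) y) # rest (i m) \<xi>) + \<phi> (i m) y * colored_val m w (rest (i m) \<xi>)
     else 0)"
proof -
  have im: "i m \<in> I" "a m \<in> carrier (A (i m))"
    using m label elt by auto
  have "replica I A (i m) j (a m) \<in> carrier T.Q" "T.cls (place \<xi>) \<in> carrier T.Q"
    by (rule replica_closed[OF im(1) m(4) im(2)],
        rule T.cls_closed[OF place_closed[OF reduced_letters[OF \<xi>]]])
  then show ?thesis
    unfolding colored_val_def replicas_snoc(1)[OF m] y_def
    using T.Q.m_assoc[OF replicas_snoc(2)[OF m]]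
      tensor_functional_replica[OF replicas_snoc(2)[OF m] \<xi> im m(4)] by simp
qed

lemma colored_val_0:
  assumes "reduced \<xi>"
  shows "colored_val 0 w \<xi> = free_val [] \<xi>"
  using place_closed[OF reduced_letters[OF assms]] tensor_val_place[OF assms]
  by (simp add: colored_val_def replicas_def list_prod_def tensor_functional_cls)

lemma prefix_val_Suc:
  "prefix_val (Suc m) \<xi> =
    (let y = a m \<otimes>\<^bsub>A (i m)\<^esub> head_factor (i m) \<xi> in
      prefix_val m ((i m, ctr (i m) y) # rest (i m) \<xi>) + \<phi> (i m) y * prefix_val m (rest (i m) \<xi>))"
  by (simp add: prefix_val_def Let_def)

lemma color_cases: "color l \<xi> = length \<xi> \<and> \<xi> \<noteq> [] \<or> color l \<xi> = Suc (length \<xi>)"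
  by (cases "(l, \<xi>)" rule: rest.cases) (auto simp: color_def)

text \<open>On a reduced word only one color of the last letter contributes, so a word of colors
  contributes only if the colors are those along which \<open>free_val\<close> expands; since consecutive
  labels differ, these color words have steps in \<open>{-1, 0, 1}\<close>.\<close>

lemma sum_colored_val:
  assumes "Suc m \<le> n" "reduced \<xi>"
  shows "(\<Sum>w\<in>motzkin_ending (Suc m) j. colored_val (Suc m) w \<xi>) =
    (if j = color (i m) \<xi> then prefix_val (Suc m) \<xi> else 0)"
  using assms
proof (induction m arbitrary: j \<xi>)
  case 0
  define y where "y = a 0 \<otimes>\<^bsub>A (i 0)\<^esub> head_factor (i 0) \<xi>"
  have im: "i 0 \<in> I" "a 0 \<in> carrier (A (i 0))"
    using 0 label elt by auto
  have "y \<in> carrier (A (i 0))"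
    unfolding y_def by (rule absorb_closed[OF im reduced_letters[OF 0(2)]])
  then have red: "reduced ((i 0, ctr (i 0) y) # rest (i 0) \<xi>)" "reduced (rest (i 0) \<xi>)"
    using reduced_Cons_ctr[OF im(1) _ 0(2)] reduced_rest[OF 0(2)] by blast+
  \<comment> \<open>The term with a new centered head vanishes, since a nonempty word has value 0
    once no letters are left.\<close>
  have F: "prefix_val (Suc 0) \<xi> = \<phi> (i 0) y * free_val [] (rest (i 0) \<xi>)"
    unfolding prefix_val_Suc y_def[symmetric] Let_def by (simp add: prefix_val_def)
  show ?case
  proof (cases "j = 1")
    case True
    have "colored_val (Suc 0) ([] @ [1]) \<xi> = (if 1 = color (i 0) \<xi> then prefix_val (Suc 0) \<xi> else 0)"
      using colored_val_snoc[OF 0(1) list.size(3) _ order_refl 0(2)]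
        colored_val_0[OF red(1)] colored_val_0[OF red(2)]
      by (simp only: F y_def[symmetric] list.set ball_empty simp_thms free_val.simps list.distinct
          add_0_left if_False)
    then show ?thesis
      by (simp add: True)
  \<comment> \<open>An active color other than 1 means that \<open>rest (i 0) \<xi>\<close> is
    nonempty, so its value is 0. This forces contributing color words to start with 1.\<close>
  next
    case False
    then show ?thesis
      by (auto simp: F color_def)
  qed
next
  case (Suc m)
  define l where "l = i (Suc m)"
  define y where "y = a (Suc m) \<otimes>\<^bsub>A l\<^esub> head_factor l \<xi>"
  define \<eta> where "\<eta> = (l, ctr l y) # rest l \<xi>"
  have im: "l \<in> I" "a (Suc m) \<in> carrier (A l)"
    using Suc.prems label elt by (auto simp: l_def)
  have ne: "i m \<noteq> l"
    unfolding l_def using alternating Suc.prems by simp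
  have "y \<in> carrier (A l)"
    unfolding y_def by (rule absorb_closed[OF im reduced_letters[OF Suc.prems(2)]])
  then have red: "reduced \<eta>" "reduced (rest l \<xi>)"
    unfolding \<eta>_def using reduced_Cons_ctr[OF im(1) _ Suc.prems(2)] reduced_rest[OF Suc.prems(2)] by blast+
  have m: "Suc m \<le> n"
    using Suc.prems by simp
  show ?case
  proof (cases "j = 0")
    case True
    then show ?thesis
      by (simp add: color_def)
  next
    case False
    have step: "colored_val (Suc (Suc m)) (w @ [j]) \<xi> =
        (if j = color l \<xi> then colored_val (Suc m) w \<eta> + \<phi> l y * colored_val (Suc m) w (rest l \<xi>) else 0)"
      if "w \<in> motzkin_ending (Suc m) j'" for w j'
    proof -
      have "length w = Suc m" "\<forall>j\<in>set w. 1 \<le> j" "1 \<le> j"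
        using that False by (simp_all add: motzkin_ending_iff)
      from colored_val_snoc[OF Suc.prems(1) this Suc.prems(2)] show ?thesis
        by (simp only: l_def y_def \<eta>_def)
    qed
    have "(\<Sum>w\<in>motzkin_ending (Suc (Suc m)) j. colored_val (Suc (Suc m)) w \<xi>) =
        (\<Sum>j'\<in>{j - 1..j + 1}. \<Sum>w\<in>motzkin_ending (Suc m) j'. colored_val (Suc (Suc m)) (w @ [j]) \<xi>)"
      using False by (intro sum_motzkin_ending_Suc) auto
    also have "\<dots> = (\<Sum>j'\<in>{j - 1..j + 1}. \<Sum>w\<in>motzkin_ending (Suc m) j'.
        if j = color l \<xi> then colored_val (Suc m) w \<eta> + \<phi> l y * colored_val (Suc m) w (rest l \<xi>) else 0)"
      by (intro sum.cong refl step)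
    also have "\<dots> = (if j = color l \<xi> then prefix_val (Suc (Suc m)) \<xi> else 0)"
    proof (cases "j = color l \<xi>")
      case True
      \<comment> \<open>These lengths bound the active color of the preceding letter: it is
        \<open>j + 1\<close> on \<open>\<eta>\<close>, whose head has a different label, and
        \<open>j - 1\<close> or \<open>j\<close> on \<open>rest l \<xi>\<close>. So the window of
        Motzkin steps contains every color that contributes.\<close>
      have len: "length (rest l \<xi>) = j - 1" "length \<eta> = j"
        using True by (simp_all add: color_def \<eta>_def)
      have "rest (i m) \<eta> = \<eta>"
        using ne by (simp add: \<eta>_def)
      then have c1: "color (i m) \<eta> \<in> {j - 1..j + 1}"
        using len by (simp add: color_def)
      have c2: "color (i m) (rest l \<xi>) \<in> {j - 1..j + 1}"
        using color_cases[of "i m" "rest l \<xi>"] len False by auto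
      have "(\<Sum>j'\<in>{j - 1..j + 1}. \<Sum>w\<in>motzkin_ending (Suc m) j'.
          colored_val (Suc m) w \<eta> + \<phi> l y * colored_val (Suc m) w (rest l \<xi>)) =
          (\<Sum>j'\<in>{j - 1..j + 1}. (if j' = color (i m) \<eta> then prefix_val (Suc m) \<eta> else 0)) +
          \<phi> l y * (\<Sum>j'\<in>{j - 1..j + 1}. (if j' = color (i m) (rest l \<xi>) then prefix_val (Suc m) (rest l \<xi>) else 0))"
        unfolding Suc.IH[OF m red(1), symmetric] Suc.IH[OF m red(2), symmetric]
        by (simp only: sum.distrib sum_distrib_left)
      also have "\<dots> = prefix_val (Suc m) \<eta> + \<phi> l y * prefix_val (Suc m) (rest l \<xi>)"
        using c1 c2 by (simp only: sum.delta finite_atLeastAtMost if_True)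
      also have "\<dots> = prefix_val (Suc (Suc m)) \<xi>"
        unfolding prefix_val_Suc[of "Suc m"] Let_def l_def[symmetric] y_def[symmetric] \<eta>_def ..
      finally show ?thesis
        using True by simp
    qed simp
    finally show ?thesis
      by (simp only: l_def)
  qed
qed

lemma tensor_functional_replicas:
  assumes "1 \<le> n" "w \<in> motzkin_words n"
  shows "replica_functional I A \<phi>
      (list_prod (tensor_algebra I A) (map (\<lambda>k. replica I A (i k) (w ! k) (a k)) [0..<n])) =
    colored_val n w []"
proof -
  have w: "length w = n" "\<forall>j\<in>set w. 1 \<le> j"
    using assms(2) by (simp_all add: motzkin_words_eq motzkin_ending_iff)
  have r: "replica I A (i k) (w ! k) (a k) \<in> carrier T.Q" if "k < n" for k
    by (rule replicas_closed[OF order_refl w that])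
  \<comment> \<open>The functional \<Phi> of the theorem is a restriction, \<open>undefined\<close>
    off the replica algebra, so membership of the product has to be shown.\<close>
  have gen: "list_prod T.Q xs \<in> replica_algebra I A"
    if "set xs \<subseteq> {replica I A i j a | i j a. i \<in> I \<and> 1 \<le> j \<and> a \<in> carrier (A i)}" for xs
    using that
  proof (induction xs)
    case Nil
    then show ?case
      using generated_subalgebra.one by (simp add: replica_algebra_def list_prod_def T_Q)
  next
    case (Cons x xs)
    have "x \<in> replica_algebra I A" "list_prod T.Q xs \<in> replica_algebra I A"
      using Cons by (auto simp: replica_algebra_def intro: generated_subalgebra.incl)
    then show ?case
      unfolding replica_algebra_def T_Q
      by (simp only: list_prod_def foldr.simps o_apply generated_subalgebra.mult)
  qed
  have "replicas n w \<in> replica_algebra I A"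
    unfolding replicas_def using w label elt by (intro gen) fastforce
  moreover have "replicas n w \<in> carrier T.Q"
    using monoid_TQ r unfolding replicas_def
    by (intro list_prod_snoc[THEN conjunct2, OF _ _ monoid.one_closed[OF monoid_TQ]]) auto
  moreover have "T.cls (place []) = \<one>\<^bsub>T.Q\<^esub>"
    using T.cls_one by simp
  ultimately show ?thesis
    using T.Q.r_one unfolding replica_functional_def colored_val_def
    by (simp add: replicas_def T_Q)
qed

lemma free_product_functional_eq_sum:
  assumes "1 \<le> n"
  shows "free_product_functional I A \<phi>
      (list_prod (free_product I A) (map (\<lambda>k. free_emb I A (i k) (a k)) [0..<n])) =
    (\<Sum>w\<in>motzkin_words n. replica_functional I A \<phi>
      (list_prod (tensor_algebra I A) (map (\<lambda>k. replica I A (i k) (w ! k) (a k)) [0..<n])))"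
proof -
  obtain m where m: "n = Suc m"
    using assms by (cases n) auto
  have "map (\<lambda>k. (i k, a k)) [0..<n] \<in> lists letters"
    using label elt by (auto simp: in_lists_conv_set)
  then have "free_product_functional I A \<phi>
      (list_prod (free_product I A) (map (\<lambda>k. free_emb I A (i k) (a k)) [0..<n])) = prefix_val n []"
    using list_prod_free_emb[of n i a] label elt by (simp add: free_product_functional_cls prefix_val_def)
  \<comment> \<open>On the empty word the active color of the last letter is 1, so the contributing
    color words are exactly those ending in 1.\<close>
  also have "\<dots> = (\<Sum>w\<in>motzkin_words n. colored_val n w [])"
    using sum_colored_val[of m "[]" 1] by (simp add: m motzkin_words_eq color_def)
  also have "\<dots> = (\<Sum>w\<in>motzkin_words n. replica_functional I A \<phi>
      (list_prod (tensor_algebra I A) (map (\<lambda>k. replica I A (i k) (w ! k) (a k)) [0..<n])))"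
    by (intro sum.cong refl tensor_functional_replicas[symmetric] assms)
  finally show ?thesis .
qed

end

end

theorem corollary5p1:
  fixes I :: "'i set"
    and A :: "'i \<Rightarrow> (complex, 'a) module"
    and \<phi> :: "'i \<Rightarrow> 'a \<Rightarrow> complex"
    and n :: nat
    and i :: "nat \<Rightarrow> 'i"
    and a :: "nat \<Rightarrow> 'a"
  assumes "\<And>l. l \<in> I \<Longrightarrow> nc_probability_space (A l) (\<phi> l)"
    and "1 \<le> n"
    and "\<And>k. k < n \<Longrightarrow> i k \<in> I"
    and "\<And>k. k < n \<Longrightarrow> a k \<in> carrier (A (i k))"
    and "\<And>k. Suc k < n \<Longrightarrow> i k \<noteq> i (Suc k)"
  shows "free_product_functional I A \<phi>
           (list_prod (free_product I A) (map (\<lambda>k. free_emb I A (i k) (a k)) [0..<n])) =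
         (\<Sum>w\<in>motzkin_words n.
           replica_functional I A \<phi>
             (list_prod (tensor_algebra I A) (map (\<lambda>k. replica I A (i k) (w ! k) (a k)) [0..<n])))"
proof -
  interpret nc_family I A \<phi>
    by (rule nc_family.intro) (rule assms(1))
  show ?thesis
    by (rule free_product_functional_eq_sum[where n = n and i = i and a = a, OF assms(3,4,5,2)])
qed

end
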